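(* Let $T=\sum_{k=M}^N Q_k(z)D^k$, with $Q_k\in\mathbb{R}[z]$ and $Q_MQ_N\not\equiv 0$, be a non-degenerate hyperbolicity preserver with nonnegative Fuchs index $r$, let $n\ge M$ be an integer, and let $B,C\in\binom{[n+r]}{n}$. If $B\rightarrow C$ then $f_{B,n}\ll f_{C,n}$. Moreover, if in addition $B\ne C$ and there is no $\theta\in\mathbb{R}$ for which $Q_1(\theta)=\cdots=Q_n(\theta)=0$, then $f_{B,n}$ and $f_{C,n}$ are co-prime, i.e., their zeros strictly interlace.
   Context: $D=d/dz$, $[m]=\{1,\dots,m\}$, $\binom{[m]}{n}$ is the set of $n$-element subsets of $[m]$, and $Q_k\equiv 0$ for $k<M$ or $k>N$. A nonzero polynomial in $\mathbb{R}[z]$ is hyperbolic if all its zeros are real. A linear operator $T:\mathbb{R}[z]\to\mathbb{R}[z]$ preserves hyperbolicity (is a hyperbolicity preserver) if $T(f)$ is hyperbolic or identically zero whenever $f$ is hyperbolic. The Fuchs index of $T$ is $r=\max_k(\deg Q_k-k)$ (over $k$ with $Q_k\not\equiv0$); $T$ is non-degenerate if $\deg Q_N=N+r$. Proper position of polynomials: the zeros $\alpha_1\le\cdots\le\alpha_p$ of $f$ and $\beta_1\le\cdots\le\beta_q$ of $g$ (hyperbolic, zeros with multiplicity) interlace if $\alpha_1\le\beta_1\le\alpha_2\le\beta_2\le\cdots$ or $\beta_1\le\alpha_1\le\beta_2\le\alpha_2\le\cdots$ (so $|p-q|\le1$; zeros of any two polynomials of degree $0$ or $1$ interlace). Write $f\ll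 g$ if the zeros of $f$ and $g$ interlace and $f'g-fg'\le 0$ on all of $\mathbb{R}$. The polynomials $f_{B,n}$, $v_{A,n}$: a pair $(v,f)$ of hyperbolic polynomials of degrees $r$ and $n$ has zero pattern $(A,B)$, where $A\cup B=[n+r]$ is a disjoint union with $|A|=r$, $|B|=n$, if, with $\alpha_1\le\cdots\le\alpha_{n+r}$ the zeros of $vf$, the zeros of $v$ are $\{\alpha_i:i\in A\}$ and those of $f$ are $\{\alpha_i:i\in B\}$ (as multisets). Given $B\in\binom{[n+r]}{n}$ and $A=[n+r]\setminus B$, let $a$ be the smallest zero of $Q_e$, $e=\min(n,N)$, put $f_0=(z-a)^n$, and recursively let $T(f_i)=v_{i+1}f_{i+1}$ be the unique factorization with $f_{i+1}$ monic and $(v_{i+1},f_{i+1})$ of zero pattern $(A,B)$. It is known that the limits $f_{B,n}:=\lim_i f_i$ and $v_{A,n}:=\lim_i v_i$ exist, that $T(f_{B,n})=v_{A,n}f_{B,n}$ with $f_{B,n}$ monic of degree $n$, and that $(v_{A,n},f_{B,n})$ has zero pattern $(A,B)$. The relation $\rightarrow$: for $B=\{b_1<\cdots<b_n\}$ and $C=\{c_1<\cdots<c_n\}$ in $\binom{[n+r]}{n}$, $B\rightarrow C$ means $2b_1\le 2c_1+1\le 2b_2\le 2c_2+1\le\cdots\le 2b_n\le 2c_n+1$. *)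

theory Defs
  imports "HOL-Computational_Algebra.Computational_Algebra"
begin

definition hyperbolic :: "real poly \<Rightarrow> bool" where
  "hyperbolic p \<longleftrightarrow>
     p \<noteq> 0 \<and> (\<forall>z. poly (map_poly complex_of_real p) z = 0 \<longrightarrow> z \<in> \<real>)"

definition hyperbolicity_preserver :: "(real poly \<Rightarrow> real poly) \<Rightarrow> bool" where
  "hyperbolicity_preserver T \<longleftrightarrow>
     Vector_Spaces.linear smult smult T \<and>
     (\<forall>f. hyperbolic f \<longrightarrow> hyperbolic (T f) \<or> T f = 0)"

definition diff_op :: "(nat \<Rightarrow> real poly) \<Rightarrow> nat \<Rightarrow> nat \<Rightarrow> real poly \<Rightarrow> real poly" where
  "diff_op Q M N f = (\<Sum>k=M..N. Q k * (pderiv ^^ k) f)"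

lemma linear_diff_op: "Vector_Spaces.linear smult smult (diff_op Q M N)"
proof -
  have add: "(pderiv ^^ k) (f + g) = (pderiv ^^ k) f + (pderiv ^^ k) g" for k and f g :: "real poly"
    by (induction k) (simp_all add: pderiv_add)
  have scale: "(pderiv ^^ k) (smult c f) = smult c ((pderiv ^^ k) f)" for k c and f :: "real poly"
    by (induction k) (simp_all add: pderiv_smult)
  have sum: "smult c (sum F S) = (\<Sum>k\<in>S. smult c (F k))"
    for c :: real and F :: "nat \<Rightarrow> real poly" and S
    by (induction S rule: infinite_finite_induct) (simp_all add: smult_add_right)
  show ?thesis
    by unfold_locales
       (simp_all add: diff_op_def add scale sum smult_add_right smult_add_left
         sum.distrib distrib_left)
qed

definition fuchs_index :: "(nat \<Rightarrow> real poly) \<Rightarrow> nat \<Rightarrow> nat \<Rightarrow> int" where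
  "fuchs_index Q M N =
     Max ((\<lambda>k. int (degree (Q k)) - int k) ` {k \<in> {M..N}. Q k \<noteq> 0})"

definition non_degenerate :: "(nat \<Rightarrow> real poly) \<Rightarrow> nat \<Rightarrow> nat \<Rightarrow> bool" where
  "non_degenerate Q M N \<longleftrightarrow> int (degree (Q N)) = int N + fuchs_index Q M N"

definition zeros :: "real poly \<Rightarrow> real list" where
  "zeros p = sorted_list_of_multiset (proots p)"

text \<open>If \<^term>\<open>xs\<close> is as long as \<^term>\<open>ys\<close> or longer by one, then \<^term>\<open>splice xs ys\<close>
  is the alternating list \<open>x\<^sub>1, y\<^sub>1, x\<^sub>2, y\<^sub>2, \<dots>\<close>.\<close>

definition chain :: "('a \<Rightarrow> 'a \<Rightarrow> bool) \<Rightarrow> 'a list \<Rightarrow> 'a list \<Rightarrow> bool" where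
  "chain R xs ys \<longleftrightarrow>
     (length xs = length ys \<or> length xs = Suc (length ys)) \<and> sorted_wrt R (splice xs ys)"

definition interlace :: "real poly \<Rightarrow> real poly \<Rightarrow> bool" where
  "interlace f g \<longleftrightarrow> hyperbolic f \<and> hyperbolic g \<and>
     (chain (\<le>) (zeros f) (zeros g) \<or> chain (\<le>) (zeros g) (zeros f))"

definition strictly_interlace :: "real poly \<Rightarrow> real poly \<Rightarrow> bool" where
  "strictly_interlace f g \<longleftrightarrow> hyperbolic f \<and> hyperbolic g \<and>
     (chain (<) (zeros f) (zeros g) \<or> chain (<) (zeros g) (zeros f))"

definition proper_position :: "real poly \<Rightarrow> real poly \<Rightarrow> bool" where
  "proper_position f g \<longleftrightarrow> interlace f g \<and>
     (\<forall>x. poly (pderiv f * g - f * pderiv g) x \<le> 0)"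

text \<open>The zeros of \<open>vf\<close> are numbered from 1, list positions from 0.\<close>

definition zero_pattern :: "nat set \<Rightarrow> nat set \<Rightarrow> real poly \<Rightarrow> real poly \<Rightarrow> bool" where
  "zero_pattern A B v f \<longleftrightarrow>
     hyperbolic v \<and> hyperbolic f \<and>
     A \<union> B = {1..degree f + degree v} \<and> A \<inter> B = {} \<and>
     card A = degree v \<and> card B = degree f \<and>
     proots v = image_mset (\<lambda>i. zeros (v * f) ! (i - 1)) (mset_set A) \<and>
     proots f = image_mset (\<lambda>i. zeros (v * f) ! (i - 1)) (mset_set B)"

definition pattern_factorization ::
    "nat set \<Rightarrow> nat set \<Rightarrow> real poly \<Rightarrow> real poly \<times> real poly" where
  "pattern_factorization A B p =
     (THE (v, f). p = v * f \<and> lead_coeff f = 1 \<and> zero_pattern A B v f)"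

primrec pattern_iterate ::
    "(real poly \<Rightarrow> real poly) \<Rightarrow> nat set \<Rightarrow> nat set \<Rightarrow> real poly \<Rightarrow> nat \<Rightarrow> real poly" where
  "pattern_iterate T A B f0 0 = f0"
| "pattern_iterate T A B f0 (Suc i) =
     snd (pattern_factorization A B (T (pattern_iterate T A B f0 i)))"

text \<open>Coefficientwise convergence is convergence in the finite-dimensional space of
  polynomials of degree at most \<open>n\<close>; all iterates above have the same degree.\<close>

definition poly_lim :: "(nat \<Rightarrow> real poly) \<Rightarrow> real poly" where
  "poly_lim X = (THE p. \<forall>k. (\<lambda>i. coeff (X i) k) \<longlonglongrightarrow> coeff p k)"

text \<open>\<^term>\<open>eigenpoly Q M N r n B\<close> is \<open>f\<^bsub>B,n\<^esub>\<close>, where \<open>r\<close> is the Fuchs index. If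
  \<open>Q\<^sub>e\<close> has no zero (\<open>e = r = 0\<close>), the starting point \<open>a\<close> is an unspecified real; then
  \<open>n = 0\<close>, or the operator is multiplication by a constant and every choice of \<open>a\<close> is
  admissible.\<close>

definition eigenpoly ::
    "(nat \<Rightarrow> real poly) \<Rightarrow> nat \<Rightarrow> nat \<Rightarrow> nat \<Rightarrow> nat \<Rightarrow> nat set \<Rightarrow> real poly" where
  "eigenpoly Q M N r n B =
     (let A = {1..n + r} - B;
          a = Min {x. poly (Q (min n N)) x = 0}
      in poly_lim (pattern_iterate (diff_op Q M N) A B ([:- a, 1:] ^ n)))"

definition arrow :: "nat set \<Rightarrow> nat set \<Rightarrow> bool" where
  "arrow B C \<longleftrightarrow>
     chain (\<le>) (map (\<lambda>b. 2 * b) (sorted_list_of_set B))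
                (map (\<lambda>c. 2 * c + 1) (sorted_list_of_set C))"

end

theory Submission
  imports Defs
begin

text \<open>Zeros of \<open>T((z - x) h)\<close> are nondecreasing in \<open>x\<close> and interlace those of \<open>T(h)\<close>, because
  \<open>T(z h) - x T(h)\<close> is hyperbolic for every real \<open>x\<close>. Moving one zero at a time, \<open>T\<close> is monotone on
  zero vectors and preserves interlacing; the relation \<open>B \<rightarrow> C\<close> is what makes the extraction of the
  factor with pattern \<open>B\<close> or \<open>C\<close> preserve interlacing as well. Starting from \<open>(z - a)\<^sup>n\<close>, the iteration
  increases and stays bounded, so interlacing passes to the limits.

  If the limits \<open>f\<close> and \<open>g\<close> share a zero \<open>\<theta>\<close>, monotonicity keeps the zero \<open>\<theta>\<close> of \<open>T(f)\<close> and
  \<open>T(g)\<close> alive for all mixtures of the zeros of \<open>f\<close> and \<open>g\<close>, so \<open>T(d u)(\<theta>) = 0\<close> for a fixed \<open>d\<close> and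
  all \<open>u\<close> of bounded degree. In terms of the symbol \<open>p(w) = \<Sum> Q\<^sub>k(\<theta>) w\<^sup>k\<close>, which is hyperbolic or
  zero, the factors of \<open>d\<close> act as operators \<open>D - c\<close>; as these create no multiple zeros, \<open>p\<close> must
  vanish to high order at \<open>0\<close>, which gives \<open>Q\<^sub>1(\<theta>) = \<dots> = Q\<^sub>n(\<theta>) = 0\<close>.\<close>

section \<open>Hyperbolic polynomials\<close>

text \<open>Moving zeros needs two facts that are not hypotheses: T(z h) - x T(h) must have degree
  exactly one more than T(h), and the two leading coefficients must have the same sign, or else the
  zeros would move left. On degree m, T multiplies the leading coefficient by \<open>lam m\<close>,
  so both facts come down to \<open>lam\<close> being nonzero and of constant sign from M on.
  Nondegeneracy settles this for large m only; preservation of hyperbolicity carries it down to M.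

  The iteration starts at the smallest zero of Q_e because a zero of Q_k forces a zero of Q_(k+1) at
  or left of it, so no Q_k with M \<le> k \<le> e changes sign further left.

  Comparisons use the counts \<open>nz\<close> of zeros up to t: they add under products, and their
  jump at \<theta> is the multiplicity there. Multiplicities cannot be avoided, since the fixed
  factor d may itself vanish at \<theta>.

  The symbol is hyperbolic for the same reason that common zeros are restricted: a nonreal zero of
  an approximant makes T(F) and T(R) vanish at \<theta>, where F and R come from the real and
  imaginary parts of a power of a nonreal linear factor; they span a pencil with moving zeros, and
  persistence under mixing then makes T(u) vanish at \<theta> for all u of bounded degree.\<close>

abbreviation cpoly :: "real poly \<Rightarrow> complex \<Rightarrow> complex" where
  "cpoly p z \<equiv> poly (map_poly complex_of_real p) z"

lemma map_poly_of_real_add: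
  "map_poly complex_of_real (p + q) = map_poly of_real p + map_poly of_real q"
  by (rule poly_eqI) (simp add: coeff_map_poly)

lemma map_poly_of_real_mult:
  "map_poly complex_of_real (p * q) = map_poly of_real p * map_poly of_real q"
  by (rule poly_eqI) (simp add: coeff_map_poly coeff_mult)

lemma cpoly_mult: "cpoly (p * q) z = cpoly p z * cpoly q z"
  by (simp add: map_poly_of_real_mult)

lemma cpoly_add: "cpoly (p + q) z = cpoly p z + cpoly q z"
  by (simp add: map_poly_of_real_add)

lemma cpoly_smult: "cpoly (smult c p) z = of_real c * cpoly p z"
  by (simp add: map_poly_smult)

lemma cpoly_diff: "cpoly (p - q) z = cpoly p z - cpoly q z"
  using cpoly_add[of p "smult (-1) q" z] cpoly_smult[of "-1" q z] by simp

lemma cpoly_of_real: "cpoly p (of_real x) = of_real (poly p x)"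
  by (induction p) (simp_all add: map_poly_pCons)

definition rp :: "real multiset \<Rightarrow> real poly" where
  "rp A = (\<Prod>x\<in>#A. [:- x, 1:])"

lemma rp_empty [simp]: "rp {#} = 1"
  by (simp add: rp_def)

lemma rp_add_mset [simp]: "rp (add_mset x A) = [:- x, 1:] * rp A"
  by (simp add: rp_def)

lemma rp_union: "rp (A + B) = rp A * rp B"
  by (simp add: rp_def)

lemma monic_rp: "lead_coeff (rp A) = 1"
  by (induction A) (simp_all add: lead_coeff_mult del: mult_pCons_left)

lemma rp_nz [simp]: "rp A \<noteq> 0"
  using monic_rp[of A] by auto

lemma degree_rp: "degree (rp A) = size A"
  by (induction A) (simp_all add: degree_mult_eq del: mult_pCons_left)

lemma proots_rp [simp]: "proots (rp A) = A"
  by (induction A) (simp_all add: proots_mult del: mult_pCons_left)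

lemma hyperbolic_nz: "hyperbolic p \<Longrightarrow> p \<noteq> 0"
  by (simp add: hyperbolic_def)

lemma hyperbolic_mult_iff: "hyperbolic (p * q) \<longleftrightarrow> hyperbolic p \<and> hyperbolic q"
  by (auto simp: hyperbolic_def cpoly_mult)

lemma hyperbolic_linear: "hyperbolic [:- x, 1:]"
proof -
  have "z \<in> \<real>" if "z - of_real x = 0" for z :: complex
    using that by (metis Reals_of_real eq_iff_diff_eq_0)
  thus ?thesis by (auto simp: hyperbolic_def map_poly_pCons)
qed

lemma hyperbolic_const: "c \<noteq> 0 \<Longrightarrow> hyperbolic [:c:]"
  by (simp add: hyperbolic_def map_poly_pCons)

lemma hyperbolic_smult: "c \<noteq> 0 \<Longrightarrow> hyperbolic (smult c p) \<longleftrightarrow> hyperbolic p"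
  by (auto simp: hyperbolic_def cpoly_smult)

lemma hyperbolic_rp: "hyperbolic (rp A)"
proof (induction A)
  case empty
  then show ?case using hyperbolic_const[of 1] by (simp add: one_pCons)
next
  case (add x A)
  then show ?case
    by (simp add: hyperbolic_mult_iff hyperbolic_linear del: mult_pCons_left)
qed

lemma hyperbolic_has_root:
  assumes "hyperbolic p" "degree p > 0"
  obtains x where "poly p x = 0"
proof -
  have "\<not> constant (poly (map_poly complex_of_real p))"
    using assms(2) by (simp add: constant_degree degree_map_poly)
  then obtain z where z: "cpoly p z = 0"
    using fundamental_theorem_of_algebra by blast
  then have "z \<in> \<real>" using assms(1) by (simp add: hyperbolic_def)
  then obtain x where "z = of_real x" by (auto elim: Reals_cases)
  with z have "poly p x = 0" by (simp add: cpoly_of_real)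
  then show thesis ..
qed

lemma hyperbolic_eq_rp:
  assumes "hyperbolic p"
  obtains c A where "c \<noteq> 0" "p = smult c (rp A)"
  using assms
proof (induction "degree p" arbitrary: p thesis)
  case 0
  then obtain c where c: "p = [:c:]" using degree_0_id by metis
  have "c \<noteq> 0" using c 0 hyperbolic_nz by force
  then show ?case using 0(2)[of c "{#}"] c by simp
next
  case (Suc n)
  obtain x where "poly p x = 0"
    using hyperbolic_has_root Suc by (metis zero_less_Suc)
  then obtain q where q: "p = [:- x, 1:] * q"
    by (auto simp: poly_eq_0_iff_dvd elim: dvdE)
  have hq: "hyperbolic q" using Suc.prems q hyperbolic_mult_iff by blast
  have "degree p = Suc (degree q)"
    using hyperbolic_nz[OF hq] q by (simp add: degree_mult_eq del: mult_pCons_left)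
  then obtain c A where "c \<noteq> 0" "q = smult c (rp A)"
    using Suc.hyps(1)[of q] hq Suc.hyps(2) by auto
  then have "p = smult c (rp (add_mset x A))" using q by (simp del: mult_pCons_left)
  then show ?case using Suc.prems(1) \<open>c \<noteq> 0\<close> by blast
qed

lemma hyperbolic_factor:
  assumes "hyperbolic p"
  shows "p = smult (lead_coeff p) (rp (proots p))"
proof -
  obtain c A where "c \<noteq> 0" "p = smult c (rp A)" by (rule hyperbolic_eq_rp[OF assms])
  then show ?thesis using monic_rp[of A] by simp
qed

lemma hyperbolic_size_proots:
  assumes "hyperbolic p"
  shows "size (proots p) = degree p"
  by (metis assms degree_rp degree_smult_eq hyperbolic_factor hyperbolic_nz leading_coeff_0_iff)

lemma hyperbolic_monic_unique:
  "hyperbolic p \<Longrightarrow> lead_coeff p = 1 \<Longrightarrow> p = rp (proots p)"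
  using hyperbolic_factor[of p] by simp

lemma map_poly_of_real_pcompose:
  "map_poly complex_of_real (pcompose p q) =
     pcompose (map_poly of_real p) (map_poly of_real q)"
  by (induction p)
    (simp_all add: pcompose_pCons map_poly_pCons map_poly_of_real_add map_poly_of_real_mult)

lemma hyperbolic_pcompose_linear:
  assumes "hyperbolic p" "b \<noteq> 0"
  shows "hyperbolic (pcompose p [:a, b:])"
  unfolding hyperbolic_def
proof (intro conjI allI impI)
  show "pcompose p [:a, b:] \<noteq> 0"
    using assms hyperbolic_nz by (subst pcompose_eq_0_iff) auto
  fix z assume "cpoly (pcompose p [:a, b:]) z = 0"
  then have "cpoly p (of_real a + z * of_real b) = 0"
    by (simp add: map_poly_of_real_pcompose poly_pcompose map_poly_pCons)
  then have "of_real a + z * of_real b \<in> \<real>" using assms by (simp add: hyperbolic_def)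
  then have "Im (of_real a + z * of_real b) = 0" by (simp add: complex_is_Real_iff)
  then show "z \<in> \<real>" using assms by (simp add: complex_is_Real_iff)
qed

lemma poly_eq_sum_bound:
  fixes p :: "'a :: comm_semiring_1 poly"
  assumes "degree p \<le> K"
  shows "poly p x = (\<Sum>k\<le>K. coeff p k * x ^ k)"
proof -
  have "(\<Sum>k\<le>degree p. coeff p k * x ^ k) = (\<Sum>k\<le>K. coeff p k * x ^ k)"
    using assms by (intro sum.mono_neutral_left) (auto simp: coeff_eq_0)
  then show ?thesis by (simp add: poly_altdef)
qed

lemma tendsto_cpoly:
  assumes "\<And>i. degree (X i) \<le> K" "degree p \<le> K"
    and "\<And>k. (\<lambda>i. coeff (X i) k) \<longlonglongrightarrow> coeff p k"
  shows "(\<lambda>i. cpoly (X i) z) \<longlonglongrightarrow> cpoly p z"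
proof -
  have eq: "cpoly q z = (\<Sum>k\<le>K. of_real (coeff q k) * z ^ k)" if "degree q \<le> K" for q
    using that by (subst poly_eq_sum_bound[of _ K]) (simp_all add: degree_map_poly coeff_map_poly)
  show ?thesis
    unfolding eq[OF assms(1)] eq[OF assms(2)] by (intro tendsto_intros assms(3))
qed

lemma degree_limit_le:
  fixes X :: "nat \<Rightarrow> real poly"
  assumes "\<And>i. degree (X i) \<le> K"
    and "\<And>k. (\<lambda>i. coeff (X i) k) \<longlonglongrightarrow> coeff p k"
  shows "degree p \<le> K"
proof (rule degree_le, intro allI impI)
  fix k assume "K < k"
  then have "coeff (X i) k = 0" for i using assms(1)[of i] by (simp add: coeff_eq_0)
  then show "coeff p k = 0" using assms(2)[of k] by (simp add: LIMSEQ_const_iff)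
qed

lemma norm_cpoly_rp_mono:
  assumes "\<bar>y\<bar> \<le> \<bar>y'\<bar>"
  shows "norm (cpoly (rp A) (Complex x y)) \<le> norm (cpoly (rp A) (Complex x y'))"
proof (induction A)
  case (add a A)
  have "y\<^sup>2 \<le> y'\<^sup>2" using assms by (simp add: abs_le_square_iff)
  then have "norm (cpoly [:- a, 1:] (Complex x y)) \<le> norm (cpoly [:- a, 1:] (Complex x y'))"
    by (simp add: map_poly_pCons cmod_def)
  then show ?case using add unfolding rp_add_mset cpoly_mult norm_mult
    by (intro mult_mono) auto
qed simp

lemma norm_cpoly_hyperbolic_mono:
  assumes "hyperbolic p" "\<bar>y\<bar> \<le> \<bar>y'\<bar>"
  shows "norm (cpoly p (Complex x y)) \<le> norm (cpoly p (Complex x y'))"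
proof -
  obtain c A where "p = smult c (rp A)" by (rule hyperbolic_eq_rp[OF assms(1)])
  then show ?thesis
    using norm_cpoly_rp_mono[OF assms(2)] by (simp add: cpoly_smult norm_mult mult_left_mono)
qed

text \<open>The closedness of hyperbolicity is elementary: \<open>\<bar>p(x + i y)\<bar>\<close> is nondecreasing in
  \<open>\<bar>y\<bar>\<close> for hyperbolic \<open>p\<close>, a property that survives limits, so a nonreal zero of the limit
  would force it to vanish on a whole vertical segment.\<close>

lemma hyperbolic_limit:
  assumes "\<And>i. degree (X i) \<le> K" "\<And>i. hyperbolic (X i)"
    and "\<And>k. (\<lambda>i. coeff (X i) k) \<longlonglongrightarrow> coeff p k"
    and "p \<noteq> 0"
  shows "hyperbolic p"
  unfolding hyperbolic_def
proof (intro conjI allI impI assms(4))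
  note dp = degree_limit_le[OF assms(1,3)]
  fix z assume z: "cpoly p z = 0"
  show "z \<in> \<real>"
  proof (rule ccontr)
    assume "z \<notin> \<real>"
    then have im: "Im z \<noteq> 0" by (simp add: complex_is_Real_iff)
    have "cpoly p (Complex (Re z) y) = 0" if "\<bar>y\<bar> \<le> \<bar>Im z\<bar>" for y
    proof -
      have "norm (cpoly p (Complex (Re z) y)) \<le> norm (cpoly p (Complex (Re z) (Im z)))"
      proof -
        have lim: "(\<lambda>i. norm (cpoly (X i) w)) \<longlonglongrightarrow> norm (cpoly p w)" for w
          by (intro tendsto_norm tendsto_cpoly[OF assms(1) dp] assms(3))
        show ?thesis
          by (rule LIMSEQ_le[OF lim lim])
            (use norm_cpoly_hyperbolic_mono[OF assms(2) that] in blast)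
      qed
      then show ?thesis using z by simp
    qed
    then have "Complex (Re z) ` {y. \<bar>y\<bar> \<le> \<bar>Im z\<bar>} \<subseteq> {w. cpoly p w = 0}" by auto
    moreover have "finite {w. cpoly p w = 0}"
      using assms(4) by (intro poly_roots_finite) (simp add: map_poly_eq_0_iff)
    ultimately have "finite (Complex (Re z) ` {y. \<bar>y\<bar> \<le> \<bar>Im z\<bar>})" by (rule finite_subset)
    then have "finite {y. \<bar>y\<bar> \<le> \<bar>Im z\<bar>}" by (rule finite_imageD) (auto simp: inj_on_def)
    then have "finite {0<..<\<bar>Im z\<bar>}" by (rule rev_finite_subset) auto
    then show False using im by (simp add: infinite_Ioo)
  qed
qed

text \<open>The model to which rescaled pencils are reduced, near a finite point and at infinity:
  exp(i pi/k) is a zero of z^k + 1, nonreal for k \<ge> 2.\<close>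

lemma not_hyperbolic_sparse:
  assumes "k \<ge> 2" "a \<noteq> 0"
  shows "\<not> hyperbolic (monom a k + [:a:])"
proof
  assume h: "hyperbolic (monom a k + [:a:])"
  define z where "z = cis (pi / real k)"
  have "z ^ k = -1"
    using assms(1) unfolding z_def by (simp add: DeMoivre)
  then have "cpoly (monom a k + [:a:]) z = 0"
    by (simp add: cpoly_add map_poly_monom poly_monom map_poly_pCons)
  then have "z \<in> \<real>" using h by (simp add: hyperbolic_def)
  moreover have "sin (pi / real k) > 0"
    using assms(1) by (intro sin_gt_zero) (auto simp: field_simps)
  ultimately show False by (simp add: z_def complex_is_Real_iff)
qed

section \<open>Pencils of hyperbolic polynomials\<close>

text \<open>Counting with multiplicity up to t replaces comparison of ordered zeros: a common factor
  then cancels from both sides of an inequality.\<close>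

definition nz :: "real poly \<Rightarrow> real \<Rightarrow> nat" where
  "nz p t = size (filter_mset (\<lambda>x. x \<le> t) (proots p))"

lemma nz_mult: "p \<noteq> 0 \<Longrightarrow> q \<noteq> 0 \<Longrightarrow> nz (p * q) t = nz p t + nz q t"
  by (simp add: nz_def proots_mult)

lemma nz_linear [simp]: "nz [:- x, 1:] t = (if x \<le> t then 1 else 0)"
  by (simp add: nz_def)

lemma nz_smult [simp]: "c \<noteq> 0 \<Longrightarrow> nz (smult c p) t = nz p t"
  by (simp add: nz_def)

lemma nz_rp: "nz (rp A) t = size (filter_mset (\<lambda>x. x \<le> t) A)"
  by (simp add: nz_def)

lemma size_filter_complement:
  "size (filter_mset P A) + size (filter_mset (\<lambda>x. \<not> P x) A) = size A"
  by (metis multiset_partition size_union)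

lemma nz_split:
  assumes "hyperbolic p"
  shows "nz p t + size (filter_mset (\<lambda>x. t < x) (proots p)) = degree p"
  using size_filter_complement[of "\<lambda>x. x \<le> t" "proots p"]
  by (simp add: nz_def hyperbolic_size_proots[OF assms] not_le)

lemma sgn_rp:
  assumes "poly (rp A) t \<noteq> 0"
  shows "sgn (poly (rp A) t) = (-1) ^ (size A + nz (rp A) t)"
  using assms
proof (induction A)
  case empty
  then show ?case by (simp add: nz_def)
next
  case (add x A)
  then show ?case
    by (auto simp: sgn_mult nz_rp nz_mult not_le simp del: mult_pCons_left)
qed

lemma sgn_poly_hyperbolic:
  assumes "hyperbolic p" "poly p t \<noteq> 0"
  shows "sgn (poly p t) = sgn (lead_coeff p) * (-1) ^ (degree p + nz p t)"
proof -
  obtain c A where p: "c \<noteq> 0" "p = smult c (rp A)" by (rule hyperbolic_eq_rp[OF assms(1)])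
  then show ?thesis
    using assms(2) sgn_rp[of A t] monic_rp[of A] by (simp add: sgn_mult degree_rp)
qed

lemma nz_eqI:
  assumes "t \<le> t'" "\<And>s. t < s \<Longrightarrow> s \<le> t' \<Longrightarrow> poly p s \<noteq> 0"
  shows "nz p t' = nz p t"
proof (cases "p = 0")
  case False
  then have "filter_mset (\<lambda>x. x \<le> t') (proots p) = filter_mset (\<lambda>x. x \<le> t) (proots p)"
    using assms by (intro filter_mset_cong refl) force
  then show ?thesis by (simp add: nz_def)
qed (simp add: nz_def)

lemma root_free_right:
  fixes p :: "real poly"
  assumes "p \<noteq> 0"
  obtains t' where "t < t'" "\<And>s. t < s \<Longrightarrow> s \<le> t' \<Longrightarrow> poly p s \<noteq> 0"
proof -
  have fin: "finite {s. poly p s = 0 \<and> t < s}"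
    using poly_roots_finite[OF assms] by (rule rev_finite_subset) auto
  show thesis
  proof (cases "{s. poly p s = 0 \<and> t < s} = {}")
    case True
    then show thesis by (intro that[of "t + 1"]) auto
  next
    case False
    define m where "m = Min {s. poly p s = 0 \<and> t < s}"
    have m: "m \<in> {s. poly p s = 0 \<and> t < s}" unfolding m_def using fin False by (rule Min_in)
    have le: "m \<le> s" if "poly p s = 0" "t < s" for s
      unfolding m_def using fin that by (intro Min_le) auto
    show thesis
    proof (rule that[of "(t + m) / 2"])
      show "t < (t + m) / 2" using m by simp
      fix s assume "t < s" "s \<le> (t + m) / 2"
      then show "poly p s \<noteq> 0" using le[of s] m by force
    qed
  qed
qed

lemma tendsto_inverse_Suc_power:
  "(\<lambda>i. (1 / real (Suc i)) ^ m) \<longlonglongrightarrow> (if m = 0 then 1 else 0)"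
proof (cases "m = 0")
  case False
  have "(\<lambda>i. (1 / real (Suc i)) ^ m) \<longlonglongrightarrow> 0 ^ m"
    by (intro tendsto_power) (use LIMSEQ_inverse_real_of_nat in \<open>simp add: inverse_eq_divide\<close>)
  then show ?thesis using False by (simp add: power_0_left)
qed simp

text \<open>Near a zero of order \<open>k\<close> of \<open>P\<close> where \<open>R\<close> does not vanish, the pencil rescales to
  \<open>z\<^sup>k - c\<close>, which has nonreal zeros for some \<open>c\<close> unless \<open>k = 1\<close>.\<close>

lemma pencil_simple_zero_0:
  assumes hyp: "\<And>x. hyperbolic (P - smult x R)"
    and "coeff R 0 \<noteq> 0" "coeff P 0 = 0"
  shows "coeff P 1 \<noteq> 0"
proof
  assume c1: "coeff P 1 = 0"
  have "P \<noteq> 0" using hyp[of 0] hyperbolic_nz by auto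
  then obtain j where "coeff P j \<noteq> 0" by (metis leading_coeff_0_iff)
  define k where "k = (LEAST j. coeff P j \<noteq> 0)"
  have k: "coeff P k \<noteq> 0" unfolding k_def by (rule LeastI) fact
  have lt: "coeff P j = 0" if "j < k" for j
    using that not_less_Least unfolding k_def by blast
  have "k \<noteq> 0" "k \<noteq> 1" using k c1 assms(3) by (metis, metis)
  then have k2: "k \<ge> 2" by simp
  \<comment> \<open>With this c the rescaled pencil P(s z)/s^k - c R(s z) tends to a z^k + a, where
    a is the lowest nonzero coefficient of P.\<close>
  define c where "c = - coeff P k / coeff R 0"
  define s where "s i = 1 / real (Suc i)" for i
  have s: "s i \<noteq> 0" for i by (simp add: s_def)
  have s_lim: "(\<lambda>i. s i ^ m) \<longlonglongrightarrow> (if m = 0 then 1 else 0)" for m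
    unfolding s_def by (rule tendsto_inverse_Suc_power)
  define X where "X i = smult (1 / s i ^ k) (pcompose (P - smult (c * s i ^ k) R) [:0, s i:])" for i
  have coeffX: "coeff (X i) j = s i ^ j / s i ^ k * coeff P j - c * coeff R j * s i ^ j" for i j
    using s[of i] by (simp add: X_def coeff_pcompose_linear field_simps)
  have "hyperbolic (monom (coeff P k) k + [:coeff P k:])"
  proof (rule hyperbolic_limit[of X])
    show "degree (X i) \<le> max (degree P) (degree R)" for i
      using degree_diff_le_max[of P "smult (c * s i ^ k) R"]
        degree_smult_le[of "c * s i ^ k" R] unfolding X_def
      by (intro order_trans[OF degree_smult_le] order_trans[OF degree_pcompose_le]) auto
    show "hyperbolic (X i)" for i
      unfolding X_def using s[of i] by (simp add: hyperbolic_smult hyperbolic_pcompose_linear hyp)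
    show "monom (coeff P k) k + [:coeff P k:] \<noteq> 0"
    proof
      assume "monom (coeff P k) k + [:coeff P k:] = 0"
      then have "coeff (monom (coeff P k) k + [:coeff P k:]) 0 = 0" by simp
      then show False using k2 k by simp
    qed
    fix j
    show "(\<lambda>i. coeff (X i) j) \<longlonglongrightarrow> coeff (monom (coeff P k) k + [:coeff P k:]) j"
    proof (cases "j < k")
      case True
      have "(\<lambda>i. - (c * coeff R j) * s i ^ j) \<longlonglongrightarrow> - (c * coeff R j) * (if j = 0 then 1 else 0)"
        by (intro tendsto_intros s_lim)
      moreover have "- (c * coeff R j) * (if j = 0 then 1 else 0) =
          coeff (monom (coeff P k) k + [:coeff P k:]) j"
        using True assms(2) by (auto simp: c_def coeff_pCons split: nat.split)
      ultimately show ?thesis by (simp add: coeffX lt[OF True])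
    next
      case False
      then have eq: "s i ^ j / s i ^ k = s i ^ (j - k)" for i
        using s[of i] by (simp add: power_diff)
      have "(\<lambda>i. s i ^ (j - k) * coeff P j - c * coeff R j * s i ^ j) \<longlonglongrightarrow>
          (if j - k = 0 then 1 else 0) * coeff P j - c * coeff R j * (if j = 0 then 1 else 0)"
        by (intro tendsto_intros s_lim)
      moreover have "(if j - k = 0 then 1 else 0) * coeff P j - c * coeff R j * (if j = 0 then 1 else 0)
          = coeff (monom (coeff P k) k + [:coeff P k:]) j"
        using False k2 by (auto simp: coeff_pCons split: nat.split)
      ultimately show ?thesis by (simp add: coeffX eq)
    qed
  qed
  then show False using not_hyperbolic_sparse[OF k2 k] by simp
qed

lemma pencil_simple_zero:
  assumes "\<And>x. hyperbolic (P - smult x R)"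
    and "poly R t \<noteq> 0" "poly P t = 0"
  shows "poly (pderiv P) t \<noteq> 0"
proof -
  have "hyperbolic (pcompose P [:t, 1:] - smult x (pcompose R [:t, 1:]))" for x
    using hyperbolic_pcompose_linear[OF assms(1)[of x], of 1 t]
    by (simp add: pcompose_diff pcompose_smult)
  then have "coeff (pcompose P [:t, 1:]) 1 \<noteq> 0"
    by (rule pencil_simple_zero_0) (use assms in \<open>simp_all flip: poly_0_coeff_0 add: poly_pcompose\<close>)
  also have "coeff (pcompose P [:t, 1:]) 1 = poly (pderiv (pcompose P [:t, 1:])) 0"
    by (simp add: poly_0_coeff_0 coeff_pderiv)
  also have "\<dots> = poly (pderiv P) t"
    by (simp add: pderiv_pcompose poly_pcompose pderiv_pCons)
  finally show ?thesis .
qed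

text \<open>The counterpart at infinity of the simplicity of zeros: dilating outwards, with x
  growing at the matching rate, turns the pencil into a z^D + a z^d = z^d (a z^(D-d) + a), which is
  not hyperbolic when D - d \<ge> 2.\<close>

lemma pencil_degree:
  assumes hyp: "\<And>x. hyperbolic (P - smult x R)"
    and "R \<noteq> 0" "degree R < degree P"
  shows "degree P = Suc (degree R)"
proof (rule ccontr)
  define d D where "d = degree R" and "D = degree P"
  assume "degree P \<noteq> Suc (degree R)"
  then have D: "D - d \<ge> 2" "d < D" using assms(3) by (auto simp: d_def D_def)
  define a where "a = coeff P D"
  have a: "a \<noteq> 0" using D unfolding a_def D_def by force
  have R: "coeff R d \<noteq> 0" using assms(2) by (simp add: d_def)
  define c where "c = - a / coeff R d"
  define s where "s i = real (Suc i)" for i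
  have s: "s i \<noteq> 0" for i by (simp add: s_def)
  have s_lim: "(\<lambda>i. s i ^ j / s i ^ m * b j) \<longlonglongrightarrow> (if j = m then b j else 0)"
    if "\<And>j. j > m \<Longrightarrow> b j = 0" for m j :: nat and b :: "nat \<Rightarrow> real"
  proof (cases "j \<le> m")
    case True
    then have "s i ^ j / s i ^ m = (1 / s i) ^ (m - j)" for i
      using s[of i] by (simp add: power_diff power_divide)
    then have "(\<lambda>i. s i ^ j / s i ^ m * b j) \<longlonglongrightarrow> (if m - j = 0 then 1 else 0) * b j"
      unfolding s_def by (simp only:) (intro tendsto_mult_right tendsto_inverse_Suc_power)
    then show ?thesis using True by (auto split: if_splits)
  qed (use that in auto)
  define X where "X i = smult (1 / s i ^ D)
    (pcompose (P - smult (c * (s i ^ D / s i ^ d)) R) [:0, s i:])" for i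
  have coeffX: "coeff (X i) j = s i ^ j / s i ^ D * coeff P j - c * (s i ^ j / s i ^ d * coeff R j)"
    for i j
    using s[of i] by (simp add: X_def coeff_pcompose_linear field_simps)
  have eq: "monom a D + monom a d = monom 1 d * (monom a (D - d) + [:a:])"
    using D by (simp add: distrib_left mult_monom smult_monom flip: monom_0)
  have "hyperbolic (monom a D + monom a d)"
  proof (rule hyperbolic_limit[of X])
    show "degree (X i) \<le> max (degree P) (degree R)" for i
      using degree_diff_le_max[of P "smult (c * (s i ^ D / s i ^ d)) R"]
        degree_smult_le[of "c * (s i ^ D / s i ^ d)" R] unfolding X_def
      by (intro order_trans[OF degree_smult_le] order_trans[OF degree_pcompose_le]) auto
    show "hyperbolic (X i)" for i
      unfolding X_def using s[of i] by (simp add: hyperbolic_smult hyperbolic_pcompose_linear hyp)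
    show "monom a D + monom a d \<noteq> 0"
    proof
      assume "monom a D + monom a d = 0"
      then have "coeff (monom a D + monom a d) d = 0" by simp
      then show False using D a by simp
    qed
    fix j
    have "(\<lambda>i. coeff (X i) j) \<longlonglongrightarrow>
        (if j = D then coeff P j else 0) - c * (if j = d then coeff R j else 0)"
      unfolding coeffX
      by (intro tendsto_intros s_lim) (simp_all add: D_def d_def coeff_eq_0)
    also have "(if j = D then coeff P j else 0) - c * (if j = d then coeff R j else 0) =
        coeff (monom a D + monom a d) j"
      using R by (auto simp: c_def a_def)
    finally show "(\<lambda>i. coeff (X i) j) \<longlonglongrightarrow> coeff (monom a D + monom a d) j" .
  qed
  then have "hyperbolic (monom a (D - d) + [:a:])"
    unfolding eq hyperbolic_mult_iff by simp
  then show False using not_hyperbolic_sparse[OF D(1) a] by simp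
qed

lemma card_separated_le:
  fixes A G :: "real set"
  assumes "finite A" "finite G"
    and "\<And>a b. a \<in> A \<Longrightarrow> b \<in> A \<Longrightarrow> a < b \<Longrightarrow> \<exists>g\<in>G. a < g \<and> g < b"
  shows "card A \<le> Suc (card G)"
  using assms
proof (induction A arbitrary: G rule: finite_linorder_max_induct)
  case (insert b A)
  show ?case
  proof (cases "A = {}")
    case False
    define a where "a = Max A"
    have a: "a \<in> A" using False insert by (simp add: a_def)
    then obtain g where g: "g \<in> G" "a < g" "g < b" using insert by blast
    have "card A \<le> Suc (card (G - {g}))"
    proof (rule insert.IH)
      fix x y assume xy: "x \<in> A" "y \<in> A" "x < y"
      then obtain h where h: "h \<in> G" "x < h" "h < y" using insert.prems by blast
      have "y \<le> a" using xy insert by (simp add: a_def)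
      with h g xy show "\<exists>g\<in>G - {g}. x < g \<and> g < y" by (intro bexI[of _ h]) auto
    qed (use insert in auto)
    moreover have "card G > 0" using g insert by (auto simp: card_gt_0_iff)
    moreover have "card (insert b A) = Suc (card A)" using insert by auto
    ultimately show ?thesis using g insert by simp
  qed simp
qed simp

text \<open>Rolle's theorem for P/R: at a critical point z with value x = P(z)/R(z), the member P -
  x R of the pencil would have a multiple zero where R does not vanish.\<close>

lemma pencil_zero_between:
  assumes hyp: "\<And>x. hyperbolic (P - smult x R)"
    and "a < b" "poly P a = 0" "poly P b = 0"
    and "\<And>t. \<not> (poly P t = 0 \<and> poly R t = 0)"
  shows "\<exists>g. a < g \<and> g < b \<and> poly R g = 0"
proof (rule ccontr)
  assume no: "\<not> ?thesis"
  then have "poly R t \<noteq> 0" if "a \<le> t" "t \<le> b" for t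
    using that assms(3-5) by (cases "t = a"; cases "t = b") (auto simp: order_less_le)
  note R = this
  have "\<exists>z>a. z < b \<and> (poly (pderiv P) z * poly R z - poly P z * poly (pderiv R) z) / (poly R z * poly R z) = 0"
  proof -
    have "\<exists>l z. a < z \<and> z < b \<and> DERIV (\<lambda>t. poly P t / poly R t) z :> l \<and>
        poly P b / poly R b - poly P a / poly R a = (b - a) * l"
    proof (rule MVT[OF assms(2)])
      show "continuous_on {a..b} (\<lambda>t. poly P t / poly R t)"
        using R by (intro continuous_intros) auto
      show "(\<lambda>t. poly P t / poly R t) differentiable (at x)" if "a < x" "x < b" for x
      proof (rule differentiable_divide)
        show "(\<lambda>t. poly P t) differentiable (at x)" "(\<lambda>t. poly R t) differentiable (at x)"
          using poly_DERIV real_differentiable_def by blast+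
      qed (use R[of x] that in simp)
    qed
    then obtain l z where z: "a < z" "z < b" "DERIV (\<lambda>t. poly P t / poly R t) z :> l" "l = 0"
      using assms by auto
    have "DERIV (\<lambda>t. poly P t / poly R t) z :>
        (poly (pderiv P) z * poly R z - poly P z * poly (pderiv R) z) / (poly R z * poly R z)"
      using R z by (intro DERIV_divide poly_DERIV) auto
    with z DERIV_unique show ?thesis by blast
  qed
  then obtain z where z: "a < z" "z < b"
    "(poly (pderiv P) z * poly R z - poly P z * poly (pderiv R) z) / (poly R z * poly R z) = 0" by blast
  have Rz: "poly R z \<noteq> 0" using R z by simp
  define x where "x = poly P z / poly R z"
  have "poly (pderiv (P - smult x R)) z \<noteq> 0"
  proof (rule pencil_simple_zero)
    show "hyperbolic (P - smult x R - smult y R)" for y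
      using hyp[of "x + y"] by (simp add: smult_add_left algebra_simps)
  qed (use Rz in \<open>simp_all add: x_def\<close>)
  with z(3) Rz show False
    by (simp add: pderiv_diff pderiv_smult x_def field_simps)
qed

lemma pencil_interlace_coprime:
  assumes hyp: "\<And>x. hyperbolic (P - smult x R)" and R: "hyperbolic R"
    and deg: "degree P = Suc (degree R)"
    and cop: "\<And>t. \<not> (poly P t = 0 \<and> poly R t = 0)"
  shows "nz R t \<le> nz P t \<and> nz P t \<le> Suc (nz R t)"
proof -
  have P: "hyperbolic P" using hyp[of 0] by simp
  have nzP: "P \<noteq> 0" "R \<noteq> 0" using P R hyperbolic_nz by auto
  have simple: "count (proots P) x \<le> 1" for x
  proof (cases "poly P x = 0")
    case True
    then have "poly (pderiv P) x \<noteq> 0"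
      using pencil_simple_zero[OF hyp _ True] cop by blast
    then have "order x (pderiv P) = 0" "pderiv P \<noteq> 0" by (auto simp: order_0I)
    then have "order x P \<le> 1"
      using order_pderiv[of P x] nzP True by auto
    then show ?thesis using nzP by simp
  qed (use nzP in \<open>simp add: order_0I\<close>)
  have card_P: "size (filter_mset Q (proots P)) = card {x. poly P x = 0 \<and> Q x}" for Q
  proof -
    have "filter_mset Q (proots P) = mset_set {x. poly P x = 0 \<and> Q x}"
    proof (rule multiset_eqI)
      fix x
      have "finite {x. poly P x = 0 \<and> Q x}"
        using poly_roots_finite[OF nzP(1)] by (rule rev_finite_subset) auto
      moreover have "count (proots P) x = (if poly P x = 0 then 1 else 0)"
        using simple[of x] nzP order_root[of P x] by auto
      ultimately show "count (filter_mset Q (proots P)) x = count (mset_set {x. poly P x = 0 \<and> Q x}) x"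
        by (simp add: count_mset_set')
    qed
    then show ?thesis by simp
  qed
  have card_R: "card {x. poly R x = 0 \<and> Q x} \<le> size (filter_mset Q (proots R))" for Q
  proof -
    have "{x. poly R x = 0 \<and> Q x} = set_mset (filter_mset Q (proots R))" using nzP by auto
    moreover obtain xs where "mset xs = filter_mset Q (proots R)" using ex_mset by blast
    ultimately show ?thesis using card_length[of xs] by (metis set_mset_mset size_mset)
  qed
  \<comment> \<open>Applied to both half-lines at t: on the left it bounds the count for P from
    above, and on the right, by complements and the degrees, from below.\<close>
  have key: "size (filter_mset Q (proots P)) \<le> Suc (size (filter_mset Q (proots R)))"
    if Q: "\<And>a b x. Q a \<Longrightarrow> Q b \<Longrightarrow> a < x \<Longrightarrow> x < b \<Longrightarrow> Q x" for Q
  proof -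
    have "card {x. poly P x = 0 \<and> Q x} \<le> Suc (card {x. poly R x = 0 \<and> Q x})"
    proof (rule card_separated_le)
      show "finite {x. poly P x = 0 \<and> Q x}" "finite {x. poly R x = 0 \<and> Q x}"
        using poly_roots_finite nzP by (auto intro: rev_finite_subset)
      fix a b assume "a \<in> {x. poly P x = 0 \<and> Q x}" "b \<in> {x. poly P x = 0 \<and> Q x}" "a < b"
      then show "\<exists>g\<in>{x. poly R x = 0 \<and> Q x}. a < g \<and> g < b"
        using pencil_zero_between[OF hyp, of a b] cop Q[of a b] by blast
    qed
    then show ?thesis using card_P[of Q] card_R[of Q] by linarith
  qed
  have "nz P t \<le> Suc (nz R t)" unfolding nz_def by (rule key) auto
  moreover have "size (filter_mset (\<lambda>x. t < x) (proots P)) \<le>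
      Suc (size (filter_mset (\<lambda>x. t < x) (proots R)))" by (rule key) auto
  ultimately show ?thesis using nz_split[OF P, of t] nz_split[OF R, of t] deg by linarith
qed

text \<open>A common zero of P and R divides the whole pencil, so it can be stripped, and it
  contributes equally to both counts.\<close>

lemma pencil_interlace:
  assumes "\<And>x. hyperbolic (P - smult x R)" "hyperbolic R"
    and "degree P = Suc (degree R)"
  shows "nz R t \<le> nz P t \<and> nz P t \<le> Suc (nz R t)"
  using assms
proof (induction "degree R" arbitrary: P R rule: less_induct)
  case less
  show ?case
  proof (cases "\<exists>c. poly P c = 0 \<and> poly R c = 0")
    case False
    then show ?thesis using pencil_interlace_coprime[OF less.prems] by blast
  next
    case True
    then obtain c where "[:- c, 1:] dvd P" "[:- c, 1:] dvd R"
      by (auto simp: poly_eq_0_iff_dvd)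
    then obtain P1 R1 where PR: "P = [:- c, 1:] * P1" "R = [:- c, 1:] * R1"
      unfolding dvd_def by blast
    have hyp1: "hyperbolic (P1 - smult x R1)" for x
    proof -
      have "P - smult x R = [:- c, 1:] * (P1 - smult x R1)"
        by (simp only: PR right_diff_distrib mult_smult_right)
      then show ?thesis using less.prems(1)[of x] by (simp only: hyperbolic_mult_iff)
    qed
    have R1: "hyperbolic R1" using less.prems(2) by (simp only: PR hyperbolic_mult_iff)
    have nz1: "P1 \<noteq> 0" "R1 \<noteq> 0" using hyp1[of 0] R1 hyperbolic_nz by auto
    have "degree ([:- c, 1:] * q) = Suc (degree q)" if "q \<noteq> 0" for q
      using that by (simp add: degree_mult_eq del: mult_pCons_left)
    then have "degree P = Suc (degree P1)" "degree R = Suc (degree R1)"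
      unfolding PR using nz1 by simp_all
    then have "nz R1 t \<le> nz P1 t \<and> nz P1 t \<le> Suc (nz R1 t)"
      using less.prems(3) by (intro less.hyps hyp1 R1) simp_all
    then show ?thesis unfolding PR using nz1 by (simp add: nz_mult del: mult_pCons_left)
  qed
qed

text \<open>All members of the pencil interlace R, so a count can differ from that of R by 0 or 1
  only. A larger count for the larger parameter y would give (P - x R) R < 0 < (P - y R) R at a
  suitable point, although the difference of these products is (y - x) R^2.\<close>

lemma pencil_mono:
  assumes hyp: "\<And>x. hyperbolic (P - smult x R)" and R: "hyperbolic R"
    and deg: "degree P = Suc (degree R)" and lead: "lead_coeff P * lead_coeff R > 0"
    and "x < y"
  shows "nz (P - smult y R) t \<le> nz (P - smult x R) t"
proof (rule ccontr)
  assume neg: "\<not> ?thesis"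
  define p q where "p = P - smult x R" and "q = P - smult y R"
  have hp: "hyperbolic p" "hyperbolic q" using hyp by (simp_all add: p_def q_def)
  have degz: "degree (P - smult z R) = degree P" "lead_coeff (P - smult z R) = lead_coeff P" for z
  proof -
    have "degree (smult z R) < degree P" using deg degree_smult_le[of z R] by simp
    then show "degree (P - smult z R) = degree P"
      using degree_add_eq_left[of "- smult z R" P] by simp
    then show "lead_coeff (P - smult z R) = lead_coeff P"
      using deg by (simp add: coeff_eq_0)
  qed
  have inter: "nz R s \<le> nz (P - smult z R) s \<and> nz (P - smult z R) s \<le> Suc (nz R s)" for z s
  proof (rule pencil_interlace)
    show "hyperbolic (P - smult z R - smult w R)" for w
      using hyp[of "z + w"] by (simp add: smult_add_left algebra_simps)
  qed (simp_all add: R degz deg)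
  \<comment> \<open>Counts include zeros at t itself, so t may be replaced by a point slightly to
    its right where no polynomial vanishes and parities of counts give signs.\<close>
  have "p * q * R \<noteq> 0" using hp R hyperbolic_nz by auto
  then obtain u where u: "t < u" "\<And>s. t < s \<Longrightarrow> s \<le> u \<Longrightarrow> poly (p * q * R) s \<noteq> 0"
    by (rule root_free_right[of _ t]) blast
  have eq: "nz p u = nz p t" "nz q u = nz q t" using u by (auto intro!: nz_eqI)
  have "nz p u < nz q u" using neg eq by (simp add: p_def q_def)
  then have pu: "nz p u = nz R u" "nz q u = Suc (nz R u)"
    using inter[of u x] inter[of u y] unfolding p_def[symmetric] q_def[symmetric] by linarith+
  have ne: "poly p u \<noteq> 0" "poly q u \<noteq> 0" "poly R u \<noteq> 0" using u by auto
  have sl: "sgn (lead_coeff P) * sgn (lead_coeff R) = 1"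
    using lead by (simp flip: sgn_mult)
  have degpq: "degree p = Suc (degree R)" "degree q = Suc (degree R)"
    "lead_coeff p = lead_coeff P" "lead_coeff q = lead_coeff P"
    using degz deg by (simp_all add: p_def q_def)
  have "sgn (poly p u * poly R u) = (sgn (lead_coeff P) * sgn (lead_coeff R)) *
      ((-1) ^ (degree p + nz p u) * (-1) ^ (degree R + nz R u))"
    using sgn_poly_hyperbolic[OF hp(1) ne(1)] sgn_poly_hyperbolic[OF R ne(3)] degpq
    by (simp add: sgn_mult)
  also have "\<dots> = -1" unfolding sl pu(1) degpq(1) by (simp flip: power_add power_mult_distrib)
  finally have pR: "poly p u * poly R u < 0" by (simp only: sgn_1_neg)
  have "sgn (poly q u * poly R u) = (sgn (lead_coeff P) * sgn (lead_coeff R)) *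
      ((-1) ^ (degree q + nz q u) * (-1) ^ (degree R + nz R u))"
    using sgn_poly_hyperbolic[OF hp(2) ne(2)] sgn_poly_hyperbolic[OF R ne(3)] degpq
    by (simp add: sgn_mult)
  also have "\<dots> = 1" unfolding sl pu(2) degpq(2) by (simp flip: power_add power_mult_distrib)
  finally have qR: "poly q u * poly R u > 0" by (simp only: sgn_1_pos)
  have "poly p u * poly R u - poly q u * poly R u = (y - x) * (poly R u * poly R u)"
    by (simp add: p_def q_def algebra_simps)
  moreover have "(y - x) * (poly R u * poly R u) \<ge> 0" using assms(5) by simp
  ultimately show False using pR qR by linarith
qed

section \<open>Derivatives, spanning products and limits\<close>

text \<open>The falling factorial n(n-1)...(n-k+1); truncated subtraction supplies a zero factor
  when k > n.\<close>

definition ff :: "nat \<Rightarrow> nat \<Rightarrow> real" where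
  "ff n k = (\<Prod>i<k. real (n - i))"

lemma ff_0 [simp]: "ff n 0 = 1"
  by (simp add: ff_def)

lemma ff_Suc: "ff n (Suc k) = ff n k * real (n - k)"
  by (simp add: ff_def)

lemma ff_pos: "k \<le> n \<Longrightarrow> ff n k > 0"
  unfolding ff_def by (rule prod_pos) auto

lemma ff_eq_0: "n < k \<Longrightarrow> ff n k = 0"
  unfolding ff_def by (rule prod_zero) auto

lemma ff_nonneg: "ff n k \<ge> 0"
  unfolding ff_def by (rule prod_nonneg) auto

lemma tendsto_ff: "(\<lambda>m. ff (Suc m) k / real (Suc m) ^ k) \<longlonglongrightarrow> 1"
proof -
  have one: "(\<lambda>m. real (Suc m - i) / real (Suc m)) \<longlonglongrightarrow> 1" for i
  proof -
    have "(\<lambda>m. 1 - real i * (1 / real (Suc m))) \<longlonglongrightarrow> 1 - real i * 0"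
      by (intro tendsto_intros) (use LIMSEQ_inverse_real_of_nat in \<open>simp add: inverse_eq_divide\<close>)
    moreover have "\<forall>\<^sub>F m in sequentially. 1 - real i * (1 / real (Suc m)) = real (Suc m - i) / real (Suc m)"
      using eventually_ge_at_top[of i]
      by eventually_elim (simp add: of_nat_diff field_simps)
    ultimately show ?thesis by (simp add: tendsto_cong)
  qed
  have "(\<lambda>m. \<Prod>i<k. real (Suc m - i) / real (Suc m)) \<longlonglongrightarrow> (\<Prod>i<k. 1)"
    by (intro tendsto_prod one)
  then show ?thesis by (simp add: ff_def prod_dividef)
qed

lemma coeff_higher_pderiv: "coeff ((pderiv ^^ k) p) j = ff (j + k) k * coeff p (j + k)" for p :: "real poly"
proof (induction k arbitrary: j)
  case (Suc k)
  have "coeff ((pderiv ^^ Suc k) p) j = real (Suc j) * (ff (Suc j + k) k * coeff p (Suc j + k))"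
    by (simp add: coeff_pderiv Suc)
  then show ?case by (simp add: ff_Suc)
qed simp

lemma higher_pderiv_eq_0: "degree f < k \<Longrightarrow> (pderiv ^^ k) f = 0" for f :: "real poly"
  by (rule poly_eqI) (simp add: coeff_higher_pderiv coeff_eq_0)

lemma degree_higher_pderiv_le: "degree ((pderiv ^^ k) p) \<le> degree p - k" for p :: "real poly"
  by (rule degree_le) (auto simp: coeff_higher_pderiv coeff_eq_0)

lemma higher_pderiv_linear_power:
  fixes a c :: "'a :: real_field"
  shows "(pderiv ^^ k) ([:a, c:] ^ n) = smult (of_real (ff n k) * c ^ k) ([:a, c:] ^ (n - k))"
proof (induction k)
  case (Suc k)
  show ?case
  proof (cases "n - k")
    case 0
    then show ?thesis using Suc by (simp add: ff_Suc)
  next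
    case (Suc m)
    then have "n - Suc k = m" by simp
    have "(pderiv ^^ Suc k) ([:a, c:] ^ n) = pderiv (smult (of_real (ff n k) * c ^ k) ([:a, c:] ^ Suc m))"
      by (simp only: funpow.simps comp_apply Suc.IH Suc)
    also have "\<dots> = smult (of_real (ff n k) * c ^ k * (of_nat (Suc m) * c)) ([:a, c:] ^ m)"
      by (simp add: pderiv_smult pderiv_power_Suc pderiv_pCons mult_ac del: power_Suc)
    finally show ?thesis using Suc \<open>n - Suc k = m\<close> by (simp add: ff_Suc mult_ac)
  qed
qed simp

lemma coeff_mult_bound:
  fixes p q :: "'a::comm_semiring_0 poly"
  assumes "degree p \<le> a" "degree q \<le> b"
  shows "coeff (p * q) (a + b) = coeff p a * coeff q b"
proof -
  have "coeff p i * coeff q (a + b - i) = (if i = a then coeff p a * coeff q b else 0)"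
    if "i \<le> a + b" for i
  proof -
    consider "i < a" | "i = a" | "i > a" by linarith
    then show ?thesis using assms by cases (simp_all add: coeff_eq_0)
  qed
  then show ?thesis by (simp add: coeff_mult)
qed

text \<open>Zeros are indexed rather than collected in a multiset, since later arguments choose each
  zero independently from two vectors.\<close>

definition pf :: "nat \<Rightarrow> (nat \<Rightarrow> real) \<Rightarrow> real poly" where
  "pf n x = (\<Prod>i<n. [:- x i, 1:])"

lemma pf_0 [simp]: "pf 0 x = 1"
  by (simp add: pf_def)

lemma pf_Suc: "pf (Suc n) x = [:- x n, 1:] * pf n x"
  by (simp add: pf_def mult.commute)

lemma pf_cong: "(\<And>i. i < n \<Longrightarrow> x i = y i) \<Longrightarrow> pf n x = pf n y"
  by (auto simp: pf_def intro!: prod.cong)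

lemma pf_Suc_shift: "pf (Suc n) x = [:- x 0, 1:] * pf n (\<lambda>i. x (Suc i))"
  by (simp only: pf_def prod.lessThan_Suc_shift)

lemma linear_power_pf: "[:- x, 1:] ^ n = pf n (\<lambda>_. x)"
  by (simp add: pf_def)

lemma pf_rp: "pf n x = rp (image_mset x (mset_set {..<n}))"
  by (simp add: pf_def rp_def prod_unfold_prod_mset image_mset.compositionality comp_def)

text \<open>By induction on \<open>m\<close>: if \<open>V\<close> contains \<open>(z - a) v\<close> and \<open>(z - b) v\<close> with \<open>a \<noteq> b\<close>, then it
  contains \<open>v\<close> and \<open>z v\<close>.\<close>

lemma products_span:
  assumes "\<And>u v. u \<in> V \<Longrightarrow> v \<in> V \<Longrightarrow> u + v \<in> V" "\<And>c u. u \<in> V \<Longrightarrow> smult c u \<in> V"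
    and "\<And>i. i < m \<Longrightarrow> x i \<noteq> y i"
    and "\<And>z. (\<And>i. i < m \<Longrightarrow> z i \<in> {x i, y i}) \<Longrightarrow> pf m z \<in> V"
    and "degree u \<le> m"
  shows "u \<in> V"
  using assms
proof (induction m arbitrary: V u)
  case 0
  have "degree u = 0" using 0(5) by simp
  then obtain c where u: "u = [:c:]" by (rule degree_eq_zeroE)
  have "1 \<in> V" using 0(4)[of undefined] by simp
  then have "smult c 1 \<in> V" by (rule 0(2))
  then show ?case using u by simp
next
  case (Suc m)
  have mix: "pf m z \<in> {v. [:- c, 1:] * v \<in> V}"
    if z: "\<And>i. i < m \<Longrightarrow> z i \<in> {x i, y i}" and c: "c \<in> {x m, y m}" for z c
  proof -
    have "pf (Suc m) (z(m := c)) \<in> V"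
    proof (rule Suc.prems(4))
      fix i assume "i < Suc m"
      then show "(z(m := c)) i \<in> {x i, y i}" using z[of i] c by (cases "i = m") auto
    qed
    moreover have "pf m (z(m := c)) = pf m z" by (auto simp: pf_def intro!: prod.cong)
    ultimately show ?thesis by (simp only: pf_Suc mem_Collect_eq fun_upd_same)
  qed
  have IH: "[:- c, 1:] * v \<in> V" if "degree v \<le> m" "c \<in> {x m, y m}" for v c
  proof -
    have "v \<in> {v. [:- c, 1:] * v \<in> V}"
    proof (rule Suc.IH)
      show "u + v \<in> {v. [:- c, 1:] * v \<in> V}"
        if "u \<in> {v. [:- c, 1:] * v \<in> V}" "v \<in> {v. [:- c, 1:] * v \<in> V}" for u v
        using that unfolding mem_Collect_eq distrib_left by (blast intro: Suc.prems(1))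
      show "smult a v \<in> {v. [:- c, 1:] * v \<in> V}" if "v \<in> {v. [:- c, 1:] * v \<in> V}" for a v
        using that unfolding mem_Collect_eq mult_smult_right by (rule Suc.prems(2))
      show "pf m z \<in> {v. [:- c, 1:] * v \<in> V}" if "\<And>i. i < m \<Longrightarrow> z i \<in> {x i, y i}" for z
        using mix[OF that] \<open>c \<in> {x m, y m}\<close> by blast
      show "x i \<noteq> y i" if "i < m" for i using Suc.prems(3)[of i] that by simp
    qed (rule that(1))
    then show ?thesis by blast
  qed
  have both: "v \<in> V" "[:0, 1:] * v \<in> V" if "degree v \<le> m" for v
  proof -
    define d where "d = y m - x m"
    have d: "d \<noteq> 0" using Suc.prems(3)[of m] by (simp add: d_def)
    have IHx: "[:- x m, 1:] * v \<in> V" and IHy: "[:- y m, 1:] * v \<in> V"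
      using that by (auto intro!: IH simp del: mult_pCons_left)
    have "smult (1 / d) ([:- x m, 1:] * v + smult (-1) ([:- y m, 1:] * v)) \<in> V"
      by (rule Suc.prems(2), rule Suc.prems(1), rule IHx, rule Suc.prems(2), rule IHy)
    moreover have "[:- x m, 1:] * v + smult (-1) ([:- y m, 1:] * v) = smult d v"
      by (simp add: d_def smult_diff_left)
    ultimately show v: "v \<in> V" using d by simp
    have "[:- x m, 1:] * v + smult (x m) v \<in> V"
      by (rule Suc.prems(1), rule IHx, rule Suc.prems(2), rule v)
    then show "[:0, 1:] * v \<in> V" by simp
  qed
  obtain c v where u: "u = pCons c v" by (cases u)
  then have v: "degree v \<le> m" using Suc.prems(5) by (auto split: if_splits)
  have "[:0, 1:] * v + smult c 1 \<in> V"
    by (rule Suc.prems(1), rule both(2)[OF v], rule Suc.prems(2), rule both(1)) simp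
  then show ?case using u by simp
qed

definition pconv :: "(nat \<Rightarrow> real poly) \<Rightarrow> real poly \<Rightarrow> bool" where
  "pconv X p \<longleftrightarrow> (\<forall>k. (\<lambda>i. coeff (X i) k) \<longlonglongrightarrow> coeff p k)"

lemma pconv_const: "pconv (\<lambda>i. p) p"
  by (simp add: pconv_def)

lemma pconv_mult: "pconv X p \<Longrightarrow> pconv Y q \<Longrightarrow> pconv (\<lambda>i. X i * Y i) (p * q)"
  by (auto simp: pconv_def coeff_mult intro!: tendsto_sum tendsto_mult)

lemma pconv_smult: "c \<longlonglongrightarrow> d \<Longrightarrow> pconv X p \<Longrightarrow> pconv (\<lambda>i. smult (c i) (X i)) (smult d p)"
  by (auto simp: pconv_def intro!: tendsto_mult)

lemma pconv_sum: "(\<And>a. a \<in> A \<Longrightarrow> pconv (X a) (p a)) \<Longrightarrow> pconv (\<lambda>i. \<Sum>a\<in>A. X a i) (\<Sum>a\<in>A. p a)"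
  by (auto simp: pconv_def coeff_sum intro!: tendsto_sum)

lemma pconv_prod: "(\<And>a. a \<in> A \<Longrightarrow> pconv (X a) (p a)) \<Longrightarrow> pconv (\<lambda>i. \<Prod>a\<in>A. X a i) (\<Prod>a\<in>A. p a)"
  by (induction A rule: infinite_finite_induct) (simp_all add: pconv_const pconv_mult)

lemma pconv_power: "pconv X p \<Longrightarrow> pconv (\<lambda>i. X i ^ n) (p ^ n)"
  by (induction n) (simp_all add: pconv_const pconv_mult)

lemma pconv_linear: "a \<longlonglongrightarrow> a' \<Longrightarrow> b \<longlonglongrightarrow> b' \<Longrightarrow> pconv (\<lambda>i. [:a i, b i:]) [:a', b':]"
  by (auto simp: pconv_def coeff_pCons split: nat.split)

lemma pconv_pf: "(\<And>i. i < n \<Longrightarrow> (\<lambda>k. x k i) \<longlonglongrightarrow> y i) \<Longrightarrow> pconv (\<lambda>k. pf n (x k)) (pf n y)"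
  unfolding pf_def by (intro pconv_prod pconv_linear tendsto_const tendsto_minus) auto

lemma pconv_higher_pderiv: "pconv X p \<Longrightarrow> pconv (\<lambda>i. (pderiv ^^ k) (X i)) ((pderiv ^^ k) p)"
  by (auto simp: pconv_def coeff_higher_pderiv intro!: tendsto_mult_left)

lemma pconv_unique: "pconv X p \<Longrightarrow> pconv X q \<Longrightarrow> p = q"
  by (auto simp: pconv_def poly_eq_iff intro: LIMSEQ_unique)

lemma pconv_hyperbolic:
  assumes "\<And>i. degree (X i) \<le> K" "\<And>i. hyperbolic (X i)" "pconv X p" "p \<noteq> 0"
  shows "hyperbolic p"
  using assms hyperbolic_limit[of X K p] by (simp add: pconv_def)

text \<open>Zooming out isolates the coefficient of z^m. The degree may be smaller than m, in which
  case the limit is 0.\<close>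

lemma pconv_rescale:
  assumes "degree p \<le> m"
  shows "pconv (\<lambda>i. smult (1 / real (Suc i) ^ m) (pcompose p [:0, real (Suc i):]))
    (monom (coeff p m) m)"
  unfolding pconv_def
proof
  fix j
  show "(\<lambda>i. coeff (smult (1 / real (Suc i) ^ m) (pcompose p [:0, real (Suc i):])) j)
      \<longlonglongrightarrow> coeff (monom (coeff p m) m) j"
  proof (cases "j \<le> m")
    case True
    then have "coeff (smult (1 / real (Suc i) ^ m) (pcompose p [:0, real (Suc i):])) j =
        (1 / real (Suc i)) ^ (m - j) * coeff p j" for i
      by (simp add: coeff_pcompose_linear power_diff power_divide)
    moreover have "(\<lambda>i. (1 / real (Suc i)) ^ (m - j) * coeff p j) \<longlonglongrightarrow>
        (if m - j = 0 then 1 else 0) * coeff p j"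
      by (intro tendsto_mult_right tendsto_inverse_Suc_power)
    ultimately show ?thesis using True by (auto split: if_splits)
  next
    case False
    then show ?thesis using assms by (simp add: coeff_pcompose_linear coeff_eq_0)
  qed
qed

lemma higher_pderiv_pcompose_scale:
  "(pderiv ^^ k) (pcompose p [:0, c:]) = smult (c ^ k) (pcompose ((pderiv ^^ k) p) [:0, c:])"
  for p :: "real poly"
  by (rule poly_eqI) (simp add: coeff_higher_pderiv coeff_pcompose_linear power_add)

lemma coeff_rp_nonneg:
  assumes "\<And>a. a \<in># A \<Longrightarrow> a \<le> 0"
  shows "coeff (rp A) k \<ge> 0"
  using assms
proof (induction A arbitrary: k)
  case (add a A)
  have *: "a \<le> 0" "\<And>k. coeff (rp A) k \<ge> 0" using add by auto
  then have "- a * coeff (rp A) k \<ge> 0" for k by (simp add: mult_nonpos_nonneg)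
  with * show ?case by (auto simp: coeff_pCons intro: order_trans split: nat.split)
qed (auto simp: one_pCons coeff_pCons split: nat.split)

lemma coeff_rp_pos:
  assumes "\<And>a. a \<in># A \<Longrightarrow> a < 0" "k \<le> size A"
  shows "coeff (rp A) k > 0"
  using assms
proof (induction A arbitrary: k)
  case (add a A)
  have a: "a < 0" using add by auto
  have nn: "coeff (rp A) j \<ge> 0" for j using add.prems by (intro coeff_rp_nonneg) (auto intro: less_imp_le)
  show ?case
  proof (cases k)
    case 0
    then show ?thesis using a add.IH[of 0] add.prems by (simp add: mult_neg_pos)
  next
    case (Suc j)
    then have "coeff (rp A) j > 0" using add by auto
    moreover have "- a * coeff (rp A) (Suc j) \<ge> 0"
      using a nn by (intro mult_nonneg_nonneg) auto
    ultimately show ?thesis using Suc by simp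
  qed
qed simp

lemma poly_rp_pos: "(\<And>a. a \<in># A \<Longrightarrow> a < x) \<Longrightarrow> poly (rp A) x > 0"
  by (induction A) (auto simp del: mult_pCons_left)

lemma poly_pos_of_coeff_nonneg:
  fixes p :: "real poly"
  assumes "\<And>k. coeff p k \<ge> 0" "p \<noteq> 0" "x > 0"
  shows "poly p x > 0"
proof -
  have "poly p x = (\<Sum>k\<le>degree p. coeff p k * x ^ k)" by (rule poly_altdef)
  also have "\<dots> \<ge> lead_coeff p * x ^ degree p"
    using assms by (intro member_le_sum) auto
  moreover have "lead_coeff p > 0"
    using assms(1)[of "degree p"] assms(2) by (simp add: order_less_le)
  then have "lead_coeff p * x ^ degree p > 0" using assms(3) by simp
  ultimately show ?thesis by linarith
qed

lemma hyperbolic_power: "hyperbolic p \<Longrightarrow> hyperbolic (p ^ n)"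
  by (induction n)
    (use hyperbolic_const[of 1] in \<open>simp_all add: hyperbolic_mult_iff one_pCons\<close>)

lemma smult_sum_right: "smult c (\<Sum>x\<in>A. f x) = (\<Sum>x\<in>A. smult c (f x))"
  by (induction A rule: infinite_finite_induct) (simp_all add: smult_add_right)

lemma linear_mult_degree:
  fixes h :: "real poly"
  assumes "h \<noteq> 0"
  shows "degree ([:- x, 1:] * h) = Suc (degree h)"
    and "lead_coeff ([:- x, 1:] * h) = lead_coeff h"
    and "[:- x, 1:] * h \<noteq> 0"
proof -
  show "degree ([:- x, 1:] * h) = Suc (degree h)"
    using degree_mult_eq[of "[:- x, 1:]" h] assms by (simp del: mult_pCons_left)
  show "lead_coeff ([:- x, 1:] * h) = lead_coeff h"
    using lead_coeff_mult[of "[:- x, 1:]" h] by (simp del: mult_pCons_left)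
  show "[:- x, 1:] * h \<noteq> 0" using assms by (simp del: mult_pCons_left)
qed

lemma hyperbolic_pf [simp]: "hyperbolic (pf n x)"
  and degree_pf [simp]: "degree (pf n x) = n"
  and coeff_pf_top [simp]: "coeff (pf n x) n = 1"
  and pf_nz [simp]: "pf n x \<noteq> 0"
  using monic_rp[of "image_mset x (mset_set {..<n})"]
  by (simp_all add: pf_rp hyperbolic_rp degree_rp)

section \<open>Zeros in increasing order\<close>

lemma sorted_nth_le_iff:
  fixes xs :: "real list"
  assumes "sorted xs" "i < length xs"
  shows "xs ! i \<le> t \<longleftrightarrow> i < length (filter (\<lambda>x. x \<le> t) xs)"
  using assms
proof (induction xs arbitrary: i)
  case (Cons x xs)
  show ?case
  proof (cases "x \<le> t")
    case True
    then show ?thesis using Cons by (cases i) auto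
  next
    case False
    then have gt: "\<not> y \<le> t" if "y \<in> set (x # xs)" for y using that Cons.prems by force
    then have "filter (\<lambda>x. x \<le> t) (x # xs) = []" unfolding filter_empty_conv by blast
    moreover have "\<not> (x # xs) ! i \<le> t" using gt[OF nth_mem[OF Cons.prems(2)]] .
    ultimately show ?thesis by simp
  qed
qed simp

lemma sorted_zeros: "sorted (zeros p)"
  by (simp add: zeros_def)

lemma mset_zeros: "mset (zeros p) = proots p"
  by (simp add: zeros_def)

lemma length_zeros: "hyperbolic p \<Longrightarrow> length (zeros p) = degree p"
  by (metis hyperbolic_size_proots mset_zeros size_mset)

text \<open>The dictionary between counts and positions: inequalities of \<open>nz\<close> become
  inequalities of the i-th zeros.\<close>

lemma zeros_le_iff: "i < length (zeros p) \<Longrightarrow> zeros p ! i \<le> t \<longleftrightarrow> i < nz p t"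
  unfolding nz_def using sorted_nth_le_iff[OF sorted_zeros]
  by (metis mset_filter mset_zeros size_mset)

lemma set_zeros: "p \<noteq> 0 \<Longrightarrow> set (zeros p) = {x. poly p x = 0}"
  by (metis mset_zeros set_count_proots set_mset_mset)

lemma poly_zeros_nth: "p \<noteq> 0 \<Longrightarrow> i < length (zeros p) \<Longrightarrow> poly p (zeros p ! i) = 0"
  using set_zeros nth_mem by blast

lemma zeros_mono:
  assumes "hyperbolic p" "hyperbolic p'" "degree p = degree p'"
    and "\<And>t. nz p' t \<le> nz p t" "i < degree p"
  shows "zeros p ! i \<le> zeros p' ! i"
proof -
  have "i < nz p' (zeros p' ! i)" using assms zeros_le_iff[of i p' "zeros p' ! i"] by (simp add: length_zeros)
  then have "i < nz p (zeros p' ! i)" using assms(4) less_le_trans by blast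
  then show ?thesis using assms zeros_le_iff[of i p] by (simp add: length_zeros)
qed

lemma zeros_shift:
  assumes "hyperbolic p" "hyperbolic p'" "degree p = degree p'"
    and "\<And>t. nz p t \<le> Suc (nz p' t)" "Suc i < degree p"
  shows "zeros p' ! i \<le> zeros p ! Suc i"
proof -
  have "Suc i < nz p (zeros p ! Suc i)" using assms zeros_le_iff[of "Suc i" p "zeros p ! Suc i"] by (simp add: length_zeros)
  then have "i < nz p' (zeros p ! Suc i)" using assms(4)[of "zeros p ! Suc i"] by simp
  then show ?thesis using assms zeros_le_iff[of i p'] by (simp add: length_zeros)
qed

lemma nz_pos:
  assumes "p \<noteq> 0" "poly p t = 0"
  shows "0 < nz p t"
proof -
  have "t \<in># filter_mset (\<lambda>x. x \<le> t) (proots p)" using assms by simp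
  then show ?thesis unfolding nz_def by (metis gr0I size_eq_0_iff_empty empty_iff set_mset_empty)
qed

text \<open>Tarski's argument: the supremum of the points with x \<le> g x is fixed. It stands in
  for the intermediate value theorem, which would require a zero to depend continuously on the
  parameter.\<close>

lemma mono_fixed_point:
  fixes g :: "real \<Rightarrow> real"
  assumes "a \<le> b" "a \<le> g a" "g b \<le> b" and mono: "\<And>x y. a \<le> x \<Longrightarrow> x \<le> y \<Longrightarrow> y \<le> b \<Longrightarrow> g x \<le> g y"
  obtains x where "a \<le> x" "x \<le> b" "g x = x"
proof -
  define S where "S = {x. a \<le> x \<and> x \<le> b \<and> x \<le> g x}"
  define s where "s = Sup S"
  have aS: "a \<in> S" using assms by (simp add: S_def)
  have bdd: "bdd_above S" unfolding bdd_above_def S_def by auto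
  have up: "x \<le> s" if "x \<in> S" for x unfolding s_def using that bdd by (rule cSup_upper)
  have as: "a \<le> s" using up aS by blast
  have sb: "s \<le> b" unfolding s_def by (rule cSup_least) (use aS in \<open>auto simp: S_def\<close>)
  have "s \<le> g s" unfolding s_def
  proof (rule cSup_least)
    fix x assume x: "x \<in> S"
    then have "g x \<le> g (Sup S)" using up[OF x] sb by (intro mono) (auto simp: S_def s_def)
    then show "x \<le> g (Sup S)" using x by (simp add: S_def)
  qed (use aS in auto)
  moreover have "g s \<in> S"
  proof -
    have "g s \<le> b" using mono[OF as sb] assms(3) by auto
    moreover have "g s \<le> g (g s)" using as \<open>s \<le> g s\<close> calculation by (intro mono) auto
    ultimately show ?thesis using as \<open>s \<le> g s\<close> by (simp add: S_def)
  qed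
  then have "g s \<le> s" by (rule up)
  ultimately show thesis using that as sb by (metis antisym)
qed

lemma poly_same_sgn:
  fixes p :: "real poly"
  assumes "s \<le> t" "\<And>x. s \<le> x \<Longrightarrow> x \<le> t \<Longrightarrow> poly p x \<noteq> 0" "poly p s > 0"
  shows "poly p t > 0"
proof (rule ccontr)
  assume "\<not> ?thesis"
  then have neg: "poly p t < 0" using assms(1) assms(2)[of t] by simp
  then have "s < t" using assms by (cases "s = t") auto
  then show False using poly_IVT_neg[of s t p] assms neg by force
qed

section \<open>Interlacing and zero patterns\<close>

lemma mset_map_upt: "mset (map g [0..<n]) = image_mset g (mset_set {..<n})"
  by (simp only: mset_map mset_set_upto_eq_mset_upto)

lemma nth_splice:
  assumes "length xs = length ys" "i < length xs"
  shows "splice xs ys ! (2 * i) = xs ! i" "splice xs ys ! Suc (2 * i) = ys ! i"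
proof -
  have "splice xs ys ! (2 * i) = xs ! i \<and> splice xs ys ! Suc (2 * i) = ys ! i"
    using assms
  proof (induction xs ys arbitrary: i rule: list_induct2)
    case (Cons x xs y ys)
    then show ?case by (cases i) auto
  qed simp
  then show "splice xs ys ! (2 * i) = xs ! i" "splice xs ys ! Suc (2 * i) = ys ! i" by auto
qed

lemma chain_iff_nth:
  assumes "length xs = length ys" "transp R"
  shows "chain R xs ys \<longleftrightarrow> (\<forall>i<length xs. R (xs ! i) (ys ! i)) \<and>
    (\<forall>i. Suc i < length xs \<longrightarrow> R (ys ! i) (xs ! Suc i))" (is "_ \<longleftrightarrow> ?A \<and> ?B")
proof
  assume "chain R xs ys"
  then have R: "R (splice xs ys ! i) (splice xs ys ! Suc i)" if "Suc i < length xs + length xs" for i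
    using that assms by (simp add: chain_def sorted_wrt_iff_nth_Suc_transp)
  show "?A \<and> ?B"
  proof (intro conjI allI impI)
    fix i assume "i < length xs"
    then show "R (xs ! i) (ys ! i)" using R[of "2 * i"] nth_splice[OF assms(1), of i] by simp
  next
    fix i assume "Suc i < length xs"
    then show "R (ys ! i) (xs ! Suc i)"
      using R[of "Suc (2 * i)"] nth_splice(2)[OF assms(1), of i] nth_splice(1)[OF assms(1), of "Suc i"] by simp
  qed
next
  assume AB: "?A \<and> ?B"
  have "R (splice xs ys ! i) (splice xs ys ! Suc i)" if i: "Suc i < length xs + length xs" for i
  proof (cases "even i")
    case True
    then obtain j where j: "i = 2 * j" by (elim evenE)
    then show ?thesis using AB i nth_splice[OF assms(1), of j] by simp
  next
    case False
    then obtain j where j: "i = Suc (2 * j)" by (metis oddE Suc_eq_plus1)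
    then have "Suc j < length xs" using i by simp
    then show ?thesis
      using AB j nth_splice(2)[OF assms(1), of j] nth_splice(1)[OF assms(1), of "Suc j"] by simp
  qed
  then show "chain R xs ys" using assms by (simp add: chain_def sorted_wrt_iff_nth_Suc_transp)
qed

lemma zeros_pf:
  assumes "\<And>i j. i \<le> j \<Longrightarrow> j < n \<Longrightarrow> x i \<le> x j"
  shows "zeros (pf n x) = map x [0..<n]"
proof -
  have "proots (pf n x) = mset (map x [0..<n])"
    by (simp only: pf_rp proots_rp mset_map_upt)
  moreover have "sorted (map x [0..<n])"
    using assms by (simp add: sorted_iff_nth_mono)
  ultimately show ?thesis unfolding zeros_def
    by (metis mset_sorted_list_of_multiset properties_for_sort sorted_sorted_list_of_multiset)
qed

lemma poly_pf: "poly (pf n x) t = (\<Prod>i<n. t - x i)"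
  by (simp add: pf_def poly_prod)

lemma poly_pf_eq_0_iff: "poly (pf n x) t = 0 \<longleftrightarrow> (\<exists>i<n. t = x i)"
  by (auto simp: poly_pf)

lemma poly_pderiv_pf:
  assumes "poly (pf n x) t \<noteq> 0"
  shows "poly (pderiv (pf n x)) t = poly (pf n x) t * (\<Sum>i<n. 1 / (t - x i))"
  using assms
proof (induction n)
  case (Suc n)
  then have "t - x n \<noteq> 0" "poly (pf n x) t \<noteq> 0" by (auto simp: pf_Suc)
  moreover have "pderiv (pf (Suc n) x) = [:- x n, 1:] * pderiv (pf n x) + pf n x"
    unfolding pf_Suc pderiv_mult by (simp add: pderiv_pCons del: mult_pCons_left)
  ultimately have "poly (pderiv (pf (Suc n) x)) t =
      (t - x n) * (poly (pf n x) t * (\<Sum>i<n. 1 / (t - x i))) + poly (pf n x) t"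
    using Suc.IH by (simp del: mult_pCons_left)
  also have "\<dots> = (t - x n) * poly (pf n x) t * ((\<Sum>i<n. 1 / (t - x i)) + 1 / (t - x n))"
    using \<open>t - x n \<noteq> 0\<close> by (simp only: distrib_left) simp
  finally show ?case by (simp add: pf_Suc del: mult_pCons_left)
qed simp

lemma inverse_diff_mono:
  fixes t :: real
  assumes "a \<le> b" "(a < t \<and> b < t) \<or> (t < a \<and> t < b)"
  shows "1 / (t - a) \<le> 1 / (t - b)"
  using assms by (auto simp: divide_simps)

lemma interlaced_mono:
  fixes x y :: "nat \<Rightarrow> real"
  assumes "\<And>i. i < n \<Longrightarrow> x i \<le> y i" "\<And>i. Suc i < n \<Longrightarrow> y i \<le> x (Suc i)"
    and "i < j" "j < n"
  shows "y i \<le> x j"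
  using assms(3,4)
proof (induction j)
  case (Suc j)
  show ?case
  proof (cases "i = j")
    case False
    then have "y i \<le> x j" using Suc by simp
    also have "\<dots> \<le> y j" using Suc by (intro assms(1)) simp
    also have "\<dots> \<le> x (Suc j)" using Suc by (intro assms(2)) simp
    finally show ?thesis .
  qed (use Suc assms in simp)
qed simp

text \<open>With \<open>\<phi>(s) = 1/(t - s)\<close>, the logarithmic derivatives differ by
  \<open>\<Sum> \<phi>(x\<^sub>i) - \<phi>(y\<^sub>i) = \<phi>(x\<^sub>0) - \<phi>(y\<^sub>n\<^sub>-\<^sub>1) + \<Sum> \<phi>(x\<^sub>i\<^sub>+\<^sub>1) - \<phi>(y\<^sub>i)\<close>; the first form has nonpositive terms
  if \<open>t\<close> lies in no interval \<open>(x\<^sub>i, y\<^sub>i)\<close>, the second nonnegative ones otherwise.\<close>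

lemma interlaced_wronskian:
  assumes xy: "\<And>i. i < n \<Longrightarrow> x i \<le> y i" and yx: "\<And>i. Suc i < n \<Longrightarrow> y i \<le> x (Suc i)"
  shows "poly (pderiv (pf n x) * pf n y - pf n x * pderiv (pf n y)) t \<le> 0"
proof -
  define W where "W = pderiv (pf n x) * pf n y - pf n x * pderiv (pf n y)"
  note yx' = interlaced_mono[of n x y, OF xy yx]
  have generic: "poly W t \<le> 0" if t: "poly (pf n x * pf n y) t \<noteq> 0" for t
  proof -
    have nz: "poly (pf n x) t \<noteq> 0" "poly (pf n y) t \<noteq> 0" using t by auto
    have ne: "t \<noteq> x i" "t \<noteq> y i" if "i < n" for i
      using nz that unfolding poly_pf_eq_0_iff by auto
    define S where "S = (\<Sum>i<n. 1 / (t - x i)) - (\<Sum>i<n. 1 / (t - y i))"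
    define F where "F = (\<Prod>i<n. (t - x i) * (t - y i))"
    have W: "poly W t = F * S"
    proof -
      have "F = poly (pf n x) t * poly (pf n y) t"
        by (simp only: F_def poly_pf prod.distrib)
      then show ?thesis
        by (simp add: W_def S_def poly_pderiv_pf[OF nz(1)] poly_pderiv_pf[OF nz(2)] right_diff_distrib)
    qed
    show ?thesis
    proof (cases "\<exists>k<n. x k < t \<and> t < y k")
      case False
      have side: "(x i < t \<and> y i < t) \<or> (t < x i \<and> t < y i)" if "i < n" for i
        using False that ne[OF that] xy[OF that] by force
      have "F > 0" unfolding F_def
        by (rule prod_pos) (use side in \<open>auto simp: zero_less_mult_iff\<close>)
      moreover have "S \<le> 0" unfolding S_def
        using sum_mono[of "{..<n}" "\<lambda>i. 1 / (t - x i)" "\<lambda>i. 1 / (t - y i)"]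
          inverse_diff_mono[OF xy side] by auto
      ultimately show ?thesis unfolding W by (simp add: mult_le_0_iff)
    next
      case True
      then obtain k where k: "k < n" "x k < t" "t < y k" by blast
      have low: "y i < t" if "i < k" for i using yx'[of i k] that k by simp
      have high: "t < x i" if "k < i" "i < n" for i using yx'[of k i] that k by simp
      have "F = ((t - x k) * (t - y k)) * (\<Prod>i\<in>{..<n} - {k}. (t - x i) * (t - y i))"
        unfolding F_def using k by (intro prod.remove) auto
      moreover have "(\<Prod>i\<in>{..<n} - {k}. (t - x i) * (t - y i)) > 0"
      proof (rule prod_pos)
        fix i assume i: "i \<in> {..<n} - {k}"
        show "0 < (t - x i) * (t - y i)"
        proof (cases "i < k")
          case True
          then show ?thesis using low[of i] xy[of i] i by (intro mult_pos_pos) auto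
        next
          case False
          then show ?thesis using high[of i] xy[of i] i by (intro mult_neg_neg) auto
        qed
      qed
      moreover have "(t - x k) * (t - y k) < 0" using k by (intro mult_pos_neg) auto
      ultimately have F: "F < 0" by (simp add: mult_neg_pos)
      obtain m where m: "n = Suc m" using k by (cases n) auto
      have "S = 1 / (t - x 0) + - (1 / (t - y m)) + (\<Sum>i<m. 1 / (t - x (Suc i)) - 1 / (t - y i))"
        unfolding S_def m sum.lessThan_Suc_shift[of "\<lambda>i. 1 / (t - x i)"] sum.lessThan_Suc
        by (simp add: sum_subtractf)
      also have "\<dots> \<ge> 0"
      proof (intro add_nonneg_nonneg sum_nonneg)
        have "x 0 < t" using k low[of 0] xy[of 0] by (cases "k = 0") auto
        then show "0 \<le> 1 / (t - x 0)" by simp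
        have "t < y m" using k high[of m] xy[of m] m by (cases "k = m") auto
        then show "0 \<le> - (1 / (t - y m))" by (simp add: divide_nonneg_neg)
        fix i assume i: "i \<in> {..<m}"
        have "(y i < t \<and> x (Suc i) < t) \<or> (t < y i \<and> t < x (Suc i))"
        proof (cases "i < k")
          case True
          have "x (Suc i) < t"
            using True k low[of "Suc i"] xy[of "Suc i"] by (cases "Suc i = k") auto
          then show ?thesis using low[OF True] by simp
        next
          case False
          have "t < y i" using False k high[of i] xy[of i] i m by (cases "i = k") auto
          moreover have "t < x (Suc i)" using False i m by (intro high) auto
          ultimately show ?thesis by simp
        qed
        then show "0 \<le> 1 / (t - x (Suc i)) - 1 / (t - y i)"
          using inverse_diff_mono[of "y i" "x (Suc i)" t] yx[of i] i m by simp
      qed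
      finally show ?thesis unfolding W using F by (simp add: mult_le_0_iff)
    qed
  qed
  have "pf n x * pf n y \<noteq> 0" by simp
  then obtain t' where t': "t < t'" "\<And>s. t < s \<Longrightarrow> s \<le> t' \<Longrightarrow> poly (pf n x * pf n y) s \<noteq> 0"
    by (rule root_free_right[of _ t]) blast
  have "(poly W \<longlongrightarrow> poly W t) (at_right t)"
    by (intro tendsto_intros tendsto_ident_at)
  moreover have "\<forall>\<^sub>F s in at_right t. poly W s \<le> 0"
    unfolding eventually_at_right[OF t'(1)] using generic t' by (intro exI[of _ t']) auto
  ultimately have "poly W t \<le> 0" by (rule tendsto_upperbound) simp
  then show ?thesis by (simp add: W_def)
qed

lemma proper_position_pf:
  assumes xy: "\<And>i. i < n \<Longrightarrow> x i \<le> y i" and yx: "\<And>i. Suc i < n \<Longrightarrow> y i \<le> x (Suc i)"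
  shows "proper_position (pf n x) (pf n y)"
proof -
  note yx' = interlaced_mono[of n x y, OF xy yx]
  have "x i \<le> x j" "y i \<le> y j" if "i \<le> j" "j < n" for i j
    using yx'[of i j] xy[of i] xy[of j] that by (cases "i = j"; force)+
  then have z: "zeros (pf n x) = map x [0..<n]" "zeros (pf n y) = map y [0..<n]"
    by (simp_all add: zeros_pf)
  have "chain (\<le>) (map x [0..<n]) (map y [0..<n])"
    by (subst chain_iff_nth) (use xy yx in auto)
  then show ?thesis
    using interlaced_wronskian[of n x y, OF xy yx] by (simp add: proper_position_def interlace_def z)
qed

lemma strictly_interlace_pf:
  assumes xy: "\<And>i. i < n \<Longrightarrow> x i \<le> y i" and yx: "\<And>i. Suc i < n \<Longrightarrow> y i \<le> x (Suc i)"
    and ne: "\<And>i j. i < n \<Longrightarrow> j < n \<Longrightarrow> x i \<noteq> y j"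
  shows "coprime (pf n x) (pf n y)" "strictly_interlace (pf n x) (pf n y)"
proof -
  note yx' = interlaced_mono[of n x y, OF xy yx]
  have "x i \<le> x j" "y i \<le> y j" if "i \<le> j" "j < n" for i j
    using yx'[of i j] xy[of i] xy[of j] that by (cases "i = j"; force)+
  then have z: "zeros (pf n x) = map x [0..<n]" "zeros (pf n y) = map y [0..<n]"
    by (simp_all add: zeros_pf)
  have "chain (<) (map x [0..<n]) (map y [0..<n])"
    by (subst chain_iff_nth) (use xy yx ne in \<open>auto simp: order_less_le dest: sym\<close>)
  then show "strictly_interlace (pf n x) (pf n y)" by (simp add: strictly_interlace_def z)
  show "coprime (pf n x) (pf n y)"
  proof (rule coprimeI, rule ccontr)
    fix d assume d: "d dvd pf n x" "d dvd pf n y" "\<not> is_unit d"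
    then obtain e where "pf n x = d * e" by (elim dvdE)
    then have hd: "hyperbolic d" using hyperbolic_pf[of n x] by (simp only: hyperbolic_mult_iff)
    then have "degree d > 0" using d(3) hyperbolic_nz is_unit_iff_degree by blast
    then obtain t where "poly d t = 0" using hyperbolic_has_root[OF hd] by blast
    then have "poly (pf n x) t = 0" "poly (pf n y) t = 0" using d by (auto elim!: dvdE)
    then show False using ne unfolding poly_pf_eq_0_iff by blast
  qed
qed

lemma mono_bounded_LIMSEQ:
  fixes X :: "nat \<Rightarrow> real"
  assumes "\<And>k. X k \<le> X (Suc k)" "\<And>k. X k \<le> b"
  shows "\<exists>l. X \<longlonglongrightarrow> l"
  using incseq_convergent[of X b] assms by (meson incseq_SucI)

lemma poly_lim_eq: "pconv X p \<Longrightarrow> poly_lim X = p"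
  unfolding poly_lim_def pconv_def[symmetric] by (rule the_equality) (auto intro: pconv_unique)

text \<open>List position belonging to the i-th smallest element of a pattern. Patterns number zeros
  from 1, so the subtraction does not truncate.\<close>

definition idx :: "nat set \<Rightarrow> nat \<Rightarrow> nat" where
  "idx B i = sorted_list_of_set B ! i - 1"

lemma idx_less:
  assumes "B \<subseteq> {1..m}" "i < card B"
  shows "idx B i < m" "Suc (idx B i) = sorted_list_of_set B ! i"
proof -
  have "finite B" using assms finite_subset by blast
  then have "sorted_list_of_set B ! i \<in> B"
    using assms(2) nth_mem[of i "sorted_list_of_set B"] by simp
  then have "1 \<le> sorted_list_of_set B ! i" "sorted_list_of_set B ! i \<le> m" using assms(1) by auto
  then show "idx B i < m" "Suc (idx B i) = sorted_list_of_set B ! i" by (auto simp: idx_def)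
qed

lemma image_mset_idx:
  assumes "finite B" "card B = n"
  shows "image_mset (\<lambda>i. g (idx B i)) (mset_set {..<n}) = image_mset (\<lambda>b. g (b - 1)) (mset_set B)"
proof -
  have "mset_set B = mset (sorted_list_of_set B)"
    by (metis assms(1) distinct_sorted_list_of_set mset_set_set set_sorted_list_of_set)
  also have "\<dots> = mset (map (\<lambda>i. sorted_list_of_set B ! i) [0..<n])"
    using assms by (metis map_nth length_sorted_list_of_set)
  finally show ?thesis
    by (simp add: idx_def mset_map_upt image_mset.compositionality comp_def del: mset_map)
qed

text \<open>The pattern prescribes the zeros of f among those of p; being monic then fixes f, and
  cancelling f fixes v. This resolves the definite description into an explicit selection of
  zeros.\<close>

lemma snd_pattern_factorization:
  assumes p: "hyperbolic p" "degree p = n + r" and B: "B \<subseteq> {1..n + r}" "card B = n"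
  shows "snd (pattern_factorization ({1..n + r} - B) B p) = pf n (\<lambda>i. zeros p ! idx B i)"
proof -
  define A where "A = {1..n + r} - B"
  define z where "z i = zeros p ! (i - 1)" for i
  define f where "f = rp (image_mset z (mset_set B))"
  define v where "v = smult (lead_coeff p) (rp (image_mset z (mset_set A)))"
  have finB: "finite B" and finA: "finite A" using B finite_subset by (auto simp: A_def)
  have cA: "card A = r" using B finB by (simp add: A_def card_Diff_subset)
  have AB: "A \<union> B = {1..n + r}" "A \<inter> B = {}" using B by (auto simp: A_def)
  have lc: "lead_coeff p \<noteq> 0" using hyperbolic_nz[OF p(1)] by simp
  have "image_mset z (mset_set A) + image_mset z (mset_set B) = image_mset z (mset_set {1..n + r})"
    using mset_set_Union[OF finA finB AB(2)] AB(1) by simp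
  also have "\<dots> = mset (map (\<lambda>i. zeros p ! i) [0..<n + r])"
  proof -
    have "mset_set {1..n + r} = image_mset Suc (mset_set {..<n + r})"
      by (subst image_mset_mset_set) (auto simp: image_Suc_lessThan)
    then show ?thesis
      by (simp add: z_def image_mset.compositionality comp_def mset_map_upt del: mset_map)
  qed
  also have "\<dots> = proots p"
    using length_zeros[OF p(1)] p(2) by (metis map_nth mset_zeros)
  finally have AB_roots: "image_mset z (mset_set A) + image_mset z (mset_set B) = proots p" .
  then have vf: "v * f = p"
    using hyperbolic_factor[OF p(1)] by (simp add: v_def f_def flip: rp_union)
  have dv: "degree v = r" "degree f = n"
    using lc cA B(2) by (simp_all add: v_def f_def degree_rp)
  have "pattern_factorization A B p = (v, f)"
    unfolding pattern_factorization_def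
  proof (rule the_equality)
    have "hyperbolic v" using lc by (simp add: v_def hyperbolic_smult hyperbolic_rp)
    moreover have "proots v = image_mset z (mset_set A)" using lc by (simp add: v_def)
    moreover have "(\<lambda>i. zeros p ! (i - 1)) = z" by (simp add: z_def fun_eq_iff)
    ultimately have "zero_pattern A B v f"
      unfolding zero_pattern_def vf using dv cA B(2) AB
      by (simp add: f_def hyperbolic_rp)
    then show "case (v, f) of (v, f) \<Rightarrow> p = v * f \<and> lead_coeff f = 1 \<and> zero_pattern A B v f"
      using vf monic_rp by (simp add: f_def)
  next
    fix vf' assume *: "case vf' of (v, f) \<Rightarrow> p = v * f \<and> lead_coeff f = 1 \<and> zero_pattern A B v f"
    obtain v' f' where [simp]: "vf' = (v', f')" by (cases vf')
    have h: "p = v' * f'" "lead_coeff f' = 1" and zp: "zero_pattern A B v' f'" using * by auto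
    have h': "hyperbolic f'" "proots f' = image_mset z (mset_set B)"
      using zp unfolding zero_pattern_def h(1)[symmetric] by (simp_all add: z_def[abs_def])
    then have f': "f' = f" using hyperbolic_monic_unique[of f'] h h' by (simp add: f_def)
    then have "v' * f = v * f" using h(1) vf by metis
    moreover have "f \<noteq> 0" by (simp add: f_def)
    ultimately have "v' = v" using mult_right_cancel by blast
    then show "vf' = (v, f)" using f' by simp
  qed
  then have "snd (pattern_factorization A B p) = f" by simp
  also have "f = pf n (\<lambda>i. zeros p ! idx B i)"
    using image_mset_idx[OF finB B(2), of "\<lambda>i. zeros p ! i"] by (simp add: f_def pf_rp z_def[abs_def])
  finally show ?thesis by (simp add: A_def)
qed

text \<open>By parity, 2b \<le> 2c + 1 means b \<le> c, while 2c + 1 \<le> 2b' means c < b'. The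
  strictness of the second inequality is what later absorbs a shift by one position.\<close>

lemma arrow_idx:
  assumes "arrow B C" "B \<subseteq> {1..m}" "C \<subseteq> {1..m}" "card B = n" "card C = n"
  shows "i < n \<Longrightarrow> idx B i \<le> idx C i" "Suc i < n \<Longrightarrow> idx C i < idx B (Suc i)"
proof -
  let ?b = "map (\<lambda>b. 2 * b) (sorted_list_of_set B)"
  let ?c = "map (\<lambda>c. 2 * c + 1) (sorted_list_of_set C)"
  have fin: "finite B" "finite C" using assms finite_subset by blast+
  have len: "length (sorted_list_of_set B) = n" "length (sorted_list_of_set C) = n"
    using assms by simp_all
  have "chain (\<le>) ?b ?c" using assms(1) by (simp add: arrow_def)
  moreover have "length ?b = length ?c" by (simp add: assms(4,5))
  ultimately have *: "(\<forall>i<length ?b. ?b ! i \<le> ?c ! i) \<and>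
      (\<forall>i. Suc i < length ?b \<longrightarrow> ?c ! i \<le> ?b ! Suc i)"
    using chain_iff_nth[of ?b ?c "(\<le>)"] transp_on_le by blast
  show "idx B i \<le> idx C i" if i: "i < n"
  proof -
    have "?b ! i \<le> ?c ! i" using * i len by simp
    then have "sorted_list_of_set B ! i \<le> sorted_list_of_set C ! i" using i len by simp
    then show ?thesis unfolding idx_def by (rule diff_le_mono)
  qed
  show "idx C i < idx B (Suc i)" if i: "Suc i < n"
  proof -
    have "?c ! i \<le> ?b ! Suc i" using * i len by simp
    then have "sorted_list_of_set C ! i < sorted_list_of_set B ! Suc i" using i len by simp
    moreover have "Suc (idx C i) = sorted_list_of_set C ! i"
      using idx_less(2)[OF assms(3), of i] assms(5) i by simp
    ultimately show ?thesis unfolding idx_def by simp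
  qed
qed

lemma idx_strict_mono:
  assumes "B \<subseteq> {1..m}" "i < j" "j < card B"
  shows "idx B i < idx B j"
proof -
  have "finite B" using assms finite_subset by blast
  then have "sorted_list_of_set B ! i < sorted_list_of_set B ! j"
    using assms(2,3) by (intro sorted_wrt_nth_less[of "(<)"]) auto
  moreover have "Suc (idx B i) = sorted_list_of_set B ! i"
    using idx_less(2)[OF assms(1), of i] assms(2,3) by simp
  ultimately show ?thesis unfolding idx_def by simp
qed

section \<open>Duality\<close>

text \<open>Laguerre's inequality at 0, with strictness: p_1^2 - 2 p_0 p_2 is p(0)^2 times the sum
  of 1/a^2 over the zeros a. The recursion \<open>step\<close> expresses this without
  division.\<close>

lemma coeff_rp_laguerre:
  assumes "coeff (rp A) 0 \<noteq> 0" "A \<noteq> {#}"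
  shows "2 * coeff (rp A) 0 * coeff (rp A) 2 < (coeff (rp A) 1)\<^sup>2"
proof -
  have step: "(coeff ([:- x, 1:] * p) 1)\<^sup>2 - 2 * coeff ([:- x, 1:] * p) 0 * coeff ([:- x, 1:] * p) 2 =
      (coeff p 0)\<^sup>2 + x\<^sup>2 * ((coeff p 1)\<^sup>2 - 2 * coeff p 0 * coeff p 2)" for x and p :: "real poly"
    by (simp add: numeral_2_eq_2 power2_eq_square algebra_simps)
  have nonneg: "(coeff (rp A) 1)\<^sup>2 - 2 * coeff (rp A) 0 * coeff (rp A) 2 \<ge> 0" for A
  proof (induction A)
    case (add x A)
    then show ?case unfolding rp_add_mset step by (intro add_nonneg_nonneg mult_nonneg_nonneg) auto
  qed simp
  obtain x A' where A: "A = add_mset x A'" using assms(2) by (meson multiset_cases)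
  have "coeff (rp A') 0 \<noteq> 0" using assms(1) A by auto
  then have "(coeff (rp A) 1)\<^sup>2 - 2 * coeff (rp A) 0 * coeff (rp A) 2 > 0"
    unfolding A rp_add_mset step using nonneg[of A'] by (intro add_pos_nonneg mult_nonneg_nonneg) auto
  then show ?thesis by simp
qed

lemma cpoly_pderiv_rp:
  assumes "cpoly (rp A) z \<noteq> 0"
  shows "cpoly (pderiv (rp A)) z = cpoly (rp A) z * (\<Sum>a\<in>#A. 1 / (z - of_real a))"
  using assms
proof (induction A)
  case (add a A)
  have lin: "cpoly [:- a, 1:] z = z - of_real a" by (simp add: map_poly_pCons)
  have nz: "z - of_real a \<noteq> 0" "cpoly (rp A) z \<noteq> 0"
    using add.prems unfolding rp_add_mset cpoly_mult lin by auto
  have "pderiv (rp (add_mset a A)) = [:- a, 1:] * pderiv (rp A) + rp A"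
    unfolding rp_add_mset pderiv_mult by (simp add: pderiv_pCons del: mult_pCons_left)
  then have "cpoly (pderiv (rp (add_mset a A))) z =
      (z - of_real a) * (cpoly (rp A) z * (\<Sum>a\<in>#A. 1 / (z - of_real a))) + cpoly (rp A) z"
    using add.IH[OF nz(2)] by (simp only: cpoly_add cpoly_mult lin)
  also have "\<dots> = (z - of_real a) * cpoly (rp A) z * ((\<Sum>a\<in>#A. 1 / (z - of_real a)) + 1 / (z - of_real a))"
    using nz(1) by (simp only: distrib_left) simp
  finally show ?case unfolding rp_add_mset cpoly_mult lin by (simp add: add.commute)
qed (simp add: pderiv_1)

text \<open>At a nonreal z the imaginary part of p'/p + a is -Im z times the sum of 1/|z - x|^2 over
  the zeros x, hence nonzero.\<close>

lemma hyperbolic_pderiv_add: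
  assumes "hyperbolic p"
  shows "pderiv p + smult a p = 0 \<or> hyperbolic (pderiv p + smult a p)"
proof -
  obtain c A where p: "c \<noteq> 0" "p = smult c (rp A)" by (rule hyperbolic_eq_rp[OF assms])
  have eq: "pderiv p + smult a p = smult c (pderiv (rp A) + smult a (rp A))"
    by (simp add: p pderiv_smult smult_add_right mult.commute)
  show ?thesis
  proof (cases "A = {#}")
    case True
    then have "pderiv p + smult a p = [:c * a:]" by (simp add: eq)
    then show ?thesis by (cases "c * a = 0") (simp_all add: hyperbolic_const)
  next
    case False
    have "cpoly (pderiv (rp A) + smult a (rp A)) z \<noteq> 0" if z: "z \<notin> \<real>" for z
    proof -
      have h: "cpoly (rp A) z \<noteq> 0" using hyperbolic_rp[of A] z by (auto simp: hyperbolic_def)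
      have im: "Im z \<noteq> 0" using z by (simp add: complex_is_Real_iff)
      have Im: "Im (\<Sum>a\<in>#A. 1 / (z - of_real a)) = - Im z * (\<Sum>a\<in>#A. 1 / (norm (z - of_real a))\<^sup>2)"
        by (induction A) (simp_all add: Im_divide cmod_power2 algebra_simps)
      have "(\<Sum>a\<in>#A. 1 / (norm (z - of_real a))\<^sup>2) > 0"
        using False
      proof (induction A)
        case (add b A)
        have "z - of_real b \<noteq> 0" using z by (metis Reals_of_real eq_iff_diff_eq_0)
        then have "1 / (norm (z - of_real b))\<^sup>2 > 0" by simp
        then show ?case using add by (cases "A = {#}") (auto intro: add_pos_pos)
      qed simp
      then have "Im ((\<Sum>a\<in>#A. 1 / (z - of_real a)) + of_real a) \<noteq> 0" using im Im by simp
      then have "(\<Sum>a\<in>#A. 1 / (z - of_real a)) + of_real a \<noteq> 0" by (metis zero_complex.sel(2))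
      moreover have "cpoly (pderiv (rp A) + smult a (rp A)) z =
          cpoly (rp A) z * ((\<Sum>a\<in>#A. 1 / (z - of_real a)) + of_real a)"
        by (simp add: cpoly_add cpoly_smult cpoly_pderiv_rp[OF h] algebra_simps)
      ultimately show ?thesis using h by simp
    qed
    then have "hyperbolic (pderiv p + smult a p)" if "pderiv p + smult a p \<noteq> 0"
      using that p(1) unfolding eq hyperbolic_smult[OF p(1)] by (auto simp: hyperbolic_def)
    then show ?thesis by blast
  qed
qed

text \<open>If R' + a R vanishes to order at least 2 at 0, then R agrees with R(0) exp(-a z) up to
  degree 2, and R(0) \<noteq> 0 would give equality in Laguerre's inequality. So R(0) = 0, and the
  recursion yields one vanishing coefficient more than was assumed; t \<ge> 1 supplies the order
  2.\<close>

lemma low_coeffs_pderiv_add: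
  assumes R: "R = 0 \<or> hyperbolic R" and a: "a \<noteq> 0" and t: "t \<ge> 1"
    and S: "\<And>k. k \<le> t \<Longrightarrow> coeff (pderiv R + smult a R) k = 0"
    and k: "k \<le> Suc t"
  shows "coeff R k = 0"
proof -
  have rec: "real (Suc k) * coeff R (Suc k) = - a * coeff R k" if "k \<le> t" for k
    using S[OF that] by (simp add: coeff_pderiv)
  have R0: "coeff R 0 = 0"
  proof (rule ccontr)
    assume r0: "coeff R 0 \<noteq> 0"
    then have "hyperbolic R" using R by auto
    then obtain c A where c: "c \<noteq> 0" "R = smult c (rp A)" by (rule hyperbolic_eq_rp)
    have r1: "coeff R 1 = - a * coeff R 0" and r2: "2 * coeff R 2 = - a * coeff R 1"
      using rec[of 0] rec[of 1] t by (simp_all add: numeral_2_eq_2)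
    have "coeff R 1 \<noteq> 0" using r1 r0 a by simp
    then have "A \<noteq> {#}" using c by auto
    moreover have "coeff (rp A) 0 \<noteq> 0" using r0 c by simp
    ultimately have "c\<^sup>2 * (2 * coeff (rp A) 0 * coeff (rp A) 2) < c\<^sup>2 * (coeff (rp A) 1)\<^sup>2"
      using c(1) coeff_rp_laguerre by (intro mult_strict_left_mono) auto
    then have "coeff R 0 * (2 * coeff R 2) < (coeff R 1)\<^sup>2"
      using c by (simp add: power2_eq_square mult_ac)
    then show False unfolding r2 r1 by (simp add: power2_eq_square algebra_simps)
  qed
  show ?thesis
    using k
  proof (induction k)
    case (Suc k)
    then show ?case using rec[of k] by simp
  qed (rule R0)
qed

text \<open>The functional \<open>\<Lambda>\<^sub>p(h) = \<Sum> p\<^sub>k h\<^sup>(\<^sup>k\<^sup>)(\<theta>)\<close> trades a factor \<open>z - c\<close> of \<open>h\<close> for the operator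
  \<open>p \<mapsto> p' + (\<theta> - c) p\<close>, which preserves hyperbolicity and creates no multiple zeros.\<close>

definition dual :: "real \<Rightarrow> real poly \<Rightarrow> real poly \<Rightarrow> real" where
  "dual \<theta> p h = (\<Sum>k\<le>degree p. coeff p k * poly ((pderiv ^^ k) h) \<theta>)"

lemma dual_bound: "degree p \<le> K \<Longrightarrow> dual \<theta> p h = (\<Sum>k\<le>K. coeff p k * poly ((pderiv ^^ k) h) \<theta>)"
  unfolding dual_def by (intro sum.mono_neutral_left) (auto simp: coeff_eq_0)

lemma higher_pderiv_linear_mult:
  "(pderiv ^^ k) ([:- c, 1:] * h) = [:- c, 1:] * (pderiv ^^ k) h + smult (real k) ((pderiv ^^ (k - 1)) h)"
  for h :: "real poly"
proof (induction k)
  case (Suc k)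
  have "pderiv ([:- c, 1:] * g) = [:- c, 1:] * pderiv g + g" for g :: "real poly"
    unfolding pderiv_mult by (simp add: pderiv_pCons del: mult_pCons_left)
  then have "(pderiv ^^ Suc k) ([:- c, 1:] * h) =
      [:- c, 1:] * (pderiv ^^ Suc k) h + (pderiv ^^ k) h + smult (real k) (pderiv ((pderiv ^^ (k - 1)) h))"
    using Suc by (simp add: pderiv_add pderiv_smult del: mult_pCons_left)
  also have "smult (real k) (pderiv ((pderiv ^^ (k - 1)) h)) = smult (real k) ((pderiv ^^ k) h)"
    by (cases k) simp_all
  finally show ?case by (simp add: smult_add_left del: mult_pCons_left)
qed simp

lemma dual_linear_mult: "dual \<theta> p ([:- c, 1:] * h) = dual \<theta> (pderiv p + smult (\<theta> - c) p) h"
proof -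
  let ?h = "\<lambda>k. poly ((pderiv ^^ k) h) \<theta>"
  define K where "K = degree p"
  have "dual \<theta> p ([:- c, 1:] * h) = (\<Sum>k\<le>Suc K. coeff p k * ((\<theta> - c) * ?h k + real k * ?h (k - 1)))"
  proof -
    have "dual \<theta> p ([:- c, 1:] * h) =
        (\<Sum>k\<le>Suc K. coeff p k * poly ((pderiv ^^ k) ([:- c, 1:] * h)) \<theta>)"
      by (rule dual_bound) (simp add: K_def)
    also have "\<dots> = (\<Sum>k\<le>Suc K. coeff p k * ((\<theta> - c) * ?h k + real k * ?h (k - 1)))"
      unfolding higher_pderiv_linear_mult by (intro sum.cong refl) (simp add: algebra_simps)
    finally show ?thesis .
  qed
  also have "\<dots> = (\<Sum>k\<le>Suc K. (\<theta> - c) * coeff p k * ?h k) + (\<Sum>k\<le>Suc K. real k * coeff p k * ?h (k - 1))"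
    by (simp add: distrib_left sum.distrib mult_ac)
  also have "(\<Sum>k\<le>Suc K. real k * coeff p k * ?h (k - 1)) = (\<Sum>k\<le>K. coeff (pderiv p) k * ?h k)"
    by (subst sum.atMost_Suc_shift) (simp add: coeff_pderiv)
  also have "(\<Sum>k\<le>Suc K. (\<theta> - c) * coeff p k * ?h k) = (\<Sum>k\<le>K. (\<theta> - c) * coeff p k * ?h k)"
    by (simp add: K_def coeff_eq_0)
  also have "(\<Sum>k\<le>K. (\<theta> - c) * coeff p k * ?h k) + (\<Sum>k\<le>K. coeff (pderiv p) k * ?h k) =
      (\<Sum>k\<le>K. coeff (pderiv p + smult (\<theta> - c) p) k * ?h k)"
    by (simp add: distrib_right sum.distrib add.commute)
  also have "\<dots> = dual \<theta> (pderiv p + smult (\<theta> - c) p) h"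
    by (rule dual_bound[symmetric])
      (auto simp: K_def degree_pderiv intro!: degree_add_le order_trans[OF degree_smult_le])
  finally show ?thesis .
qed

lemma poly_higher_pderiv_power:
  "poly ((pderiv ^^ j) ([:- \<theta>, 1:] ^ k)) \<theta> = (if j = k then ff k k else 0)" for \<theta> :: real
  by (cases j k rule: linorder_cases) (auto simp: higher_pderiv_linear_power ff_eq_0 power_0_left)

lemma dual_power: "dual \<theta> p ([:- \<theta>, 1:] ^ k) = coeff p k * ff k k"
proof -
  have "dual \<theta> p ([:- \<theta>, 1:] ^ k) = (\<Sum>j\<le>max k (degree p). if j = k then coeff p k * ff k k else 0)"
    by (subst dual_bound[of _ "max k (degree p)"])
      (simp, intro sum.cong refl, auto simp: poly_higher_pderiv_power)
  then show ?thesis by simp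
qed

text \<open>For empty A, powers of z - \<theta> read off the coefficients 0 to t. Each factor z - c
  then becomes an operator D + (\<theta> - c), and undoing it gains one coefficient; \<theta>
  \<notin> A keeps \<theta> - c nonzero.\<close>

lemma dual_vanishes:
  fixes p :: "real poly"
  assumes "p = 0 \<or> hyperbolic p"
    and "\<And>u :: real poly. degree u \<le> t \<Longrightarrow> dual \<theta> p (rp A * u) = 0"
    and "t \<ge> 1 \<or> A = {#}" "\<theta> \<notin># A" "k \<le> t + size A"
  shows "coeff p k = 0"
  using assms
proof (induction A arbitrary: p k)
  case empty
  have "dual \<theta> p ([:- \<theta>, 1:] ^ k) = 0"
    using empty(2)[of "[:- \<theta>, 1:] ^ k"] empty(5) by (simp add: degree_power_eq)
  then show ?case using ff_pos[of k k] by (simp add: dual_power)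
next
  case (add c A)
  define S where "S = pderiv p + smult (\<theta> - c) p"
  have S: "S = 0 \<or> hyperbolic S"
    using add.prems(1) hyperbolic_pderiv_add[of p "\<theta> - c"] by (auto simp: S_def)
  have "coeff S j = 0" if "j \<le> t + size A" for j
  proof (rule add.IH[OF S _ _ _ that])
    fix u :: "real poly" assume u: "degree u \<le> t"
    have "dual \<theta> p (rp (add_mset c A) * u) = dual \<theta> S (rp A * u)"
      unfolding S_def rp_add_mset mult.assoc dual_linear_mult ..
    then show "dual \<theta> S (rp A * u) = 0" using add.prems(2)[OF u] by simp
  qed (use add.prems in auto)
  then show ?case
    using add.prems by (intro low_coeffs_pderiv_add[of p "\<theta> - c" "t + size A"]) (auto simp: S_def)
qed

text \<open>Multiplicity is the jump of the counting function, so monotonicity of counts under T can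
  be applied to it.\<close>

lemma le_order_iff_nz:
  assumes "p \<noteq> 0"
  shows "j \<le> order \<theta> p \<longleftrightarrow> (\<forall>s<\<theta>. nz p s + j \<le> nz p \<theta>)"
proof -
  define L where "L = size (filter_mset (\<lambda>x. x < \<theta>) (proots p))"
  have "filter_mset (\<lambda>x. x \<le> \<theta>) (proots p) =
      filter_mset (\<lambda>x. x < \<theta>) (proots p) + filter_mset (\<lambda>x. x = \<theta>) (proots p)"
    by (rule multiset_eqI) auto
  moreover have "size (filter_mset (\<lambda>x. x = \<theta>) (proots p)) = order \<theta> p"
    using assms by (simp add: filter_eq_replicate_mset)
  ultimately have nz: "nz p \<theta> = L + order \<theta> p" by (simp add: nz_def L_def)
  have le: "nz p s \<le> L" if "s < \<theta>" for s
  proof -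
    have "filter_mset (\<lambda>x. x \<le> s) (proots p) =
        filter_mset (\<lambda>x. x \<le> s) (filter_mset (\<lambda>x. x < \<theta>) (proots p))"
      using that by (auto simp: filter_filter_mset intro!: filter_mset_cong)
    then show ?thesis unfolding nz_def L_def using size_filter_mset_lesseq by metis
  qed
  have "\<exists>s<\<theta>. nz p s = L"
  proof -
    define S where "S = insert (\<theta> - 1) {x. poly p x = 0 \<and> x < \<theta>}"
    have "finite {x. poly p x = 0 \<and> x < \<theta>}" using poly_roots_finite[OF assms] by (rule rev_finite_subset) auto
    then have fin: "finite S" by (simp add: S_def)
    have "Max S \<in> S" using fin by (intro Max_in) (auto simp: S_def)
    then have "Max S < \<theta>" by (auto simp: S_def)
    moreover have "filter_mset (\<lambda>x. x \<le> Max S) (proots p) = filter_mset (\<lambda>x. x < \<theta>) (proots p)"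
    proof (intro filter_mset_cong refl)
      fix x assume "x \<in># proots p"
      then have "x \<in> S" if "x < \<theta>" using that assms by (simp add: S_def)
      then show "(x \<le> Max S) = (x < \<theta>)" using \<open>Max S < \<theta>\<close> Max_ge[OF fin, of x] by auto
    qed
    ultimately show ?thesis by (auto simp: nz_def L_def)
  qed
  then obtain s0 where s0: "s0 < \<theta>" "nz p s0 = L" by blast
  show ?thesis
  proof
    assume "j \<le> order \<theta> p"
    then show "\<forall>s<\<theta>. nz p s + j \<le> nz p \<theta>" using le nz by (fastforce intro: add_mono)
  next
    assume "\<forall>s<\<theta>. nz p s + j \<le> nz p \<theta>"
    then have "nz p s0 + j \<le> nz p \<theta>" using s0 by blast
    then show "j \<le> order \<theta> p" using s0 nz by simp
  qed
qed

text \<open>The jump at \<theta> does not shrink if the counts to the left do not grow and the count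
  at \<theta> does not fall.\<close>

lemma order_sandwich:
  assumes "p \<noteq> 0" "k \<noteq> 0" "\<And>t. nz k t \<le> nz p t" "nz p \<theta> \<le> nz k \<theta>" "j \<le> order \<theta> p"
  shows "j \<le> order \<theta> k"
  unfolding le_order_iff_nz[OF assms(2)]
proof (intro allI impI)
  fix s assume "s < \<theta>"
  then have "nz p s + j \<le> nz p \<theta>" using assms(5) unfolding le_order_iff_nz[OF assms(1)] by blast
  then show "nz k s + j \<le> nz k \<theta>" using assms(3)[of s] assms(4) by linarith
qed

section \<open>Powers of a nonreal linear factor\<close>

lemma poly_map_Re: "poly (map_poly Re C) t = Re (poly C (of_real t))"
  by (induction C) (simp_all add: map_poly_pCons)

lemma poly_map_Im: "poly (map_poly Im C) t = Im (poly C (of_real t))"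
  by (induction C) (simp_all add: map_poly_pCons)

lemma pderiv_map_Re: "(pderiv ^^ k) (map_poly Re C) = map_poly Re ((pderiv ^^ k) C)"
  by (induction k) (simp_all add: poly_eq_iff coeff_pderiv coeff_map_poly)

lemma pderiv_map_Im: "(pderiv ^^ k) (map_poly Im C) = map_poly Im ((pderiv ^^ k) C)"
  by (induction k) (simp_all add: poly_eq_iff coeff_pderiv coeff_map_poly)

lemma cpoly_map_Re: "cpoly (map_poly Re C) z = (poly C z + cnj (poly C (cnj z))) / 2"
proof -
  have "map_poly of_real (map_poly Re C) = smult (1 / 2) (C + map_poly cnj C)"
    by (rule poly_eqI) (simp add: coeff_map_poly complex_eq_iff)
  then show ?thesis by simp
qed

lemma cpoly_map_Im: "cpoly (map_poly Im C) z = (poly C z - cnj (poly C (cnj z))) / (2 * \<i>)"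
proof -
  have "map_poly of_real (map_poly Im C) = smult (1 / (2 * \<i>)) (C - map_poly cnj C)"
    by (rule poly_eqI) (simp add: coeff_map_poly complex_eq_iff Re_divide Im_divide)
  then show ?thesis by simp
qed

lemma coeff_linear_power_top:
  fixes x :: complex
  shows "coeff ([:- x, 1:] ^ Suc m) (Suc m) = 1" "coeff ([:- x, 1:] ^ Suc m) m = - (of_nat (Suc m) * x)"
proof -
  have top: "coeff ([:- x, 1:] ^ j) j = 1" for j
    using lead_coeff_power[of "[:- x, 1:]" j] by (simp add: degree_power_eq)
  show "coeff ([:- x, 1:] ^ Suc m) (Suc m) = 1" by (rule top)
  show "coeff ([:- x, 1:] ^ Suc m) m = - (of_nat (Suc m) * x)"
  proof (induction m)
    case (Suc m)
    have "coeff ([:- x, 1:] ^ Suc (Suc m)) (Suc m) =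
        coeff ([:- x, 1:] ^ Suc m) m - x * coeff ([:- x, 1:] ^ Suc m) (Suc m)"
      by (subst power_Suc) (simp del: power_Suc)
    then show ?case unfolding Suc top by (simp add: algebra_simps)
  qed simp
qed

text \<open>For nonreal \<open>x\<close>, a combination \<open>\<alpha>(z - x)\<^sup>m + \<alpha>\<^sup>*(z - x\<^sup>*)\<^sup>m\<close> can only vanish where
  \<open>\<bar>z - x\<bar> = \<bar>z - x\<^sup>*\<bar>\<close>, that is, on the real line.\<close>

lemma nonreal_power_pencil:
  fixes x :: complex and m :: nat
  defines "C \<equiv> [:- x, 1:] ^ Suc m"
  defines "F \<equiv> map_poly Re C" and "R \<equiv> smult (- sgn (Im x)) (map_poly Im C)"
  assumes x: "Im x \<noteq> 0"
  shows "hyperbolic (F - smult c R)" "hyperbolic R"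
    and "degree F = Suc m" "lead_coeff F = 1" "degree R = m" "lead_coeff R > 0"
    and "\<not> (poly F t = 0 \<and> poly R t = 0)"
proof -
  have dC: "degree C = Suc m" by (simp add: C_def degree_power_eq del: power_Suc)
  have hiC: "coeff C j = 0" if "j > Suc m" for j using that dC by (simp add: coeff_eq_0)
  have cF: "coeff F (Suc m) = 1"
    by (simp only: F_def C_def coeff_map_poly zero_complex.sel coeff_linear_power_top one_complex.sel)
  \<comment> \<open>The coefficient of z^m in Im C is -(m+1) Im x; the factor -sgn(Im x) in R makes
    it positive, as the direction of motion in the pencil requires.\<close>
  have cRm: "coeff R m = real (Suc m) * \<bar>Im x\<bar>"
  proof -
    have "coeff R m = - sgn (Im x) * Im (- (of_nat (Suc m) * x))"
      by (simp only: R_def C_def coeff_smult coeff_map_poly zero_complex.sel coeff_linear_power_top)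
    also have "\<dots> = real (Suc m) * (sgn (Im x) * Im x)" by simp
    also have "sgn (Im x) * Im x = \<bar>Im x\<bar>" by (simp add: abs_sgn mult.commute)
    finally show ?thesis .
  qed
  have cRS: "coeff R (Suc m) = 0"
    by (simp only: R_def C_def coeff_smult coeff_map_poly zero_complex.sel coeff_linear_power_top
        one_complex.sel mult_zero_right)
  have hiF: "coeff F j = 0" "coeff R j = 0" if "j > Suc m" for j
    using hiC[OF that] by (simp_all add: F_def R_def coeff_map_poly)
  show dF: "degree F = Suc m"
    using le_degree[of F "Suc m"] cF hiF(1) degree_le[of "Suc m" F] by simp
  then show "lead_coeff F = 1" using cF by simp
  have hiR: "coeff R j = 0" if "j > m" for j
    using that cRS hiF(2)[of j] by (cases "j = Suc m") auto
  have "coeff R m > 0" unfolding cRm using x by simp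
  then have "degree R = m" using le_degree[of R m] hiR degree_le[of m R] by simp
  then show dR: "degree R = m" "lead_coeff R > 0" using \<open>coeff R m > 0\<close> by simp_all
  have Cz: "poly C z = (z - x) ^ Suc m" for z by (simp add: C_def del: power_Suc)
  have conj: "cnj (poly C (cnj z)) = (z - cnj x) ^ Suc m" for z by (simp add: Cz del: power_Suc)
  have real: "z \<in> \<real>" if eq: "\<alpha> * (z - x) ^ Suc m = \<beta> * (z - cnj x) ^ Suc m"
    and ab: "norm \<alpha> = norm \<beta>" "\<alpha> \<noteq> 0" for z \<alpha> \<beta>
  proof -
    have "norm \<alpha> * norm (z - x) ^ Suc m = norm \<beta> * norm (z - cnj x) ^ Suc m"
      using arg_cong[OF eq, of norm] by (simp only: norm_mult norm_power)
    moreover have "\<beta> \<noteq> 0" using ab by auto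
    ultimately have "norm (z - x) ^ Suc m = norm (z - cnj x) ^ Suc m" using ab by (simp del: power_Suc)
    then have "norm (z - x) = norm (z - cnj x)" by (rule power_inject_base) auto
    then have "(norm (z - x))\<^sup>2 = (norm (z - cnj x))\<^sup>2" by simp
    then have "(Im z - Im x)\<^sup>2 = (Im z + Im x)\<^sup>2" by (simp add: cmod_power2)
    then have "Im z * Im x = 0" by (simp add: power2_eq_square algebra_simps)
    then show ?thesis using x by (simp add: complex_is_Real_iff)
  qed
  define s where "s = - sgn (Im x)"
  have s: "s \<noteq> 0" using x by (simp add: s_def sgn_zero_iff)
  have RF: "cpoly F z = ((z - x) ^ Suc m + (z - cnj x) ^ Suc m) / 2"
    "cpoly R z = of_real s * (((z - x) ^ Suc m - (z - cnj x) ^ Suc m) / (2 * \<i>))" for z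
    unfolding F_def R_def cpoly_smult cpoly_map_Re cpoly_map_Im conj Cz s_def by simp_all
  show "hyperbolic R" unfolding hyperbolic_def
  proof (intro conjI allI impI)
    show "R \<noteq> 0" using dR(2) by auto
    fix z assume "cpoly R z = 0"
    then have "1 * (z - x) ^ Suc m = 1 * (z - cnj x) ^ Suc m" using s by (simp add: RF del: power_Suc)
    then show "z \<in> \<real>" by (rule real) auto
  qed
  show "hyperbolic (F - smult c R)" unfolding hyperbolic_def
  proof (intro conjI allI impI)
    have "coeff (F - smult c R) (Suc m) = 1" using cF cRS by simp
    then show "F - smult c R \<noteq> 0" by auto
    fix z assume "cpoly (F - smult c R) z = 0"
    then have eq0: "((z - x) ^ Suc m + (z - cnj x) ^ Suc m) / 2 -
        of_real c * (of_real s * (((z - x) ^ Suc m - (z - cnj x) ^ Suc m) / (2 * \<i>))) = 0"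
      unfolding cpoly_diff cpoly_smult RF .
    \<comment> \<open>Clearing denominators brings the equation to the form needed by
      \<open>real\<close>: the two coefficients are, up to sign, complex conjugates, so they have
      equal modulus.\<close>
    have "(of_real (c * s) - \<i>) * A = (of_real (c * s) + \<i>) * B"
      if "(A + B) / 2 - of_real c * (of_real s * ((A - B) / (2 * \<i>))) = 0" for A B
    proof -
      have "\<i> * (A + B) - of_real c * of_real s * (A - B) =
          2 * \<i> * ((A + B) / 2 - of_real c * (of_real s * ((A - B) / (2 * \<i>))))"
        by (simp add: field_simps)
      also have "\<dots> = 0" using that by simp
      finally show ?thesis by (simp add: algebra_simps)
    qed
    from this[OF eq0] have "(of_real (c * s) - \<i>) * (z - x) ^ Suc m = (of_real (c * s) + \<i>) * (z - cnj x) ^ Suc m" .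
    then show "z \<in> \<real>"
    proof (rule real)
      show "norm (of_real (c * s) - \<i>) = norm (of_real (c * s) + \<i>)" by (simp add: cmod_def)
      show "of_real (c * s) - \<i> \<noteq> 0" by (simp add: complex_eq_iff)
    qed
  qed
  show "\<not> (poly F t = 0 \<and> poly R t = 0)"
  proof
    assume "poly F t = 0 \<and> poly R t = 0"
    then have "Re (poly C (of_real t)) = 0" "Im (poly C (of_real t)) = 0"
      using s by (simp_all add: F_def R_def poly_map_Re poly_map_Im s_def)
    then have "poly C (of_real t) = 0" by (simp add: complex_eq_iff)
    then have "of_real t = x" by (simp add: Cz del: power_Suc)
    then show False using x by auto
  qed
qed

lemma hyperbolic_monic_pf:
  assumes "hyperbolic p" "lead_coeff p = 1" "degree p = m"
  shows "p = pf m (\<lambda>i. zeros p ! i)"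
proof -
  have "proots p = mset (map (\<lambda>i. zeros p ! i) [0..<m])"
    using length_zeros[OF assms(1)] assms(3) by (metis map_nth mset_zeros)
  then have "rp (proots p) = pf m (\<lambda>i. zeros p ! i)" by (simp only: pf_rp mset_map_upt)
  then show ?thesis using hyperbolic_monic_unique[OF assms(1,2)] by (simp only:)
qed

lemma count_image_mset_set:
  assumes "finite S"
  shows "count (image_mset x (mset_set S)) a = card {i \<in> S. x i = a}"
proof -
  have "count (image_mset x (mset_set S)) a = size (filter_mset (\<lambda>b. b = a) (image_mset x (mset_set S)))"
    by (simp add: filter_eq_replicate_mset)
  also have "\<dots> = size (filter_mset (\<lambda>i. x i = a) (mset_set S))"
    by (simp add: filter_mset_image_mset)
  also have "\<dots> = card {i \<in> S. x i = a}"
    using assms by (simp add: filter_mset_mset_set)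
  finally show ?thesis .
qed

lemma order_pf: "order a (pf n x) = card {i. i < n \<and> x i = a}"
proof -
  have "order a (pf n x) = count (proots (pf n x)) a" by simp
  also have "\<dots> = card {i \<in> {..<n}. x i = a}"
    by (simp only: pf_rp proots_rp) (simp add: count_image_mset_set)
  finally show ?thesis by simp
qed

section \<open>The operator\<close>

text \<open>Nonnegativity of the Fuchs index is carried by the type of \<open>r\<close>.\<close>

locale fuchsian_preserver =
  fixes Q :: "nat \<Rightarrow> real poly" and M N r :: nat
  assumes Q_outside: "\<And>k. k < M \<or> k > N \<Longrightarrow> Q k = 0"
    and MN: "M \<le> N" and QMN: "Q M * Q N \<noteq> 0"
    and preserver: "hyperbolicity_preserver (diff_op Q M N)"
    and fuchs: "fuchs_index Q M N = int r"
    and nondeg: "non_degenerate Q M N"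
begin

abbreviation T :: "real poly \<Rightarrow> real poly" where "T \<equiv> diff_op Q M N"

lemma T_add: "T (f + g) = T f + T g"
  and T_smult: "T (smult c f) = smult c (T f)"
  and T_diff: "T (f - g) = T f - T g"
proof -
  interpret Vector_Spaces.linear smult smult T by (rule linear_diff_op)
  show "T (f + g) = T f + T g" by (rule add)
  show "T (smult c f) = smult c (T f)" by (rule scale)
  show "T (f - g) = T f - T g" by (rule diff)
qed

lemma T_hyperbolic: "hyperbolic f \<Longrightarrow> T f \<noteq> 0 \<Longrightarrow> hyperbolic (T f)"
  using preserver by (auto simp: hyperbolicity_preserver_def)

lemma degree_QN: "degree (Q N) = N + r"
  using nondeg fuchs by (simp add: non_degenerate_def)

lemma degree_Q: "degree (Q k) \<le> k + r"
proof (cases "Q k = 0")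
  case False
  then have "k \<in> {k \<in> {M..N}. Q k \<noteq> 0}" using Q_outside[of k] by force
  then have "int (degree (Q k)) - int k \<le>
      Max ((\<lambda>k. int (degree (Q k)) - int k) ` {k \<in> {M..N}. Q k \<noteq> 0})"
    by (intro Max_ge) auto
  then show ?thesis using fuchs by (simp add: fuchs_index_def)
qed simp

section \<open>Action of the operator on leading terms\<close>

definition q :: "nat \<Rightarrow> real" where "q k = coeff (Q k) (k + r)"

text \<open>The factor in T(z^m) = \<open>lam m\<close> z^(m+r) + lower terms.\<close>

definition lam :: "nat \<Rightarrow> real" where "lam m = (\<Sum>k=M..N. q k * ff m k)"

lemma q_N: "q N \<noteq> 0"
  using QMN degree_QN by (simp add: q_def flip: degree_QN)

lemma q_outside: "k < M \<or> k > N \<Longrightarrow> q k = 0"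
  using Q_outside by (simp add: q_def)

lemma degree_T_le:
  assumes "degree f \<le> m"
  shows "degree (T f) \<le> m + r"
  unfolding diff_op_def
proof (rule degree_sum_le)
  fix k
  show "degree (Q k * (pderiv ^^ k) f) \<le> m + r"
  proof (cases "k \<le> m")
    case True
    have "degree (Q k * (pderiv ^^ k) f) \<le> (k + r) + (m - k)"
      using degree_Q[of k] degree_higher_pderiv_le[of k f] assms
      by (intro order_trans[OF degree_mult_le] add_mono) auto
    then show ?thesis using True by simp
  qed (use assms in \<open>simp add: higher_pderiv_eq_0\<close>)
qed simp

lemma coeff_T_top:
  assumes "degree f \<le> m"
  shows "coeff (T f) (m + r) = lam m * coeff f m"
proof -
  have "coeff (Q k * (pderiv ^^ k) f) (m + r) = q k * ff m k * coeff f m" for k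
  proof (cases "k \<le> m")
    case True
    have "coeff (Q k * (pderiv ^^ k) f) ((k + r) + (m - k)) =
        coeff (Q k) (k + r) * coeff ((pderiv ^^ k) f) (m - k)"
      using degree_Q[of k] degree_higher_pderiv_le[of k f] assms
      by (intro coeff_mult_bound) auto
    then show ?thesis using True by (simp add: q_def coeff_higher_pderiv add.commute)
  qed (use assms in \<open>simp add: higher_pderiv_eq_0 ff_eq_0\<close>)
  then show ?thesis
    by (simp add: diff_op_def coeff_sum lam_def sum_distrib_right)
qed

lemma T_linear_power: "T ([:- x, 1:] ^ n) = (\<Sum>k=M..N. smult (ff n k) (Q k * [:- x, 1:] ^ (n - k)))"
  by (simp add: diff_op_def higher_pderiv_linear_power)

lemma T_power_M: "T ([:- x, 1:] ^ M) = smult (ff M M) (Q M)"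
proof -
  have "T ([:- x, 1:] ^ M) = (\<Sum>k=M..N. if k = M then smult (ff M M) (Q M) else 0)"
    unfolding T_linear_power by (intro sum.cong) (auto simp: ff_eq_0)
  then show ?thesis using MN by simp
qed

text \<open>Divided by m^N, the sum tends to q_N, which is nonzero by nondegeneracy.\<close>

lemma eventually_sgn_lam: "\<forall>\<^sub>F m in sequentially. sgn (lam m) = sgn (q N)"
proof -
  have one: "(\<lambda>m. q k * ff (Suc m) k / real (Suc m) ^ N) \<longlonglongrightarrow> (if k = N then q N else 0)"
    if "k \<in> {M..N}" for k
  proof -
    have "q k * ff (Suc m) k / real (Suc m) ^ N =
        q k * (ff (Suc m) k / real (Suc m) ^ k) * (1 / real (Suc m)) ^ (N - k)" for m
    proof -
      have "real (Suc m) ^ N = real (Suc m) ^ k * real (Suc m) ^ (N - k)"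
        using that by (simp flip: power_add)
      then show ?thesis by (simp add: power_divide)
    qed
    moreover have "(\<lambda>m. q k * (ff (Suc m) k / real (Suc m) ^ k) * (1 / real (Suc m)) ^ (N - k))
        \<longlonglongrightarrow> q k * 1 * (if N - k = 0 then 1 else 0)"
      by (intro tendsto_mult tendsto_const tendsto_ff tendsto_inverse_Suc_power)
    ultimately show ?thesis using that by (auto split: if_splits)
  qed
  have "(\<lambda>m. \<Sum>k=M..N. q k * ff (Suc m) k / real (Suc m) ^ N) \<longlonglongrightarrow>
      (\<Sum>k=M..N. if k = N then q N else 0)"
    by (intro tendsto_sum one)
  then have lim: "(\<lambda>m. lam (Suc m) / real (Suc m) ^ N) \<longlonglongrightarrow> q N"
    using MN by (simp add: lam_def sum_divide_distrib)
  have "\<forall>\<^sub>F m in sequentially. sgn (lam (Suc m)) = sgn (q N)"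
  proof (cases "q N > 0")
    case True
    show ?thesis using order_tendstoD(1)[OF lim True]
      by eventually_elim (use True in \<open>simp add: zero_less_divide_iff\<close>)
  next
    case False
    then have neg: "q N < 0" using q_N by simp
    show ?thesis using order_tendstoD(2)[OF lim neg]
      by eventually_elim (use neg in \<open>simp add: divide_less_0_iff\<close>)
  qed
  then show ?thesis by (simp add: eventually_sequentially_Suc[of "\<lambda>m. sgn (lam m) = sgn (q N)"])
qed

text \<open>By the eventual sign there is a largest n with \<open>lam n = 0\<close>. For h of degree
  n with real zeros, T((z - x) h) then has degree n + 1 + r while T(h) has degree below n + r, which
  the pencil tolerates only if T(h) = 0. Such h span all polynomials of degree at most n, so T(z^M)
  = M! Q_M would vanish.\<close>

lemma lam_nz:
  assumes "m \<ge> M"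
  shows "lam m \<noteq> 0"
proof
  assume m: "lam m = 0"
  obtain K where K: "\<And>n. n \<ge> K \<Longrightarrow> sgn (lam n) = sgn (q N)"
    using eventually_sgn_lam by (auto simp: eventually_sequentially)
  define S where "S = {n. lam n = 0}"
  have S: "S \<subseteq> {..<K}"
  proof
    fix n assume "n \<in> S"
    then have "sgn (lam n) \<noteq> sgn (q N)" using q_N by (simp add: S_def sgn_zero_iff)
    then show "n \<in> {..<K}" using K[of n] by (meson lessThan_iff not_le)
  qed
  then have fin: "finite S" by (rule finite_subset) simp
  define n where "n = Max S"
  have "S \<noteq> {}" using m by (auto simp: S_def)
  then have nS: "n \<in> S" unfolding n_def using fin by (intro Max_in)
  then have n0: "lam n = 0" by (simp add: S_def)
  have "m \<in> S" using m by (simp add: S_def)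
  then have nM: "n \<ge> M" using assms order_trans[OF assms Max_ge[OF fin]] by (simp add: n_def)
  have "Suc n \<notin> S"
  proof
    assume "Suc n \<in> S"
    then have "Suc n \<le> n" unfolding n_def by (rule Max_ge[OF fin])
    then show False by simp
  qed
  then have n1: "lam (Suc n) \<noteq> 0" by (simp add: S_def)
  have T0: "T (pf n z) = 0" for z
  proof (rule ccontr)
    define h where "h = pf n z"
    assume "T (pf n z) \<noteq> 0"
    then have R0: "T h \<noteq> 0" by (simp add: h_def)
    have h: "hyperbolic h" "degree h = n" "lead_coeff h = 1"
      by (simp_all add: h_def)
    have eq: "T ([:- x, 1:] * h) = T ([:0, 1:] * h) - smult x (T h)" for x
    proof -
      have "[:- x, 1:] * h = [:0, 1:] * h - smult x h" by simp
      then show ?thesis by (simp only: T_diff T_smult)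
    qed
    have top: "coeff (T ([:- x, 1:] * h)) (Suc n + r) = lam (Suc n)" for x
    proof -
      have "degree ([:- x, 1:] * h) = Suc n" "lead_coeff ([:- x, 1:] * h) = 1"
        using h linear_mult_degree[OF hyperbolic_nz[OF h(1)]] by (simp_all del: mult_pCons_left)
      then show ?thesis using coeff_T_top[of "[:- x, 1:] * h" "Suc n"] by simp
    qed
    have "degree (T ([:0, 1:] * h)) = Suc (degree (T h))"
    proof (rule pencil_degree)
      show "hyperbolic (T ([:0, 1:] * h) - smult x (T h))" for x
        unfolding eq[symmetric]
      proof (rule T_hyperbolic)
        show "hyperbolic ([:- x, 1:] * h)" unfolding hyperbolic_mult_iff
          using h hyperbolic_linear by simp
        show "T ([:- x, 1:] * h) \<noteq> 0" using top[of x] n1 by (metis coeff_0)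
      qed
      have "coeff (T ([:0, 1:] * h)) (Suc n + r) \<noteq> 0" using top[of 0] n1 by simp
      then have "Suc n + r \<le> degree (T ([:0, 1:] * h))" by (rule le_degree)
      moreover have "degree (T h) \<le> n + r" using h by (intro degree_T_le) simp
      ultimately show "degree (T h) < degree (T ([:0, 1:] * h))" by simp
    qed (rule R0)
    moreover have "coeff (T ([:0, 1:] * h)) (Suc n + r) \<noteq> 0" using top[of 0] n1 by simp
    then have "Suc n + r \<le> degree (T ([:0, 1:] * h))" by (rule le_degree)
    moreover have "degree (T h) \<le> n + r" using h by (intro degree_T_le) simp
    ultimately have "degree (T h) = n + r" by simp
    then have "lead_coeff (T h) = lam n" using coeff_T_top[of h n] h by simp
    then show False using n0 R0 by simp
  qed
  have "[:- 0, 1:] ^ M \<in> {u. T u = 0}"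
  proof (rule products_span[where x = "\<lambda>_. 0" and y = "\<lambda>_. 1" and m = n])
    show "degree ([:- 0, 1:] ^ M :: real poly) \<le> n" using nM by (simp add: degree_power_eq)
  qed (use T0 in \<open>auto simp: T_add T_smult\<close>)
  then show False using T_power_M[of 0] QMN ff_pos[of M M] by simp
qed

lemma T_nz:
  assumes "degree f = m" "m \<ge> M" "f \<noteq> 0"
  shows "degree (T f) = m + r" "lead_coeff (T f) = lam m * lead_coeff f" "T f \<noteq> 0"
proof -
  have c: "coeff (T f) (m + r) = lam m * lead_coeff f" using coeff_T_top[of f m] assms by simp
  then have nz: "coeff (T f) (m + r) \<noteq> 0" using lam_nz[OF assms(2)] assms(3) by simp
  then show d: "degree (T f) = m + r" 
    using degree_T_le[of f m] le_degree[OF nz] assms by simp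
  show "lead_coeff (T f) = lam m * lead_coeff f" using c d by simp
  show "T f \<noteq> 0" using nz by auto
qed

section \<open>The top homogeneous part and the signs of its coefficients\<close>

definition T_top :: "real poly \<Rightarrow> real poly" where
  "T_top f = (\<Sum>k=M..N. monom (q k) (k + r) * (pderiv ^^ k) f)"

lemma coeff_T_top_op: "coeff (T_top f) (j + r) = lam j * coeff f j"
proof -
  have "coeff (monom (q k) (k + r) * (pderiv ^^ k) f) (j + r) = q k * ff j k * coeff f j" for k
    by (simp add: coeff_monom_mult coeff_higher_pderiv ff_eq_0)
  then show ?thesis by (simp add: T_top_def coeff_sum lam_def sum_distrib_right)
qed

lemma coeff_T_top_op_low: "j < r \<Longrightarrow> coeff (T_top f) j = 0"
  by (simp add: T_top_def coeff_sum coeff_monom_mult)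

text \<open>The top homogeneous part is a limit of conjugates of \<^term>\<open>T\<close> by dilations.\<close>

lemma T_top_hyperbolic:
  assumes f: "hyperbolic f" and deg: "degree f \<ge> M"
  shows "hyperbolic (T_top f)"
proof -
  define s where "s i = real (Suc i)" for i
  have s: "s i \<noteq> 0" for i by (simp add: s_def)
  define X where "X i = smult (1 / s i ^ r) (pcompose (T (pcompose f [:0, 1 / s i:])) [:0, s i:])" for i
  have id: "pcompose (pcompose p [:0, 1 / s i:]) [:0, s i:] = p" for p i
    using s[of i] by (intro poly_eqI) (simp add: coeff_pcompose_linear power_divide)
  have X_eq: "X i = (\<Sum>k=M..N. smult (1 / s i ^ (k + r)) (pcompose (Q k) [:0, s i:]) * (pderiv ^^ k) f)" for i
    unfolding X_def diff_op_def
    by (simp add: pcompose_sum pcompose_mult higher_pderiv_pcompose_scale pcompose_smult id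
        smult_sum_right power_add power_divide mult.commute)
  have conv: "pconv X (T_top f)"
    unfolding X_eq T_top_def s_def q_def
    by (intro pconv_sum pconv_mult pconv_const pconv_rescale degree_Q)
  have fs: "degree (pcompose f [:0, 1 / s i:]) = degree f" for i
    using s[of i] by (simp add: degree_pcompose)
  have fs0: "pcompose f [:0, 1 / s i:] \<noteq> 0" for i
    using hyperbolic_nz[OF f] s[of i] by (subst pcompose_eq_0_iff) auto
  note Tfs = T_nz[OF fs deg fs0]
  show ?thesis
  proof (rule pconv_hyperbolic[OF _ _ conv])
    show "degree (X i) \<le> degree f + r" for i
      unfolding X_def using s[of i] Tfs(1)[of i] by (simp add: degree_pcompose)
    show "hyperbolic (X i)" for i
      unfolding X_def using s[of i] Tfs(3)[of i] f
      by (simp add: hyperbolic_smult hyperbolic_pcompose_linear T_hyperbolic)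
    have "coeff (T_top f) (degree f + r) \<noteq> 0"
      unfolding coeff_T_top_op using lam_nz[OF deg] hyperbolic_nz[OF f] by simp
    then show "T_top f \<noteq> 0" by auto
  qed
qed

text \<open>The top part sends z^m (z^2 - 1) to z^(m+r) (\<open>lam (m + 2)\<close> z^2 -
  \<open>lam m\<close>), which has nonreal zeros if the signs differ. Steps of length 2 then reach
  the range where the sign is known.\<close>

lemma sgn_lam:
  assumes "m \<ge> M"
  shows "sgn (lam m) = sgn (q N)"
proof -
  have step: "sgn (lam (m + 2)) = sgn (lam m)" if m: "m \<ge> M" for m
  proof (rule ccontr)
    define a b where "a = lam (m + 2)" and "b = lam m"
    have ab0: "a \<noteq> 0" "b \<noteq> 0" using lam_nz m by (simp_all add: a_def b_def)
    assume "\<not> ?thesis"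
    then have ab: "b / a < 0" using ab0 by (auto simp: a_def b_def sgn_real_def divide_less_0_iff split: if_splits)
    define f :: "real poly" where "f = monom 1 (m + 2) - monom 1 m"
    have "f = [:- 0, 1:] ^ m * ([:- 1, 1:] * [:- (- 1), 1:])"
      by (simp add: f_def monom_altdef algebra_simps power2_eq_square)
    then have "hyperbolic f"
      by (simp only: hyperbolic_mult_iff hyperbolic_linear hyperbolic_power)
    moreover have "degree f \<ge> M"
      using m by (intro order_trans[OF _ le_degree[of f "m + 2"]]) (auto simp: f_def)
    ultimately have h: "hyperbolic (T_top f)" by (rule T_top_hyperbolic)
    have "T_top f = monom 1 (m + r) * [:- b, 0, a:]"
    proof (rule poly_eqI)
      fix j
      show "coeff (T_top f) j = coeff (monom 1 (m + r) * [:- b, 0, a:]) j"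
      proof (cases "j < r")
        case False
        then obtain i where j: "j = i + r" by (metis le_add_diff_inverse2 not_le)
        show ?thesis unfolding j coeff_T_top_op
          by (auto simp: f_def coeff_monom_mult coeff_pCons a_def b_def split: nat.split)
      qed (simp add: coeff_T_top_op_low coeff_monom_mult del: mult_pCons_right)
    qed
    then have h2: "hyperbolic [:- b, 0, a:]" using h by (simp only: hyperbolic_mult_iff)
    define t where "t = sqrt (- (b / a))"
    have t: "t > 0" "t\<^sup>2 = - (b / a)" using ab by (simp_all add: t_def)
    have "a * t\<^sup>2 = - b" using t ab0 by simp
    then have "cpoly [:- b, 0, a:] (Complex 0 t) = 0"
      by (simp add: map_poly_pCons complex_eq_iff power2_eq_square algebra_simps)
    then have "Complex 0 t \<in> \<real>" using h2 by (simp add: hyperbolic_def)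
    then show False using t by (simp add: complex_is_Real_iff)
  qed
  have chain: "sgn (lam (m + 2 * j)) = sgn (lam m)" for j
  proof (induction j)
    case (Suc j)
    have "sgn (lam (m + 2 * j + 2)) = sgn (lam (m + 2 * j))" using assms by (intro step) simp
    then show ?case using Suc by (simp add: add.commute)
  qed simp
  obtain K where K: "\<And>n. n \<ge> K \<Longrightarrow> sgn (lam n) = sgn (q N)"
    using eventually_sgn_lam by (auto simp: eventually_sequentially)
  show ?thesis using chain[of K] K[of "m + 2 * K"] by simp
qed

lemma lam_below: "m < M \<Longrightarrow> lam m = 0"
  by (simp add: lam_def ff_eq_0)

lemma q_M: "q M \<noteq> 0"
proof -
  have "lam M = (\<Sum>k=M..N. if k = M then q M * ff M M else 0)"
    unfolding lam_def by (intro sum.cong) (auto simp: ff_eq_0)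
  then show ?thesis using lam_nz[of M] MN by auto
qed

text \<open>Applying the top part to \<open>(1 + z/m)\<^sup>m\<close> and dividing by \<open>z\<^sup>r (1 + z/m)\<^sup>m\<^sup>-\<^sup>N\<close> leaves polynomials
  without positive zeros that converge to \<open>\<Sum> q\<^sub>k z\<^sup>k\<close>.\<close>

lemma sgn_q:
  assumes "k \<in> {M..N}"
  shows "sgn (q k) = sgn (q N)"
proof -
  define \<sigma> where "\<sigma> = sgn (q N)"
  have \<sigma>: "\<sigma> \<noteq> 0" "\<sigma> * \<sigma> = 1" using q_N by (simp_all add: \<sigma>_def sgn_real_def)
  define L where "L m = [:1, 1 / real (Suc m):]" for m
  have L: "hyperbolic (L m)" for m
  proof -
    have "L m = smult (1 / real (Suc m)) [:- (- real (Suc m)), 1:]" by (simp add: L_def)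
    moreover have "hyperbolic (smult (1 / real (Suc m)) [:- (- real (Suc m)), 1:])"
      by (subst hyperbolic_smult) (simp, rule hyperbolic_linear)
    ultimately show ?thesis by (simp only:)
  qed
  define E where "E m = (\<Sum>k=M..N. smult (ff (Suc m) k / real (Suc m) ^ k) (monom (q k) k * L m ^ (N - k)))" for m
  define E0 where "E0 = (\<Sum>k=M..N. monom (q k) k)"
  have coeff_E0: "coeff E0 j = q j" for j
    using q_outside[of j] by (cases "j \<in> {M..N}") (auto simp: E0_def coeff_sum)
  have fac: "T_top (L m ^ Suc m) = monom 1 r * (L m ^ (Suc m - N) * E m)" if "N \<le> m" for m
  proof -
    have "monom (q k) (k + r) * (pderiv ^^ k) (L m ^ Suc m) =
      monom 1 r * (L m ^ (Suc m - N) * smult (ff (Suc m) k / real (Suc m) ^ k) (monom (q k) k * L m ^ (N - k)))"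
      if k: "k \<in> {M..N}" for k
    proof -
      have "Suc m - k = (Suc m - N) + (N - k)" using k \<open>N \<le> m\<close> by auto
      then have "L m ^ (Suc m - k) = L m ^ (Suc m - N) * L m ^ (N - k)" by (simp only: power_add)
      moreover have "(pderiv ^^ k) (L m ^ Suc m) = smult (ff (Suc m) k / real (Suc m) ^ k) (L m ^ (Suc m - k))"
        unfolding L_def higher_pderiv_linear_power by (simp add: power_divide)
      moreover have "monom (q k) (k + r) = monom 1 r * monom (q k) k"
        by (simp add: mult_monom add.commute)
      ultimately show ?thesis by (simp add: mult_ac)
    qed
    then show ?thesis by (simp add: T_top_def E_def sum_distrib_left)
  qed
  have coeffL: "coeff (L m ^ j) i \<ge> 0" for m j i
  proof (induction j arbitrary: i)
    case (Suc j)
    have "coeff (L m * L m ^ j) i \<ge> 0"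
      unfolding coeff_mult by (intro sum_nonneg mult_nonneg_nonneg Suc)
        (auto simp: L_def coeff_pCons split: nat.split)
    then show ?case by simp
  qed (simp add: one_pCons coeff_pCons split: nat.split)
  have lam_nn: "\<sigma> * lam m \<ge> 0" for m
  proof (cases "M \<le> m")
    case True
    then have "lam m = \<sigma> * \<bar>lam m\<bar>" using sgn_lam[of m] sgn_mult_abs[of "lam m"] by (simp add: \<sigma>_def)
    then have "\<sigma> * lam m = (\<sigma> * \<sigma>) * \<bar>lam m\<bar>" by simp
    then show ?thesis using \<sigma> by simp
  qed (simp add: lam_below)
  have degL: "degree (L m ^ j) = j" for m j
    by (simp add: L_def degree_power_eq)
  have Tnz: "hyperbolic (T_top (L m ^ Suc m))" if "N \<le> m" for m
    using MN that by (intro T_top_hyperbolic hyperbolic_power L) (simp only: degL)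
  have hypE: "hyperbolic (E m)" if "N \<le> m" for m
    using Tnz[OF that] unfolding fac[OF that] by (simp only: hyperbolic_mult_iff)
  have posT: "\<sigma> * poly (T_top (L m ^ Suc m)) x > 0" if "N \<le> m" "x > 0" for m x
  proof -
    have "coeff (smult \<sigma> (T_top (L m ^ Suc m))) j \<ge> 0" for j
    proof (cases "j < r")
      case False
      then obtain i where j: "j = i + r" by (metis le_add_diff_inverse2 not_le)
      have "0 \<le> (\<sigma> * lam i) * coeff (L m ^ Suc m) i" by (intro mult_nonneg_nonneg lam_nn coeffL)
      then show ?thesis unfolding j coeff_smult coeff_T_top_op by (simp add: mult.assoc)
    qed (simp add: coeff_T_top_op_low)
    then have "poly (smult \<sigma> (T_top (L m ^ Suc m))) x > 0"
      using hyperbolic_nz[OF Tnz[OF that(1)]] \<sigma> that(2) by (intro poly_pos_of_coeff_nonneg) auto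
    then show ?thesis by simp
  qed
  have coeffE: "\<sigma> * coeff (E m) j \<ge> 0" if "N \<le> m" for m j
  proof -
    have posE: "\<sigma> * poly (E m) x > 0" if "x > 0" for x
    proof -
      have "0 < x ^ r * (poly (L m) x ^ (Suc m - N)) * (\<sigma> * poly (E m) x)"
        using posT[OF \<open>N \<le> m\<close> that] unfolding fac[OF \<open>N \<le> m\<close>] by (simp add: poly_monom mult_ac)
      moreover have "poly (L m) x > 0" using that by (simp add: L_def add_pos_pos)
      then have "x ^ r * (poly (L m) x ^ (Suc m - N)) > 0" using that by simp
      ultimately show ?thesis by (rule zero_less_mult_pos)
    qed
    obtain c A where c: "c \<noteq> 0" "E m = smult c (rp A)" by (rule hyperbolic_eq_rp[OF hypE[OF \<open>N \<le> m\<close>]])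
    have A: "a \<le> 0" if "a \<in># A" for a
    proof (rule ccontr)
      assume "\<not> a \<le> 0"
      moreover have "poly (rp A) a = 0" using that by (induction A) auto
      ultimately show False using posE[of a] c by simp
    qed
    have "poly (rp A) 1 > 0" using A by (intro poly_rp_pos) force
    moreover have "0 < poly (rp A) 1 * (\<sigma> * c)" using posE[of 1] c by (simp add: mult_ac)
    ultimately have "\<sigma> * c > 0" by (metis zero_less_mult_pos)
    then have "(\<sigma> * c) * coeff (rp A) j \<ge> 0" using coeff_rp_nonneg[OF A] by simp
    then show ?thesis using c by (simp add: mult.assoc)
  qed
  have convE: "pconv E E0"
  proof -
    have "pconv L [:1, 0:]"
      unfolding L_def using LIMSEQ_inverse_real_of_nat
      by (intro pconv_linear tendsto_const) (simp add: inverse_eq_divide)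
    then have "pconv L 1" by (simp add: one_pCons)
    then have "pconv E (\<Sum>k=M..N. smult 1 (monom (q k) k * 1 ^ (N - k)))"
      unfolding E_def by (intro pconv_sum pconv_smult tendsto_ff pconv_mult pconv_const pconv_power)
    then show ?thesis by (simp add: E0_def)
  qed
  have qnn: "\<sigma> * q j \<ge> 0" for j
  proof -
    have "(\<lambda>m. \<sigma> * coeff (E m) j) \<longlonglongrightarrow> \<sigma> * q j"
      using convE unfolding pconv_def coeff_E0 by (intro tendsto_mult_left) blast
    then show ?thesis
      by (rule LIMSEQ_le_const) (use coeffE in blast)
  qed
  have degE: "degree (E m) \<le> N" for m
    unfolding E_def
  proof (rule degree_sum_le)
    fix k assume k: "k \<in> {M..N}"
    have "degree (monom (q k) k * L m ^ (N - k)) \<le> k + (N - k)"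
      by (intro order_trans[OF degree_mult_le] add_mono degree_monom_le) (simp add: degL)
    then show "degree (smult (ff (Suc m) k / real (Suc m) ^ k) (monom (q k) k * L m ^ (N - k))) \<le> N"
      using k order_trans[OF degree_smult_le] by fastforce
  qed simp
  have "E0 \<noteq> 0" using coeff_E0[of N] q_N by auto
  have "hyperbolic E0"
  proof (rule pconv_hyperbolic)
    show "degree (E (i + N)) \<le> N" for i by (rule degE)
    show "hyperbolic (E (i + N))" for i by (rule hypE) simp
    show "pconv (\<lambda>i. E (i + N)) E0"
      using convE unfolding pconv_def using LIMSEQ_ignore_initial_segment by blast
  qed fact
  \<comment> \<open>Limits give only weak inequalities for the q_k. Strictness comes from real
    zeros: after division by z^M the constant term q_M is nonzero, so all zeros are negative and no
    coefficient up to the degree vanishes.\<close>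
  define E1 where "E1 = (\<Sum>k=M..N. monom (q k) (k - M))"
  have E0_eq: "E0 = monom 1 M * E1"
    unfolding E0_def E1_def sum_distrib_left by (intro sum.cong) (auto simp: mult_monom)
  then have "hyperbolic E1" using \<open>hyperbolic E0\<close> by (simp only: hyperbolic_mult_iff)
  then obtain c A where c: "c \<noteq> 0" "E1 = smult c (rp A)" by (rule hyperbolic_eq_rp)
  have coeff_E1: "coeff E1 j = q (j + M)" for j
    using coeff_E0[of "j + M"] by (simp add: E0_eq coeff_monom_mult)
  have A: "a < 0" if a: "a \<in># A" for a
  proof (rule ccontr)
    assume "\<not> a < 0"
    have "poly (rp A) a = 0" using a by (induction A) auto
    then have z: "poly E1 a = 0" using c by simp
    have "E1 \<noteq> 0" using \<open>hyperbolic E1\<close> hyperbolic_nz by blast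
    moreover have "coeff (smult \<sigma> E1) j \<ge> 0" for j using qnn coeff_E1 by simp
    ultimately have pos: "poly (smult \<sigma> E1) x > 0" if "x > 0" for x
      using \<sigma> that by (intro poly_pos_of_coeff_nonneg) auto
    have "a = 0"
    proof (rule ccontr)
      assume "a \<noteq> 0"
      then show False using pos[of a] z \<open>\<not> a < 0\<close> by simp
    qed
    then show False using z q_M coeff_E1[of 0] by (simp add: poly_0_coeff_0)
  qed
  have "N - M \<le> degree E1" using coeff_E1[of "N - M"] q_N MN by (intro le_degree) simp
  then have "N - M \<le> size A" using c by (simp add: degree_rp)
  moreover have "k - M \<le> N - M" using assms by (intro diff_le_mono) simp
  ultimately have "k - M \<le> size A" by (rule order_trans[rotated])
  then have "coeff (rp A) (k - M) > 0" using A by (intro coeff_rp_pos)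
  then have "q k \<noteq> 0" using coeff_E1[of "k - M"] c assms by auto
  then have "\<sigma> * q k > 0" using qnn[of k] \<sigma> by (simp add: order_less_le)
  then show ?thesis using q_N \<open>q k \<noteq> 0\<close> by (auto simp: \<sigma>_def sgn_real_def split: if_splits)
qed

section \<open>Monotonicity and interlacing under the operator\<close>

lemma T_below: "degree f < M \<Longrightarrow> T f = 0"
  unfolding diff_op_def by (intro sum.neutral) (simp add: higher_pderiv_eq_0)

lemma T_linear_mult: "T ([:- x, 1:] * h) = T ([:0, 1:] * h) - smult x (T h)"
proof -
  have "[:- x, 1:] * h = [:0, 1:] * h - smult x h" by simp
  then show ?thesis by (simp only: T_diff T_smult)
qed

text \<open>The hypotheses of the pencil lemmas for T(z h) - x T(h). The leading coefficients agree
  in sign because \<open>lam\<close> keeps its sign from one degree to the next.\<close>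

lemma T_pencil:
  assumes h: "hyperbolic h" and deg: "degree h \<ge> M"
  shows "hyperbolic (T ([:- x, 1:] * h))" "hyperbolic (T h)"
    and "degree (T ([:- x, 1:] * h)) = Suc (degree (T h))"
    and "lead_coeff (T ([:- x, 1:] * h)) * lead_coeff (T h) > 0"
proof -
  have h0: "h \<noteq> 0" using hyperbolic_nz[OF h] .
  note l = linear_mult_degree[OF h0, of x]
  note a = T_nz[OF l(1) _ l(3)] and b = T_nz[OF refl deg h0]
  show "hyperbolic (T ([:- x, 1:] * h))"
    using a deg h by (intro T_hyperbolic) (simp_all add: hyperbolic_mult_iff hyperbolic_linear del: mult_pCons_left)
  show "hyperbolic (T h)" using b h by (intro T_hyperbolic)
  show "degree (T ([:- x, 1:] * h)) = Suc (degree (T h))" using a b deg by simp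
  have "sgn (lam (Suc (degree h)) * lam (degree h)) = sgn (q N) * sgn (q N)"
    using deg by (simp add: sgn_mult sgn_lam)
  also have "\<dots> = 1" using q_N by (simp add: sgn_real_def)
  finally have "lam (Suc (degree h)) * lam (degree h) > 0" by (simp only: sgn_1_pos)
  moreover have "lead_coeff h * lead_coeff h > 0" using h0 leading_coeff_0_iff not_real_square_gt_zero by blast
  moreover have "lead_coeff (T ([:- x, 1:] * h)) * lead_coeff (T h) =
      (lam (Suc (degree h)) * lam (degree h)) * (lead_coeff h * lead_coeff h)"
    using a(2) b(2) deg l(2) by (simp only: le_SucI) (simp add: mult_ac)
  ultimately show "lead_coeff (T ([:- x, 1:] * h)) * lead_coeff (T h) > 0" by (simp only: mult_pos_pos)
qed

lemma T_pencil_shift: "T ([:- x, 1:] * h) - smult y (T h) = T ([:- (x + y), 1:] * h)"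
  unfolding T_linear_mult[of x] T_linear_mult[of "x + y"] by (simp add: smult_add_left)

lemma T_linear_interlace:
  assumes "hyperbolic h" "degree h \<ge> M"
  shows "nz (T h) t \<le> nz (T ([:- x, 1:] * h)) t" "nz (T ([:- x, 1:] * h)) t \<le> Suc (nz (T h) t)"
proof -
  have "nz (T h) t \<le> nz (T ([:- x, 1:] * h)) t \<and> nz (T ([:- x, 1:] * h)) t \<le> Suc (nz (T h) t)"
  proof (rule pencil_interlace)
    show "hyperbolic (T ([:- x, 1:] * h) - smult y (T h))" for y
      unfolding T_pencil_shift using T_pencil(1)[OF assms] .
  qed (use T_pencil[OF assms] in auto)
  then show "nz (T h) t \<le> nz (T ([:- x, 1:] * h)) t" "nz (T ([:- x, 1:] * h)) t \<le> Suc (nz (T h) t)"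
    by auto
qed

lemma T_linear_mono:
  assumes "hyperbolic h" "x \<le> y"
  shows "nz (T ([:- y, 1:] * h)) t \<le> nz (T ([:- x, 1:] * h)) t"
proof (cases "degree h < M \<or> x = y")
  case True
  \<comment> \<open>In degree below M the operator kills h, so the image of (z - x) h is the same
    for all x.\<close>
  then show ?thesis using T_below unfolding T_linear_mult[of x] T_linear_mult[of y] by auto
next
  case False
  then have deg: "degree h \<ge> M" and "x < y" using assms by auto
  have "nz (T ([:- x, 1:] * h) - smult (y - x) (T h)) t \<le> nz (T ([:- x, 1:] * h) - smult 0 (T h)) t"
  proof (rule pencil_mono)
    show "hyperbolic (T ([:- x, 1:] * h) - smult z (T h))" for z
      unfolding T_pencil_shift using T_pencil(1)[OF assms(1) deg] .
  qed (use T_pencil[OF assms(1) deg] \<open>x < y\<close> in auto)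
  then show ?thesis unfolding T_pencil_shift by simp
qed

text \<open>The factor d holds the zeros kept fixed while the others move.\<close>

lemma T_mono:
  assumes "hyperbolic d" "\<And>i. i < n \<Longrightarrow> x i \<le> y i"
  shows "nz (T (d * pf n y)) t \<le> nz (T (d * pf n x)) t"
  using assms
proof (induction n arbitrary: d)
  case (Suc n)
  have "d * pf (Suc n) y = ([:- y n, 1:] * d) * pf n y"
    by (simp only: pf_Suc mult_ac)
  moreover have "nz (T (([:- y n, 1:] * d) * pf n y)) t \<le> nz (T (([:- y n, 1:] * d) * pf n x)) t"
    using Suc.prems by (intro Suc.IH) (auto simp: hyperbolic_mult_iff hyperbolic_linear simp del: mult_pCons_left)
  moreover have "([:- y n, 1:] * d) * pf n x = [:- y n, 1:] * (d * pf n x)" by (simp only: mult_ac)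
  moreover have "nz (T ([:- y n, 1:] * (d * pf n x))) t \<le> nz (T ([:- x n, 1:] * (d * pf n x))) t"
    using Suc.prems by (intro T_linear_mono) (auto simp: hyperbolic_mult_iff pf_rp hyperbolic_rp)
  moreover have "[:- x n, 1:] * (d * pf n x) = d * pf (Suc n) x" by (simp only: pf_Suc mult_ac)
  ultimately show ?case by simp
qed simp

lemma T_mono_pf:
  "(\<And>i. i < n \<Longrightarrow> x i \<le> y i) \<Longrightarrow> nz (T (pf n y)) t \<le> nz (T (pf n x)) t"
  using T_mono[of 1 n x y t] hyperbolic_rp[of "{#}"] by simp

text \<open>Drop x_0 and append the last y: the new vector \<open>x'\<close> dominates y entrywise
  and differs from x by a single exchange. With h the common factor, both images interlace T(h), so
  their counts differ by at most one.\<close>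

lemma T_shift:
  assumes "\<And>i. Suc i < n \<Longrightarrow> y i \<le> x (Suc i)"
  shows "nz (T (pf n x)) t \<le> Suc (nz (T (pf n y)) t)"
proof (cases n)
  case (Suc m)
  define h where "h = pf m (\<lambda>i. x (Suc i))"
  have h: "hyperbolic h" "degree h = m" by (simp_all add: h_def pf_rp hyperbolic_rp degree_rp)
  define x' where "x' = (\<lambda>i. x (Suc i))(m := y m)"
  have x': "pf n x' = [:- y m, 1:] * h"
    unfolding Suc pf_Suc h_def by (intro arg_cong2[of _ _ _ _ "(*)"] pf_cong) (auto simp: x'_def)
  have x: "pf n x = [:- x 0, 1:] * h" unfolding Suc h_def by (rule pf_Suc_shift)
  have le: "nz (T (pf n x')) t \<le> nz (T (pf n y)) t"
  proof (rule T_mono_pf)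
    fix i assume "i < n"
    then show "y i \<le> x' i" using assms[of i] Suc by (cases "i = m") (auto simp: x'_def)
  qed
  show ?thesis
  proof (cases "m < M")
    case True
    then have "T h = 0" using h T_below by simp
    then have "T (pf n x) = T (pf n x')" unfolding x x' by (simp only: T_linear_mult smult_0_right)
    then show ?thesis using le by simp
  next
    case False
    then have "nz (T (pf n x)) t \<le> Suc (nz (T h) t)" unfolding x using h by (intro T_linear_interlace) auto
    moreover have "nz (T h) t \<le> nz (T (pf n x')) t" unfolding x' using h False by (intro T_linear_interlace) auto
    ultimately show ?thesis using le by linarith
  qed
qed simp

section \<open>Location of the zeros of the Q_k and of T((z - x)^n)\<close>

definition \<sigma> :: real where "\<sigma> = sgn (q N)"

lemma \<sigma>_nz: "\<sigma> \<noteq> 0"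
  using q_N by (simp add: \<sigma>_def sgn_zero_iff)

lemma \<sigma>_q: "k \<in> {M..N} \<Longrightarrow> \<sigma> * q k > 0"
  using sgn_q[of k] q_N by (auto simp: \<sigma>_def sgn_real_def split: if_splits)

lemma degree_Q_eq:
  assumes "k \<in> {M..N}"
  shows "degree (Q k) = k + r" "lead_coeff (Q k) = q k"
proof -
  have "coeff (Q k) (k + r) \<noteq> 0" using \<sigma>_q[OF assms] by (auto simp: q_def)
  then show "degree (Q k) = k + r" using degree_Q[of k] le_degree[of "Q k" "k + r"] by simp
  then show "lead_coeff (Q k) = q k" by (simp add: q_def)
qed

lemma Q_sign_at_infinity:
  obtains K where "\<And>k t. k \<in> {M..N} \<Longrightarrow> t \<ge> K \<Longrightarrow> \<sigma> * poly (Q k) t > 0"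
    and "\<And>k t. k \<in> {M..N} \<Longrightarrow> t \<le> - K \<Longrightarrow> (-1) ^ (k + r) * (\<sigma> * poly (Q k) t) > 0"
proof -
  have "\<exists>K. \<forall>t\<ge>K. \<sigma> * poly (Q k) t > 0 \<and> (-1) ^ (k + r) * (\<sigma> * poly (Q k) (- t)) > 0"
    if k: "k \<in> {M..N}" for k
  proof -
    define p1 where "p1 = smult \<sigma> (Q k)"
    define p2 where "p2 = smult ((-1) ^ (k + r) * \<sigma>) (pcompose (Q k) [:0, -1:])"
    have "lead_coeff p1 > 0" using \<sigma>_q[OF k] \<sigma>_nz degree_Q_eq[OF k] by (simp add: p1_def)
    then obtain n1 where n1: "\<And>x. x \<ge> n1 \<Longrightarrow> lead_coeff p1 \<le> poly p1 x"
      using poly_pinfty_gt_lc[of p1] by blast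
    have "degree p2 = k + r" using \<sigma>_nz degree_Q_eq[OF k] by (simp add: p2_def degree_pcompose)
    then have "lead_coeff p2 = ((-1) ^ (k + r) * \<sigma>) * ((-1) ^ (k + r) * q k)"
      by (simp add: p2_def coeff_pcompose_linear q_def)
    also have "\<dots> = ((-1) ^ (k + r) * (-1) ^ (k + r)) * (\<sigma> * q k)" by (simp only: mult_ac)
    also have "\<dots> = \<sigma> * q k" by (simp flip: power_add power_mult_distrib)
    finally have "lead_coeff p2 > 0" using \<sigma>_q[OF k] by simp
    then obtain n2 where n2: "\<And>x. x \<ge> n2 \<Longrightarrow> lead_coeff p2 \<le> poly p2 x"
      using poly_pinfty_gt_lc[of p2] by blast
    show ?thesis
    proof (intro exI[of _ "max n1 n2"] allI impI conjI)
      fix t assume t: "max n1 n2 \<le> t"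
      have "0 < poly p1 t" using n1[of t] t \<open>lead_coeff p1 > 0\<close> by linarith
      then show "0 < \<sigma> * poly (Q k) t" by (simp add: p1_def)
      have "0 < poly p2 t" using n2[of t] t \<open>lead_coeff p2 > 0\<close> by linarith
      then show "0 < (-1) ^ (k + r) * (\<sigma> * poly (Q k) (- t))"
        by (simp add: p2_def poly_pcompose mult.assoc)
    qed
  qed
  then obtain K where K: "\<And>k t. k \<in> {M..N} \<Longrightarrow> t \<ge> K k \<Longrightarrow>
      \<sigma> * poly (Q k) t > 0 \<and> (-1) ^ (k + r) * (\<sigma> * poly (Q k) (- t)) > 0" by metis
  define K' where "K' = Max (K ` {M..N})"
  have le: "K k \<le> K'" if "k \<in> {M..N}" for k unfolding K'_def using that by (intro Max_ge) auto
  show thesis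
  proof (rule that[of K'])
    fix k t assume "k \<in> {M..N}" "t \<ge> K'"
    then show "\<sigma> * poly (Q k) t > 0" using K[of k t] le[of k] by auto
  next
    fix k t assume "k \<in> {M..N}" "t \<le> - K'"
    then show "(-1) ^ (k + r) * (\<sigma> * poly (Q k) t) > 0" using K[of k "- t"] le[of k] by auto
  qed
qed

lemma poly_T_linear_power:
  "poly (T ([:- x, 1:] ^ n)) t = (\<Sum>k=M..N. ff n k * poly (Q k) t * (t - x) ^ (n - k))"
  unfolding T_linear_power by (simp add: poly_sum mult.assoc)

lemma T_power_pos_right:
  assumes "n \<ge> M" "x < t" "\<And>k. k \<in> {M..N} \<Longrightarrow> \<sigma> * poly (Q k) t > 0"
  shows "poly (T ([:- x, 1:] ^ n)) t \<noteq> 0"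
proof -
  have "0 < (\<Sum>k=M..N. ff n k * (\<sigma> * poly (Q k) t) * (t - x) ^ (n - k))"
  proof (rule sum_pos2[of _ M])
    show "0 < ff n M * (\<sigma> * poly (Q M) t) * (t - x) ^ (n - M)"
      by (rule mult_pos_pos[OF mult_pos_pos[OF ff_pos[OF assms(1)] assms(3)]])
        (use assms(2) MN in auto)
    show "0 \<le> ff n k * (\<sigma> * poly (Q k) t) * (t - x) ^ (n - k)" if "k \<in> {M..N}" for k
      by (rule mult_nonneg_nonneg[OF mult_nonneg_nonneg[OF ff_nonneg less_imp_le[OF assms(3)[OF that]]]])
        (use assms(2) in auto)
  qed (use MN in auto)
  also have "\<dots> = \<sigma> * poly (T ([:- x, 1:] ^ n)) t"
    unfolding poly_T_linear_power sum_distrib_left by (intro sum.cong) auto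
  finally show ?thesis by auto
qed

text \<open>For t < x the power (t - x)^(n-k) has sign (-1)^(n-k), so the factor (-1)^(n+r) aligns
  all terms. Terms with k > n are absent, hence the range up to min n N, whose end is the index e of
  the starting point.\<close>

lemma T_power_pos_left:
  assumes "n \<ge> M" "t < x"
    and "\<And>k. k \<in> {M..min n N} \<Longrightarrow> (-1) ^ (k + r) * (\<sigma> * poly (Q k) t) > 0"
  shows "poly (T ([:- x, 1:] ^ n)) t \<noteq> 0"
proof -
  have eq: "(-1) ^ (n + r) * (t - x) ^ (n - k) = (-1) ^ (k + r) * (x - t) ^ (n - k)" if "k \<le> n" for k
  proof -
    have "(t - x) ^ (n - k) = (-1) ^ (n - k) * (x - t) ^ (n - k)"
      by (simp flip: power_mult_distrib)
    moreover have "(-1) ^ (n + r) * (-1) ^ (n - k) = ((-1) ^ (k + r) :: real)"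
    proof -
      have "n + r + (n - k) = k + r + 2 * (n - k)" using that by simp
      then have "(-1) ^ (n + r) * (-1) ^ (n - k) = ((-1) ^ (k + r + 2 * (n - k)) :: real)"
        by (simp only: flip: power_add)
      then show ?thesis by (simp add: power_add power_mult)
    qed
    ultimately show ?thesis by (metis mult.assoc)
  qed
  have "0 < (\<Sum>k=M..min n N. ff n k * ((-1) ^ (k + r) * (\<sigma> * poly (Q k) t)) * (x - t) ^ (n - k))"
  proof (rule sum_pos)
    fix k assume k: "k \<in> {M..min n N}"
    show "0 < ff n k * ((-1) ^ (k + r) * (\<sigma> * poly (Q k) t)) * (x - t) ^ (n - k)"
      by (rule mult_pos_pos[OF mult_pos_pos[OF ff_pos assms(3)]]) (use assms(2) k in auto)
  qed (use assms MN in auto)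
  also have "\<dots> = (\<Sum>k=M..min n N. (-1) ^ (n + r) * (\<sigma> * (ff n k * poly (Q k) t * (t - x) ^ (n - k))))"
  proof (rule sum.cong[OF refl])
    fix k assume "k \<in> {M..min n N}"
    then have "k \<le> n" by simp
    have "ff n k * ((-1) ^ (k + r) * (\<sigma> * poly (Q k) t)) * (x - t) ^ (n - k) =
        ff n k * (\<sigma> * poly (Q k) t) * ((-1) ^ (k + r) * (x - t) ^ (n - k))" by (simp only: mult_ac)
    then show "ff n k * ((-1) ^ (k + r) * (\<sigma> * poly (Q k) t)) * (x - t) ^ (n - k) =
        (-1) ^ (n + r) * (\<sigma> * (ff n k * poly (Q k) t * (t - x) ^ (n - k)))"
      unfolding eq[OF \<open>k \<le> n\<close>, symmetric] by (simp only: mult_ac)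
  qed
  also have "\<dots> = (\<Sum>k=M..N. (-1) ^ (n + r) * (\<sigma> * (ff n k * poly (Q k) t * (t - x) ^ (n - k))))"
    by (rule sum.mono_neutral_left) (auto simp: ff_eq_0)
  also have "\<dots> = (-1) ^ (n + r) * (\<sigma> * poly (T ([:- x, 1:] ^ n)) t)"
    unfolding poly_T_linear_power sum_distrib_left ..
  finally show ?thesis by auto
qed

lemma T_pf:
  assumes "n \<ge> M"
  shows "hyperbolic (T (pf n x))" "degree (T (pf n x)) = n + r" "T (pf n x) \<noteq> 0"
    and "length (zeros (T (pf n x))) = n + r"
proof -
  note a = T_nz[OF degree_pf assms pf_nz, of x]
  show h: "hyperbolic (T (pf n x))" using a by (intro T_hyperbolic) simp
  show "degree (T (pf n x)) = n + r" "T (pf n x) \<noteq> 0" using a by simp_all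
  then show "length (zeros (T (pf n x))) = n + r" using length_zeros[OF h] by simp
qed

text \<open>The smallest zero g(x) of T((z - x)^k) is monotone in x, and at a fixed point all terms
  but one vanish, leaving k! Q_k(x) = 0.\<close>

lemma Q_zero_below:
  assumes k: "k \<in> {M..N}" and pos: "k + r > 0"
    and le: "zeros (T (pf k (\<lambda>_. b))) ! 0 \<le> b"
  obtains x where "x \<le> b" "poly (Q k) x = 0"
proof -
  define g where "g x = zeros (T (pf k (\<lambda>_. x))) ! 0" for x
  note Tk = T_pf[of k] and k' = k[simplified]
  have root: "poly (T ([:- x, 1:] ^ k)) (g x) = 0" for x
    unfolding g_def linear_power_pf using Tk k' pos by (intro poly_zeros_nth) auto
  obtain K where K: "\<And>k t. k \<in> {M..N} \<Longrightarrow> t \<le> - K \<Longrightarrow> (-1) ^ (k + r) * (\<sigma> * poly (Q k) t) > 0"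
    using Q_sign_at_infinity by metis
  \<comment> \<open>At and below -K the Q_k have the signs that exclude zeros of T((z - a)^k) left
    of a. So g lies above the diagonal at a, and by hypothesis at or below it at b.\<close>
  define a where "a = min b (- K)"
  have "a \<le> g a"
  proof (rule ccontr)
    assume neg: "\<not> a \<le> g a"
    then have "poly (T ([:- a, 1:] ^ k)) (g a) \<noteq> 0"
      using k' by (intro T_power_pos_left K) (auto simp: a_def)
    then show False using root by simp
  qed
  moreover have "g x \<le> g y" if "x \<le> y" for x y
    unfolding g_def using that Tk k' pos by (intro zeros_mono T_mono_pf) auto
  moreover have "a \<le> b" "g b \<le> b" using le by (simp_all add: a_def g_def)
  ultimately obtain x where x: "x \<le> b" "g x = x"
    using mono_fixed_point[of a b g] by blast
  have "0 = poly (T ([:- x, 1:] ^ k)) x" using root[of x] x by simp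
  also have "\<dots> = (\<Sum>j=M..N. if j = k then ff k k * poly (Q k) x else 0)"
    unfolding poly_T_linear_power
  proof (rule sum.cong[OF refl])
    fix j
    show "ff k j * poly (Q j) x * (x - x) ^ (k - j) = (if j = k then ff k k * poly (Q k) x else 0)"
      by (cases j k rule: linorder_cases) (auto simp: ff_eq_0 power_0_left)
  qed
  also have "\<dots> = ff k k * poly (Q k) x" using k by simp
  finally have "poly (Q k) x = 0" using ff_pos[of k k] by simp
  then show thesis using that x by blast
qed

text \<open>A zero a of Q_k is a zero of T((z - a)^k). By interlacing, T((z - a)^(k+1)) has a zero
  at or below a, which starts the fixed-point argument for Q_(k+1).\<close>

lemma Q_zero_step:
  assumes "M \<le> k" "k < N" "poly (Q k) a = 0"
  obtains x where "x \<le> a" "poly (Q (Suc k)) x = 0"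
proof (rule Q_zero_below[of "Suc k" a])
  define h where "h = [:- a, 1:] ^ k"
  have h: "hyperbolic h" "degree h = k" by (simp_all add: h_def linear_power_pf)
  have "poly (T h) a = (\<Sum>j=M..N. if j = k then ff k k * poly (Q k) a else 0)"
    unfolding poly_T_linear_power h_def
  proof (rule sum.cong[OF refl])
    fix j
    show "ff k j * poly (Q j) a * (a - a) ^ (k - j) = (if j = k then ff k k * poly (Q k) a else 0)"
      by (cases j k rule: linorder_cases) (auto simp: ff_eq_0 power_0_left)
  qed
  then have "poly (T h) a = 0" using assms(3) by simp
  moreover have "T h \<noteq> 0" using T_pf(3)[of k] assms by (simp add: h_def linear_power_pf)
  ultimately have "0 < nz (T h) a" by (intro nz_pos)
  also have "\<dots> \<le> nz (T ([:- a, 1:] * h)) a" using h assms by (intro T_linear_interlace) auto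
  also have "[:- a, 1:] * h = pf (Suc k) (\<lambda>_. a)" by (simp add: h_def flip: linear_power_pf)
  finally show "zeros (T (pf (Suc k) (\<lambda>_. a))) ! 0 \<le> a"
    using T_pf(4)[of "Suc k"] assms by (subst zeros_le_iff) auto
qed (use assms that in auto)

lemma Q_zero_chain:
  assumes "M \<le> k" "k \<le> e" "e \<le> N" "poly (Q k) a = 0"
  obtains x where "x \<le> a" "poly (Q e) x = 0"
proof -
  have "\<exists>x\<le>a. poly (Q e) x = 0"
    using assms(2,3)
  proof (induction e rule: dec_induct)
    case (step e)
    then obtain x where "x \<le> a" "poly (Q e) x = 0" by auto
    then show ?case using Q_zero_step[of e x] step assms(1) by (metis Suc_le_eq order_trans)
  qed (use assms in auto)
  then show thesis using that by blast
qed

lemma Q_sign_left: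
  assumes k: "M \<le> k" "k \<le> e" "e \<le> N" and t: "\<And>s. poly (Q e) s = 0 \<Longrightarrow> t < s"
  shows "(-1) ^ (k + r) * (\<sigma> * poly (Q k) t) > 0"
proof -
  obtain K where K: "\<And>k t. k \<in> {M..N} \<Longrightarrow> t \<le> - K \<Longrightarrow> (-1) ^ (k + r) * (\<sigma> * poly (Q k) t) > 0"
    using Q_sign_at_infinity by metis
  have "poly (smult ((-1) ^ (k + r) * \<sigma>) (Q k)) t > 0"
  proof (rule poly_same_sgn[of "min t (- K)"])
    show "poly (smult ((- 1) ^ (k + r) * \<sigma>) (Q k)) x \<noteq> 0" if "x \<le> t" for x
    proof
      assume "poly (smult ((- 1) ^ (k + r) * \<sigma>) (Q k)) x = 0"
      then have "poly (Q k) x = 0" using \<sigma>_nz by simp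
      then obtain y where "y \<le> x" "poly (Q e) y = 0" using Q_zero_chain k by metis
      then show False using t[of y] that by simp
    qed
    show "0 < poly (smult ((- 1) ^ (k + r) * \<sigma>) (Q k)) (min t (- K))"
      using K[of k "min t (- K)"] k by (simp add: mult.assoc)
  qed simp_all
  then show ?thesis by (simp add: mult.assoc)
qed

text \<open>If \<open>Q\<^sub>e\<close> has no zero, then \<open>a\<close> is unspecified, but \<open>Q_sign_left\<close> applies everywhere.\<close>

lemma T_start_zeros_ge:
  assumes "n \<ge> M" and a: "a = Min {x. poly (Q (min n N)) x = 0}"
    and t: "poly (T ([:- a, 1:] ^ n)) t = 0"
  shows "a \<le> t"
proof (rule ccontr)
  assume lt: "\<not> a \<le> t"
  have "Q (min n N) \<noteq> 0" using \<sigma>_q[of "min n N"] assms(1) MN by (auto simp: q_def)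
  then have fin: "finite {x. poly (Q (min n N)) x = 0}" by (rule poly_roots_finite)
  have "poly (T ([:- a, 1:] ^ n)) t \<noteq> 0"
  proof (rule T_power_pos_left)
    fix k assume k: "k \<in> {M..min n N}"
    show "0 < (- 1) ^ (k + r) * (\<sigma> * poly (Q k) t)"
    proof (rule Q_sign_left[of _ "min n N"])
      fix s assume "poly (Q (min n N)) s = 0"
      then have "a \<le> s" unfolding a using fin by (intro Min_le) auto
      then show "t < s" using lt by simp
    qed (use k in auto)
  qed (use assms lt in auto)
  then show False using t by simp
qed

text \<open>Supplies a constant vector that one step does not increase; by monotonicity it dominates
  all iterates.\<close>

lemma T_end_zeros_le:
  assumes "n \<ge> M"
  obtains b where "a \<le> b" "\<And>t. poly (T ([:- b, 1:] ^ n)) t = 0 \<Longrightarrow> t \<le> b"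
proof -
  obtain K where K: "\<And>k t. k \<in> {M..N} \<Longrightarrow> t \<ge> K \<Longrightarrow> \<sigma> * poly (Q k) t > 0"
    using Q_sign_at_infinity by metis
  show thesis
  proof (rule that[of "max a K"])
    fix t assume "poly (T ([:- max a K, 1:] ^ n)) t = 0"
    then show "t \<le> max a K"
      using T_power_pos_right[OF assms, of "max a K" t] K[of _ t] by (meson max.cobounded2 not_le order.trans less_imp_le)
  qed simp
qed

section \<open>The iteration on zero vectors\<close>

definition step :: "nat \<Rightarrow> nat set \<Rightarrow> (nat \<Rightarrow> real) \<Rightarrow> nat \<Rightarrow> real" where
  "step n B x i = zeros (T (pf n x)) ! idx B i"

definition start :: "nat \<Rightarrow> real" where
  "start n = Min {x. poly (Q (min n N)) x = 0}"

definition iter :: "nat \<Rightarrow> nat set \<Rightarrow> nat \<Rightarrow> nat \<Rightarrow> real" where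
  "iter n B k = (step n B ^^ k) (\<lambda>_. start n)"

lemma zeros_T_sorted:
  "n \<ge> M \<Longrightarrow> j \<le> k \<Longrightarrow> k < n + r \<Longrightarrow> zeros (T (pf n x)) ! j \<le> zeros (T (pf n x)) ! k"
  using sorted_zeros[of "T (pf n x)"] T_pf(4)[of n x] by (simp add: sorted_iff_nth_mono)

lemma zeros_T_mono:
  assumes "n \<ge> M" "\<And>i. i < n \<Longrightarrow> x i \<le> y i" "j < n + r"
  shows "zeros (T (pf n x)) ! j \<le> zeros (T (pf n y)) ! j"
  using assms T_pf[OF assms(1)] by (intro zeros_mono T_mono_pf) auto

lemma zeros_T_shift:
  assumes "n \<ge> M" "\<And>i. Suc i < n \<Longrightarrow> y i \<le> x (Suc i)" "Suc j < n + r"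
  shows "zeros (T (pf n y)) ! j \<le> zeros (T (pf n x)) ! Suc j"
  using assms T_pf[OF assms(1)] by (intro zeros_shift T_shift) auto

lemma step_mono:
  assumes "n \<ge> M" "B \<subseteq> {1..n + r}" "card B = n" "\<And>i. i < n \<Longrightarrow> x i \<le> y i" "i < n"
  shows "step n B x i \<le> step n B y i"
  unfolding step_def using assms idx_less(1)[of B "n + r" i] by (intro zeros_T_mono) auto

text \<open>Passing from x to y and from position i of B to that of C both move right, which gives
  the first inequality. The second compares T of y with T of x at the next position; the strict
  inequality \<open>idx C i < idx B (Suc i)\<close> provides that extra position.\<close>

lemma step_interlace:
  assumes n: "n \<ge> M" and B: "B \<subseteq> {1..n + r}" "card B = n" and C: "C \<subseteq> {1..n + r}" "card C = n"
    and arr: "arrow B C"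
    and xy: "\<And>i. i < n \<Longrightarrow> x i \<le> y i" and yx: "\<And>i. Suc i < n \<Longrightarrow> y i \<le> x (Suc i)"
  shows "i < n \<Longrightarrow> step n B x i \<le> step n C y i"
    and "Suc i < n \<Longrightarrow> step n C y i \<le> step n B x (Suc i)"
proof -
  note ar = arrow_idx[OF arr B(1) C(1) B(2) C(2)]
  show "step n B x i \<le> step n C y i" if i: "i < n"
  proof -
    have "step n B x i \<le> step n B y i" using n B xy i by (intro step_mono) auto
    also have "\<dots> \<le> step n C y i"
      unfolding step_def using ar(1)[OF i] idx_less(1)[OF C(1), of i] C i n by (intro zeros_T_sorted) auto
    finally show ?thesis .
  qed
  show "step n C y i \<le> step n B x (Suc i)" if i: "Suc i < n"
  proof -
    have lt: "idx B (Suc i) < n + r" using idx_less(1)[OF B(1), of "Suc i"] B i by simp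
    have "step n C y i \<le> zeros (T (pf n x)) ! Suc (idx C i)"
      unfolding step_def using ar(2)[OF i] lt n yx by (intro zeros_T_shift) auto
    also have "\<dots> \<le> step n B x (Suc i)"
      unfolding step_def using ar(2)[OF i] lt n by (intro zeros_T_sorted) auto
    finally show ?thesis .
  qed
qed

lemma iter_Suc: "iter n B (Suc k) = step n B (iter n B k)"
  by (simp add: iter_def)

text \<open>Replaces the recursion on polynomials by one on zero vectors, where the entrywise order
  is available.\<close>

lemma pattern_iterate_eq:
  assumes "n \<ge> M" "B \<subseteq> {1..n + r}" "card B = n"
  shows "pattern_iterate T ({1..n + r} - B) B ([:- start n, 1:] ^ n) k = pf n (iter n B k)"
proof (induction k)
  case 0
  then show ?case by (simp add: iter_def linear_power_pf)
next
  case (Suc k)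
  have "snd (pattern_factorization ({1..n + r} - B) B (T (pf n (iter n B k)))) =
      pf n (\<lambda>i. zeros (T (pf n (iter n B k))) ! idx B i)"
    using T_pf[OF assms(1)] assms by (intro snd_pattern_factorization) auto
  then show ?case using Suc by (simp add: iter_Suc step_def[abs_def])
qed

lemma iter_interlace:
  assumes n: "n \<ge> M" and B: "B \<subseteq> {1..n + r}" "card B = n" and C: "C \<subseteq> {1..n + r}" "card C = n"
    and arr: "arrow B C"
  shows "(\<forall>i<n. iter n B k i \<le> iter n C k i) \<and> (\<forall>i. Suc i < n \<longrightarrow> iter n C k i \<le> iter n B k (Suc i))"
proof (induction k)
  case 0
  then show ?case by (simp add: iter_def)
next
  case (Suc k)
  then show ?case
    unfolding iter_Suc using step_interlace[OF n B C arr, of "iter n B k" "iter n C k"] by blast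
qed

lemma iter_incseq:
  assumes n: "n \<ge> M" and B: "B \<subseteq> {1..n + r}" "card B = n"
  shows "i < n \<Longrightarrow> iter n B k i \<le> iter n B (Suc k) i"
proof (induction k arbitrary: i)
  case 0
  have "idx B i < n + r" using idx_less(1)[OF B(1)] B 0 by simp
  then have "poly (T (pf n (\<lambda>_. start n))) (zeros (T (pf n (\<lambda>_. start n))) ! idx B i) = 0"
    using T_pf[OF n] by (intro poly_zeros_nth) auto
  then show ?case
    using T_start_zeros_ge[OF n start_def] by (simp add: iter_def step_def linear_power_pf)
next
  case (Suc k)
  then show ?case unfolding iter_Suc[of n B k] iter_Suc[of n B "Suc k"]
    using n B by (intro step_mono) auto
qed

lemma iter_bounded:
  assumes n: "n \<ge> M" and B: "B \<subseteq> {1..n + r}" "card B = n"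
  obtains b where "\<And>k i. i < n \<Longrightarrow> iter n B k i \<le> b"
proof -
  obtain b where b: "start n \<le> b" "\<And>t. poly (T ([:- b, 1:] ^ n)) t = 0 \<Longrightarrow> t \<le> b"
    using T_end_zeros_le[OF n] by blast
  have sb: "step n B (\<lambda>_. b) i \<le> b" if "i < n" for i
  proof -
    have "idx B i < n + r" using idx_less(1)[OF B(1)] B that by simp
    then have "poly (T (pf n (\<lambda>_. b))) (zeros (T (pf n (\<lambda>_. b))) ! idx B i) = 0"
      using T_pf[OF n] by (intro poly_zeros_nth) auto
    then show ?thesis unfolding step_def using b(2) by (simp add: linear_power_pf)
  qed
  have "iter n B k i \<le> b" if "i < n" for k i
    using that
  proof (induction k arbitrary: i)
    case (Suc k)
    have "step n B (iter n B k) i \<le> step n B (\<lambda>_. b) i"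
      using Suc n B by (intro step_mono) auto
    then show ?case using sb[OF Suc.prems] by (simp add: iter_Suc)
  qed (use b in \<open>simp add: iter_def\<close>)
  then show thesis by (rule that)
qed

lemma pconv_T: "pconv X p \<Longrightarrow> pconv (\<lambda>i. T (X i)) (T p)"
  unfolding diff_op_def by (intro pconv_sum pconv_mult pconv_const pconv_higher_pderiv)

lemma T_pf_factor:
  assumes "n \<ge> M"
  shows "T (pf n x) = smult (lam n) (pf (n + r) (\<lambda>j. zeros (T (pf n x)) ! j))"
proof -
  have "lead_coeff (T (pf n x)) = lam n" using T_nz[OF degree_pf assms pf_nz] by simp
  moreover have "rp (proots (T (pf n x))) = pf (n + r) (\<lambda>j. zeros (T (pf n x)) ! j)"
  proof -
    have "proots (T (pf n x)) = mset (map (\<lambda>j. zeros (T (pf n x)) ! j) [0..<n + r])"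
      using T_pf(4)[OF assms] by (metis map_nth mset_zeros)
    then show ?thesis by (simp only: pf_rp mset_map_upt)
  qed
  ultimately show ?thesis using hyperbolic_factor[OF T_pf(1)[OF assms], of x] by simp
qed

text \<open>Along an increasing sequence each zero of the image is monotone and bounded, hence
  convergent. The limits are sorted, and coefficientwise convergence identifies them as the zeros of
  the limit, multiplicities included.\<close>

lemma zeros_T_continuous:
  assumes n: "n \<ge> M" and mono: "\<And>i k. i < n \<Longrightarrow> x k i \<le> x (Suc k) i"
    and lim: "\<And>i. i < n \<Longrightarrow> (\<lambda>k. x k i) \<longlonglongrightarrow> y i"
    and j: "j < n + r"
  shows "(\<lambda>k. zeros (T (pf n (x k))) ! j) \<longlonglongrightarrow> zeros (T (pf n y)) ! j"
proof -
  define z where "z k j = zeros (T (pf n (x k))) ! j" for k j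
  have le: "x k i \<le> y i" if "i < n" for i k
    using lim[OF that] mono[OF that] incseq_le[of "\<lambda>k. x k i"] by (simp add: incseq_SucI)
  have "\<exists>l. (\<lambda>k. z k j) \<longlonglongrightarrow> l" if "j < n + r" for j
    unfolding z_def using n mono le that
    by (intro mono_bounded_LIMSEQ[of _ "zeros (T (pf n y)) ! j"] zeros_T_mono) auto
  then obtain \<alpha> where \<alpha>: "\<And>j. j < n + r \<Longrightarrow> (\<lambda>k. z k j) \<longlonglongrightarrow> \<alpha> j" by metis
  have "pconv (\<lambda>k. T (pf n (x k))) (T (pf n y))" by (intro pconv_T pconv_pf lim)
  moreover have "pconv (\<lambda>k. smult (lam n) (pf (n + r) (z k))) (smult (lam n) (pf (n + r) \<alpha>))"
    by (intro pconv_smult pconv_pf tendsto_const \<alpha>)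
  then have "pconv (\<lambda>k. T (pf n (x k))) (smult (lam n) (pf (n + r) \<alpha>))"
    unfolding z_def T_pf_factor[OF n, symmetric] .
  ultimately have T: "T (pf n y) = smult (lam n) (pf (n + r) \<alpha>)" by (rule pconv_unique)
  have "\<alpha> i \<le> \<alpha> j" if "i \<le> j" "j < n + r" for i j
  proof (rule LIMSEQ_le[OF \<alpha> \<alpha>])
    show "\<exists>N. \<forall>k\<ge>N. z k i \<le> z k j"
      unfolding z_def using zeros_T_sorted[OF n] that by blast
  qed (use that in auto)
  then have "zeros (pf (n + r) \<alpha>) = map \<alpha> [0..<n + r]" by (rule zeros_pf)
  then have "zeros (T (pf n y)) = map \<alpha> [0..<n + r]"
    using lam_nz[OF n] unfolding T zeros_def by simp
  then show ?thesis using \<alpha>[OF j] j by (simp add: z_def)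
qed

lemma eigenpoly_limit:
  assumes n: "n \<ge> M" and B: "B \<subseteq> {1..n + r}" "card B = n"
  obtains \<xi> where "\<And>i. i < n \<Longrightarrow> (\<lambda>k. iter n B k i) \<longlonglongrightarrow> \<xi> i"
    and "eigenpoly Q M N r n B = pf n \<xi>"
    and "\<And>i. i < n \<Longrightarrow> \<xi> i = zeros (T (pf n \<xi>)) ! idx B i"
proof -
  obtain b where b: "\<And>k i. i < n \<Longrightarrow> iter n B k i \<le> b" using iter_bounded[OF n B] by blast
  have "\<exists>l. (\<lambda>k. iter n B k i) \<longlonglongrightarrow> l" if "i < n" for i
    using iter_incseq[OF n B that] b[OF that] by (intro mono_bounded_LIMSEQ)
  then obtain \<xi> where \<xi>: "\<And>i. i < n \<Longrightarrow> (\<lambda>k. iter n B k i) \<longlonglongrightarrow> \<xi> i" by metis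
  show thesis
  proof (rule that[OF \<xi>])
    have "pconv (\<lambda>k. pf n (iter n B k)) (pf n \<xi>)" by (intro pconv_pf \<xi>)
    moreover have "pattern_iterate T ({1..n + r} - B) B ([:- start n, 1:] ^ n) = (\<lambda>k. pf n (iter n B k))"
      by (rule ext) (rule pattern_iterate_eq[OF n B])
    ultimately show "eigenpoly Q M N r n B = pf n \<xi>"
      unfolding eigenpoly_def Let_def start_def[symmetric] by (simp only: poly_lim_eq)
    fix i assume i: "i < n"
    then have "idx B i < n + r" using idx_less(1)[OF B(1), of i] B by simp
    then have "(\<lambda>k. iter n B (Suc k) i) \<longlonglongrightarrow> zeros (T (pf n \<xi>)) ! idx B i"
      unfolding iter_Suc step_def
      by (intro zeros_T_continuous[OF n] iter_incseq[OF n B] \<xi>)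
    moreover have "(\<lambda>k. iter n B (Suc k) i) \<longlonglongrightarrow> \<xi> i"
      using \<xi>[OF i] by (rule LIMSEQ_Suc)
    ultimately show "\<xi> i = zeros (T (pf n \<xi>)) ! idx B i" by (metis LIMSEQ_unique)
  qed
qed

section \<open>Persistence of zeros of the image under changes of the argument\<close>

lemma T_drop:
  assumes h: "hyperbolic h" and dvd: "[:- \<theta>, 1:] ^ Suc j dvd T ([:- c, 1:] * h)"
  shows "[:- \<theta>, 1:] ^ j dvd T h"
proof (cases "degree h \<ge> M")
  case True
  note a = T_pencil[OF h True] and i = T_linear_interlace[OF h True]
  have nz: "T ([:- c, 1:] * h) \<noteq> 0" "T h \<noteq> 0" using a(1)[of c] a(2) hyperbolic_nz by blast+
  have "Suc j \<le> order \<theta> (T ([:- c, 1:] * h))" using dvd nz(1) order_divides by blast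
  \<comment> \<open>Passing from T((z - c) h) to T(h), counts left of \<theta> do not grow and the
    count at \<theta> falls by at most one, so the jump loses at most one.\<close>
  then have "nz (T h) s + j \<le> nz (T h) \<theta>" if "s < \<theta>" for s
    unfolding le_order_iff_nz[OF nz(1)] using that i(1)[of s c] i(2)[of c \<theta>] by fastforce
  then show ?thesis using nz(2) le_order_iff_nz[OF nz(2)] order_divides by blast
qed (simp add: T_below)

text \<open>An exchange: giving up a fixed factor z - c and one order of vanishing gains one degree
  of freedom in u. Dropping the factor handles products of real linear factors, their span gives
  degree m, and u = (z - c) v + c v + a reaches degree m + 1.\<close>

lemma T_drop_family:
  assumes h: "hyperbolic h"
    and dvd: "\<And>u. degree u \<le> m \<Longrightarrow> [:- \<theta>, 1:] ^ Suc j dvd T ([:- c, 1:] * h * u)"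
    and u: "degree u \<le> Suc m"
  shows "[:- \<theta>, 1:] ^ j dvd T (h * u)"
proof -
  let ?P = "[:- \<theta>, 1:] ^ j"
  have fam: "?P dvd T (h * v)" if "degree v \<le> m" for v
  proof -
    have "v \<in> {v. ?P dvd T (h * v)}"
    proof (rule products_span[where x = "\<lambda>_. 0" and y = "\<lambda>_. 1" and m = m])
      show "pf m z \<in> {v. ?P dvd T (h * v)}" for z
      proof -
        have "hyperbolic (h * pf m z)" using h by (simp add: hyperbolic_mult_iff)
        moreover have "[:- \<theta>, 1:] ^ Suc j dvd T ([:- c, 1:] * (h * pf m z))"
          using dvd[of "pf m z"] by (simp only: mult.assoc degree_pf)
        ultimately show ?thesis using T_drop by blast
      qed
    qed (use that in \<open>auto simp: distrib_left T_add T_smult intro: dvd_add dvd_smult\<close>)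
    then show ?thesis by simp
  qed
  obtain a v where uv: "u = pCons a v" by (cases u)
  then have v: "degree v \<le> m" using u by (auto split: if_splits)
  have "u = [:- c, 1:] * v + smult c v + smult a 1" by (simp add: uv)
  then have "h * u = [:- c, 1:] * h * v + smult c (h * v) + smult a (h * 1)"
    by (simp only: distrib_left mult_smult_right mult_ac)
  then have "T (h * u) = T ([:- c, 1:] * h * v) + smult c (T (h * v)) + smult a (T (h * 1))"
    by (simp only: T_add T_smult)
  moreover have "?P dvd T ([:- c, 1:] * h * v)"
    using dvd[OF v] by (rule dvd_trans[rotated]) (simp add: le_imp_power_dvd del: power_Suc)
  moreover have "?P dvd T (h * v)" "?P dvd T (h * 1)" using fam[OF v] fam[of 1] by simp_all
  ultimately show ?thesis by (simp add: dvd_add dvd_smult)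
qed

lemma T_drop_repeat:
  assumes "\<And>u. degree u \<le> m \<Longrightarrow> [:- \<theta>, 1:] ^ (j + k) dvd T (rp (replicate_mset k c + A) * u)"
    and "degree u \<le> m + k"
  shows "[:- \<theta>, 1:] ^ j dvd T (rp A * u)"
  using assms
proof (induction k arbitrary: m u)
  case (Suc k)
  show ?case
  proof (rule Suc.IH)
    fix v :: "real poly" assume v: "degree v \<le> Suc m"
    have eq: "rp (replicate_mset (Suc k) c + A) = [:- c, 1:] * rp (replicate_mset k c + A)"
      by (simp del: mult_pCons_left)
    show "[:- \<theta>, 1:] ^ (j + k) dvd T (rp (replicate_mset k c + A) * v)"
    proof (rule T_drop_family[where c = c and m = m])
      fix u :: "real poly" assume u: "degree u \<le> m"
      show "[:- \<theta>, 1:] ^ Suc (j + k) dvd T ([:- c, 1:] * rp (replicate_mset k c + A) * u)"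
        using Suc.prems(1)[OF u] unfolding eq add_Suc_right .
    qed (rule hyperbolic_rp, rule v)
  qed (use Suc.prems in simp)
qed simp

section \<open>The symbol and its hyperbolicity\<close>

definition symbol :: "real \<Rightarrow> real poly" where
  "symbol \<theta> = (\<Sum>k=M..N. monom (poly (Q k) \<theta>) k)"

lemma coeff_symbol: "coeff (symbol \<theta>) k = poly (Q k) \<theta>"
  using Q_outside[of k] by (cases "k \<in> {M..N}") (auto simp: symbol_def coeff_sum)

lemma degree_symbol: "degree (symbol \<theta>) \<le> N"
  by (rule degree_le) (simp add: coeff_symbol Q_outside)

lemma dual_symbol: "dual \<theta> (symbol \<theta>) h = poly (T h) \<theta>"
proof -
  have "dual \<theta> (symbol \<theta>) h = (\<Sum>k\<le>N. poly (Q k) \<theta> * poly ((pderiv ^^ k) h) \<theta>)"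
    using dual_bound[OF degree_symbol] by (simp add: coeff_symbol)
  also have "\<dots> = (\<Sum>k=M..N. poly (Q k) \<theta> * poly ((pderiv ^^ k) h) \<theta>)"
    by (rule sum.mono_neutral_right) (auto simp: Q_outside)
  finally show ?thesis by (simp add: diff_op_def poly_sum)
qed

text \<open>A mixture lies between x and y entrywise. Its count at \<theta> is squeezed between
  equal values, and its counts to the left are at most those for x, so the jump at \<theta> stays at
  least j.\<close>

lemma T_mixed_order:
  assumes n: "n \<ge> M" and xy: "\<And>i. i < n \<Longrightarrow> x i \<le> y i"
    and eq: "nz (T (pf n x)) \<theta> = nz (T (pf n y)) \<theta>"
    and dvd: "[:- \<theta>, 1:] ^ j dvd T (pf n x)"
    and z: "\<And>i. i < n \<Longrightarrow> z i \<in> {x i, y i}"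
  shows "[:- \<theta>, 1:] ^ j dvd T (pf n z)"
proof -
  have zx: "x i \<le> z i" "z i \<le> y i" if "i < n" for i using z[OF that] xy[OF that] by auto
  note T = T_pf(3)[OF n]
  have "j \<le> order \<theta> (T (pf n z))"
  proof (rule order_sandwich[OF T T])
    show "nz (T (pf n z)) t \<le> nz (T (pf n x)) t" for t by (rule T_mono_pf) (rule zx)
    show "nz (T (pf n x)) \<theta> \<le> nz (T (pf n z)) \<theta>" unfolding eq by (rule T_mono_pf) (rule zx)
    show "j \<le> order \<theta> (T (pf n x))" using dvd T order_divides by blast
  qed
  then show ?thesis using order_divides by blast
qed

text \<open>Here z_i ranges between y_i and x_(i+1). If the count for x exceeds that for y by the
  maximal amount, \<open>T_shift\<close> keeps the count for z from falling below that for y. The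
  last z has no upper bound.\<close>

lemma T_mixed_order_shift:
  assumes n: "n \<ge> M" and yx: "\<And>i. Suc i < n \<Longrightarrow> y i \<le> x (Suc i)"
    and eq: "nz (T (pf n x)) \<theta> = Suc (nz (T (pf n y)) \<theta>)"
    and dvd: "[:- \<theta>, 1:] ^ j dvd T (pf n y)"
    and z: "\<And>i. Suc i < n \<Longrightarrow> z i \<in> {y i, x (Suc i)}" "\<And>i. n = Suc i \<Longrightarrow> y i \<le> z i"
  shows "[:- \<theta>, 1:] ^ j dvd T (pf n z)"
proof -
  have yz: "y i \<le> z i" if "i < n" for i
    using z(1)[of i] z(2)[of i] yx[of i] that by (cases "Suc i < n") (auto simp: not_less)
  have zx: "z i \<le> x (Suc i)" if "Suc i < n" for i using z(1)[OF that] yx[OF that] by auto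
  note T = T_pf(3)[OF n]
  have "j \<le> order \<theta> (T (pf n z))"
  proof (rule order_sandwich[OF T T])
    show "nz (T (pf n z)) t \<le> nz (T (pf n y)) t" for t by (rule T_mono_pf) (rule yz)
    have "nz (T (pf n x)) \<theta> \<le> Suc (nz (T (pf n z)) \<theta>)" by (rule T_shift) (rule zx)
    then show "nz (T (pf n y)) \<theta> \<le> nz (T (pf n z)) \<theta>" using eq by simp
    show "j \<le> order \<theta> (T (pf n y))" using dvd T order_divides by blast
  qed
  then show ?thesis using order_divides by blast
qed

text \<open>Positions with equal entries form the fixed factor; the others, enumerated by
  \<open>e\<close>, offer two distinct choices each, and the resulting products span.\<close>

lemma T_mixed_span:
  assumes mix: "\<And>z. (\<And>i. i < n \<Longrightarrow> z i \<in> {x i, y i}) \<Longrightarrow> P dvd T (pf n z)"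
    and u: "degree u \<le> card {i. i < n \<and> x i \<noteq> y i}"
  shows "P dvd T (rp (image_mset x (mset_set {i. i < n \<and> x i = y i})) * u)"
proof -
  define F where "F = {i. i < n \<and> x i = y i}"
  define G where "G = {i. i < n \<and> x i \<noteq> y i}"
  define m where "m = card G"
  have fin: "finite F" "finite G" and FG: "F \<union> G = {..<n}" "F \<inter> G = {}"
    by (auto simp: F_def G_def)
  obtain e where e: "bij_betw e {..<m} G"
    using ex_bij_betw_nat_finite[OF fin(2)] by (auto simp: m_def lessThan_atLeast0)
  define e' where "e' = inv_into {..<m} e"
  have e': "e' (e i) = i" if "i < m" for i
    unfolding e'_def using e that by (simp add: bij_betw_inv_into_left)
  have eG: "e i \<in> G" if "i < m" for i using e that by (auto simp: bij_betw_def)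
  let ?d = "rp (image_mset x (mset_set F))"
  have d: "?d = (\<Prod>i\<in>F. [:- x i, 1:])"
    by (simp add: rp_def prod_unfold_prod_mset image_mset.compositionality comp_def)
  have "u \<in> {v. P dvd T (?d * v)}"
  proof (rule products_span[where x = "\<lambda>i. x (e i)" and y = "\<lambda>i. y (e i)" and m = m])
    show "x (e i) \<noteq> y (e i)" if "i < m" for i using eG[OF that] by (simp add: G_def)
    fix z assume z: "\<And>i. i < m \<Longrightarrow> z i \<in> {x (e i), y (e i)}"
    define w where "w i = (if i \<in> G then z (e' i) else x i)" for i
    have "P dvd T (pf n w)"
    proof (rule mix)
      fix i assume "i < n"
      show "w i \<in> {x i, y i}"
      proof (cases "i \<in> G")
        case True
        then obtain k where "k < m" "i = e k" using e by (auto simp: bij_betw_def)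
        then show ?thesis using z[of k] e' True by (simp add: w_def)
      qed (simp add: w_def)
    qed
    also have "pf n w = ?d * pf m z"
    proof -
      have "pf n w = (\<Prod>i\<in>F. [:- w i, 1:]) * (\<Prod>i\<in>G. [:- w i, 1:])"
        unfolding pf_def FG(1)[symmetric] using fin FG(2) by (rule prod.union_disjoint)
      also have "(\<Prod>i\<in>F. [:- w i, 1:]) = ?d"
        unfolding d using FG(2) by (intro prod.cong) (auto simp: w_def)
      also have "(\<Prod>i\<in>G. [:- w i, 1:]) = (\<Prod>i<m. [:- w (e i), 1:])"
        by (rule prod.reindex_bij_betw[OF e, symmetric])
      also have "\<dots> = pf m z"
        unfolding pf_def using eG e' by (intro prod.cong) (auto simp: w_def)
      finally show ?thesis .
    qed
    finally show "pf m z \<in> {v. P dvd T (?d * v)}" by simp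
  qed (use u in \<open>auto simp: m_def G_def distrib_left T_add T_smult intro: dvd_add dvd_smult\<close>)
  then show ?thesis by (simp add: F_def)
qed

text \<open>T(F - c R) vanishes at \<theta> for every c, while all zeros of F - c R move strictly
  right with c. Between c = 0 and c = 2 the count at \<theta> drops by at most one, so it agrees at
  c = 0, 1 or at c = 1, 2. For such a pair all mixtures keep the zero \<theta>, and as no zero is
  shared they span every degree up to m.\<close>

lemma T_vanishes_of_pencil:
  assumes hyp: "\<And>c. hyperbolic (F - smult c R)" and R: "hyperbolic R"
    and deg: "degree F = m" "m = Suc (degree R)" and lead: "lead_coeff F = 1" "lead_coeff R > 0"
    and cop: "\<And>t. \<not> (poly F t = 0 \<and> poly R t = 0)"
    and m: "m \<ge> M" and TF: "poly (T F) \<theta> = 0" and TR: "poly (T R) \<theta> = 0"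
    and u: "degree u \<le> m"
  shows "poly (T u) \<theta> = 0"
proof -
  define p where "p c = F - smult c R" for c
  define x where "x c i = zeros (p c) ! i" for c i
  have hp: "hyperbolic (p c)" for c using hyp by (simp add: p_def)
  have dp: "degree (p c) = m" "lead_coeff (p c) = 1" for c
  proof -
    have "degree (smult c R) < degree F" using deg degree_smult_le[of c R] by simp
    then have "degree (F - smult c R) = degree F" using degree_add_eq_left[of "- smult c R" F] by simp
    then show "degree (p c) = m" "lead_coeff (p c) = 1"
      using deg lead by (simp_all add: p_def coeff_eq_0)
  qed
  have pf: "pf m (x c) = p c" for c
  proof -
    have "x c = (\<lambda>i. zeros (p c) ! i)" by (simp add: x_def fun_eq_iff)
    then show ?thesis by (simp only:) (rule hyperbolic_monic_pf[OF hp dp(2,1), symmetric])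
  qed
  have inter: "nz R t \<le> nz (p c) t \<and> nz (p c) t \<le> Suc (nz R t)" for c t
  proof (rule pencil_interlace)
    show "hyperbolic (p c - smult y R)" for y
      using hyp[of "c + y"] by (simp add: p_def smult_add_left algebra_simps)
  qed (use R dp deg in auto)
  have mono: "nz (p c') t \<le> nz (p c) t" if "c < c'" for c c' t
    unfolding p_def using that hyp R deg lead by (intro pencil_mono) auto
  have len: "length (zeros (p c)) = m" for c using length_zeros[OF hp] dp by simp
  have strict: "x c i < x c' i" if "c < c'" "i < m" for c c' i
  proof -
    have "x c i \<le> x c' i"
      unfolding x_def using that hp dp mono by (intro zeros_mono) auto
    moreover have "x c i \<noteq> x c' i"
    proof
      assume eq: "x c i = x c' i"
      have "poly (p c) (x c i) = 0" "poly (p c') (x c i) = 0"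
        using poly_zeros_nth[OF hyperbolic_nz[OF hp], of i c] poly_zeros_nth[OF hyperbolic_nz[OF hp], of i c']
          that len eq by (simp_all add: x_def)
      then have z: "poly F (x c i) = c * poly R (x c i)" "poly F (x c i) = c' * poly R (x c i)"
        by (simp_all add: p_def)
      then have "(c' - c) * poly R (x c i) = 0" by (simp add: algebra_simps)
      then have "poly R (x c i) = 0" using that by simp
      then show False using cop[of "x c i"] z by simp
    qed
    ultimately show ?thesis by simp
  qed
  have key: "poly (T u) \<theta> = 0"
    if eq: "nz (T (p c)) \<theta> = nz (T (p c')) \<theta>" and c: "c < c'" for c c'
  proof -
    have "poly (T (p c)) \<theta> = 0" using TF TR by (simp add: p_def T_diff T_smult)
    then have dvd: "[:- \<theta>, 1:] ^ 1 dvd T (pf m (x c))" by (simp add: pf poly_eq_0_iff_dvd)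
    have eqsets: "{i. i < m \<and> x c i = x c' i} = {}" "{i. i < m \<and> x c i \<noteq> x c' i} = {..<m}"
      using strict[OF c] less_irrefl by (metis (mono_tags, lifting) empty_Collect_eq, force)
    have "[:- \<theta>, 1:] ^ 1 dvd T (rp (image_mset (x c) (mset_set {i. i < m \<and> x c i = x c' i})) * u)"
    proof (rule T_mixed_span)
      show "[:- \<theta>, 1:] ^ 1 dvd T (pf m z)" if "\<And>i. i < m \<Longrightarrow> z i \<in> {x c i, x c' i}" for z
      proof (rule T_mixed_order[of m "x c" "x c'", OF m _ _ dvd])
        show "x c i \<le> x c' i" if "i < m" for i using strict[OF c that] by simp
        show "nz (T (pf m (x c))) \<theta> = nz (T (pf m (x c'))) \<theta>" unfolding pf by (rule eq)
      qed (rule that)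
      show "degree u \<le> card {i. i < m \<and> x c i \<noteq> x c' i}" unfolding eqsets using u by simp
    qed
    then have "[:- \<theta>, 1:] dvd T u" unfolding eqsets by simp
    then show ?thesis by (simp add: poly_eq_0_iff_dvd)
  qed
  have le: "nz (T (p c')) \<theta> \<le> nz (T (p c)) \<theta>" if "c < c'" for c c'
    unfolding pf[symmetric] using strict[OF that] by (intro T_mono_pf less_imp_le)
  have "nz (T (p 0)) \<theta> \<le> Suc (nz (T (p 2)) \<theta>)"
    unfolding pf[symmetric]
  proof (rule T_shift)
    fix i assume i: "Suc i < m"
    have "nz (p 0) t \<le> Suc (nz (p 2) t)" for t using inter[of t 0] inter[of t 2] by linarith
    then show "x 2 i \<le> x 0 (Suc i)"
      unfolding x_def using i hp dp by (intro zeros_shift) auto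
  qed
  then have "nz (T (p 0)) \<theta> = nz (T (p 1)) \<theta> \<or> nz (T (p 1)) \<theta> = nz (T (p 2)) \<theta>"
    using le[of 0 1] le[of 1 2] by linarith
  then show ?thesis using key[of 0 1] key[of 1 2] by auto
qed

text \<open>\<open>V\<close> is the value at \<theta> of the complexified operator on (z - x)^m.
  Since the Q_k and \<theta> are real, real and imaginary parts can be taken before or
  after.\<close>

lemma poly_T_map_Re_Im:
  fixes x :: complex and m :: nat and \<theta> :: real
  defines "V \<equiv> (\<Sum>k=M..N. of_real (poly (Q k) \<theta> * ff m k) * (of_real \<theta> - x) ^ (m - k))"
  shows "poly (T (map_poly Re ([:- x, 1:] ^ m))) \<theta> = Re V"
    and "poly (T (map_poly Im ([:- x, 1:] ^ m))) \<theta> = Im V"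
  unfolding V_def diff_op_def poly_sum poly_mult pderiv_map_Re pderiv_map_Im poly_map_Re poly_map_Im
    higher_pderiv_linear_power
  by (simp_all add: mult.assoc)

text \<open>The approximants \<open>X m\<close> weight the coefficients by falling factorials that
  tend to 1 after scaling. A nonreal zero of one gives a nonreal x at which the complexified T((z -
  x)^(m+1)) vanishes at \<theta>; then T(u) vanishes at \<theta> for all u of degree at most m + 1,
  against Q_k(\<theta>) \<noteq> 0 for some k.\<close>

lemma symbol_hyperbolic: "symbol \<theta> = 0 \<or> hyperbolic (symbol \<theta>)"
proof (cases "symbol \<theta> = 0")
  case False
  note nz = this
  then obtain k0 where k0: "poly (Q k0) \<theta> \<noteq> 0" by (metis coeff_symbol leading_coeff_0_iff)
  then have k0N: "k0 \<in> {M..N}" using Q_outside[of k0] by force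
  define X where "X m = (\<Sum>k=M..N. smult (ff (Suc m) k / real (Suc m) ^ k) (monom (poly (Q k) \<theta>) k))" for m
  have coeffX: "coeff (X m) k = ff (Suc m) k / real (Suc m) ^ k * poly (Q k) \<theta>" for m k
  proof -
    have "coeff (X m) k = (\<Sum>k'=M..N. if k' = k then ff (Suc m) k / real (Suc m) ^ k * poly (Q k) \<theta> else 0)"
      unfolding X_def coeff_sum by (intro sum.cong) auto
    then show ?thesis using Q_outside[of k] by (cases "k \<in> {M..N}") auto
  qed
  have hypX: "hyperbolic (X m)" if m: "m \<ge> N" for m
    unfolding hyperbolic_def
  proof (intro conjI allI impI)
    have "ff (Suc m) k0 > 0" using k0N m by (intro ff_pos) auto
    then have "coeff (X m) k0 \<noteq> 0" using k0 by (simp add: coeffX)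
    then show "X m \<noteq> 0" by auto
    fix w assume w: "cpoly (X m) w = 0"
    show "w \<in> \<real>"
    proof (rule ccontr)
      assume nr: "w \<notin> \<real>"
      then have w0: "w \<noteq> 0" by auto
      \<comment> \<open>Chosen so that the value at \<theta> of the image of (z - x)^(m+1) is
        v^(m+1) times \<open>X m\<close> at w; being a real number divided by w, it is
        nonreal.\<close>
      define v where "v = of_real (real (Suc m)) / w"
      define x where "x = of_real \<theta> - v"
      have "Im x \<noteq> 0"
      proof
        assume "Im x = 0"
        then have "v \<in> \<real>" by (simp add: x_def complex_is_Real_iff)
        then have "of_real (real (Suc m)) / v \<in> \<real>" by (intro Reals_divide) auto
        moreover have "c / (c / w) = w" if "c \<noteq> 0" for c using that w0 by simp
        then have "of_real (real (Suc m)) / v = w"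
          unfolding v_def by (metis of_real_eq_0_iff of_nat_eq_0_iff nat.distinct(2))
        ultimately show False using nr by simp
      qed
      have degX: "degree (X m) \<le> N" by (rule degree_le) (simp add: coeffX Q_outside)
      have "(\<Sum>k=M..N. of_real (poly (Q k) \<theta> * ff (Suc m) k) * (of_real \<theta> - x) ^ (Suc m - k)) =
          v ^ Suc m * (\<Sum>k=M..N. of_real (coeff (X m) k) * w ^ k)"
        unfolding sum_distrib_left
      proof (rule sum.cong[OF refl])
        fix k assume k: "k \<in> {M..N}"
        have "v ^ Suc m = v ^ (Suc m - k) * v ^ k" using k m by (simp flip: power_add)
        moreover have "v ^ k * w ^ k = of_real (real (Suc m) ^ k)"
          using w0 by (simp add: v_def flip: power_mult_distrib)
        ultimately have vw: "v ^ Suc m * w ^ k = v ^ (Suc m - k) * of_real (real (Suc m) ^ k)"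
          by (simp only: mult.assoc)
        have "v ^ Suc m * (of_real (coeff (X m) k) * w ^ k) =
            of_real (coeff (X m) k) * (v ^ Suc m * w ^ k)"
          by (simp only: mult_ac)
        also have "\<dots> = v ^ (Suc m - k) * of_real (real (Suc m) ^ k * coeff (X m) k)"
          unfolding vw by (simp only: of_real_mult mult_ac)
        also have "real (Suc m) ^ k * coeff (X m) k = poly (Q k) \<theta> * ff (Suc m) k"
          by (simp add: coeffX)
        finally show "of_real (poly (Q k) \<theta> * ff (Suc m) k) * (of_real \<theta> - x) ^ (Suc m - k) =
            v ^ Suc m * (of_real (coeff (X m) k) * w ^ k)"
          by (simp add: x_def mult.commute)
      qed
      also have "(\<Sum>k=M..N. of_real (coeff (X m) k) * w ^ k) = (\<Sum>k\<le>N. of_real (coeff (X m) k) * w ^ k)"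
        by (rule sum.mono_neutral_left) (auto simp: coeffX Q_outside)
      also have "\<dots> = cpoly (X m) w"
        using degX by (subst poly_eq_sum_bound[of _ N]) (simp_all add: degree_map_poly coeff_map_poly)
      finally have V: "(\<Sum>k=M..N. of_real (poly (Q k) \<theta> * ff (Suc m) k) * (of_real \<theta> - x) ^ (Suc m - k)) = 0"
        using w by simp
      note pen = nonreal_power_pencil[OF \<open>Im x \<noteq> 0\<close>, where m = m]
      have van: "poly (T u) \<theta> = 0" if "degree u \<le> Suc m" for u
      proof (rule T_vanishes_of_pencil[OF pen(1) pen(2) pen(3) _ pen(4) pen(6) pen(7)])
        show "Suc m = Suc (degree (smult (- sgn (Im x)) (map_poly Im ([:- x, 1:] ^ Suc m))))"
          using pen(5) by simp
        show "M \<le> Suc m" using m MN by simp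
        show "poly (T (map_poly Re ([:- x, 1:] ^ Suc m))) \<theta> = 0"
          unfolding poly_T_map_Re_Im V by simp
        show "poly (T (smult (- sgn (Im x)) (map_poly Im ([:- x, 1:] ^ Suc m)))) \<theta> = 0"
          unfolding T_smult poly_smult poly_T_map_Re_Im V by simp
      qed (rule that)
      have "poly (T ([:- \<theta>, 1:] ^ k0)) \<theta> = 0"
        using k0N m by (intro van) (simp add: degree_power_eq)
      then have "coeff (symbol \<theta>) k0 * ff k0 k0 = 0"
        unfolding dual_symbol[symmetric] dual_power .
      then show False using k0 ff_pos[of k0 k0] by (simp add: coeff_symbol)
    qed
  qed
  have "hyperbolic (symbol \<theta>)"
  proof (rule pconv_hyperbolic[OF _ _ _ nz])
    show "degree (X (i + N)) \<le> N" for i by (rule degree_le) (simp add: coeffX Q_outside)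
    show "hyperbolic (X (i + N))" for i by (rule hypX) simp
    have "pconv X (\<Sum>k=M..N. smult 1 (monom (poly (Q k) \<theta>) k))"
      unfolding X_def by (intro pconv_sum pconv_smult tendsto_ff pconv_const)
    then have "pconv X (symbol \<theta>)" by (simp add: symbol_def)
    then show "pconv (\<lambda>i. X (i + N)) (symbol \<theta>)"
      unfolding pconv_def using LIMSEQ_ignore_initial_segment by blast
  qed
  then show ?thesis ..
qed simp

section \<open>From families of vanishing images to common zeros of the Q_k\<close>

lemma order_T_pf:
  assumes "n \<ge> M"
  shows "order a (T (pf n x)) = card {j. j < n + r \<and> zeros (T (pf n x)) ! j = a}"
  by (subst T_pf_factor[OF assms]) (simp add: order_smult lam_nz[OF assms] order_pf)

text \<open>The factor z - \<theta> dualizes to plain differentiation, which forgets the constant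
  term of the symbol. Hence nothing is obtained for Q_0, and vanishing coefficients of the
  derivative of the symbol shift up by one.\<close>

lemma symbol_simple_family:
  assumes fam: "\<And>u. degree u \<le> t \<Longrightarrow> poly (T (rp (add_mset \<theta> A) * u)) \<theta> = 0"
    and "\<theta> \<notin># A" "t \<ge> 1 \<or> A = {#}" "k \<in> {1..t + size A + 1}"
  shows "poly (Q k) \<theta> = 0"
proof -
  define S where "S = pderiv (symbol \<theta>) + smult (\<theta> - \<theta>) (symbol \<theta>)"
  have S: "S = 0 \<or> hyperbolic S"
    using symbol_hyperbolic[of \<theta>] hyperbolic_pderiv_add[of "symbol \<theta>" "\<theta> - \<theta>"] by (auto simp: S_def)
  have "coeff S (k - 1) = 0"
  proof (rule dual_vanishes[OF S])
    fix u :: "real poly" assume u: "degree u \<le> t"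
    have "dual \<theta> S (rp A * u) = dual \<theta> (symbol \<theta>) (rp (add_mset \<theta> A) * u)"
      unfolding S_def rp_add_mset mult.assoc dual_linear_mult ..
    then show "dual \<theta> S (rp A * u) = 0" using fam[OF u] by (simp only: dual_symbol)
  qed (use assms in auto)
  then show ?thesis using assms(4) by (simp add: S_def coeff_pderiv coeff_symbol)
qed

text \<open>If \<theta> has multiplicity c + 1 in the fixed factor, c of these copies are exchanged
  for degrees of freedom. This costs c orders and leaves at least one, with \<theta> a simple zero
  of the remaining factor.\<close>

lemma symbol_family:
  assumes fam: "\<And>u. degree u \<le> m \<Longrightarrow> [:- \<theta>, 1:] ^ j dvd T (rp A * u)"
    and j: "count A \<theta> \<le> j" "1 \<le> j" and m: "m \<ge> 1" and k: "k \<in> {1..m + size A}"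
  shows "poly (Q k) \<theta> = 0"
proof (cases "count A \<theta>")
  case 0
  have "coeff (symbol \<theta>) k = 0"
  proof (rule dual_vanishes[OF symbol_hyperbolic])
    fix u :: "real poly" assume "degree u \<le> m"
    then have "[:- \<theta>, 1:] ^ j dvd T (rp A * u)" by (rule fam)
    then have "[:- \<theta>, 1:] dvd T (rp A * u)" using j(2) by (metis dvd_power dvd_trans gr0I not_one_le_zero)
    then show "dual \<theta> (symbol \<theta>) (rp A * u) = 0" by (simp add: dual_symbol poly_eq_0_iff_dvd)
  qed (use 0 m k in \<open>auto simp: not_in_iff\<close>)
  then show ?thesis by (simp add: coeff_symbol)
next
  case (Suc c)
  define A1 where "A1 = filter_mset (\<lambda>x. x \<noteq> \<theta>) A"
  have A: "A = replicate_mset c \<theta> + add_mset \<theta> A1"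
    using Suc by (intro multiset_eqI) (auto simp: A1_def)
  have "poly (T (rp (add_mset \<theta> A1) * u)) \<theta> = 0" if u: "degree u \<le> m + c" for u
  proof -
    have "[:- \<theta>, 1:] ^ 1 dvd T (rp (add_mset \<theta> A1) * u)"
    proof (rule T_drop_repeat[OF _ u])
      fix v :: "real poly" assume "degree v \<le> m"
      then have "[:- \<theta>, 1:] ^ j dvd T (rp A * v)" by (rule fam)
      moreover have "[:- \<theta>, 1:] ^ (1 + c) dvd [:- \<theta>, 1:] ^ j"
        using j(1) Suc by (intro le_imp_power_dvd) simp
      ultimately show "[:- \<theta>, 1:] ^ (1 + c) dvd T (rp (replicate_mset c \<theta> + add_mset \<theta> A1) * v)"
        unfolding A[symmetric] by (rule dvd_trans[rotated])
    qed
    then show ?thesis by (simp add: poly_eq_0_iff_dvd del: rp_add_mset)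
  qed
  moreover have "m + size A = (m + c) + size A1 + 1" by (subst A) simp
  ultimately show ?thesis using m k by (intro symbol_simple_family) (auto simp: A1_def)
qed

text \<open>Here no freedom is given, only one surplus order at \<theta>. Exchanging c copies of
  \<theta> leaves order 2. If another zero a remains, the surplus is spent on exchanging it too,
  which provides the t \<ge> 1 needed by the duality argument.\<close>

lemma symbol_multiple:
  assumes dvd: "[:- \<theta>, 1:] ^ Suc (Suc c) dvd T (rp A)" and c: "count A \<theta> = Suc c" and k: "k \<in> {1..size A}"
  shows "poly (Q k) \<theta> = 0"
proof -
  define A1 where "A1 = filter_mset (\<lambda>x. x \<noteq> \<theta>) A"
  have A: "A = replicate_mset c \<theta> + add_mset \<theta> A1"
    using c by (intro multiset_eqI) (auto simp: A1_def)
  have fam: "[:- \<theta>, 1:] ^ 2 dvd T (rp (add_mset \<theta> A1) * u)" if u: "degree u \<le> 0 + c" for u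
  proof (rule T_drop_repeat[OF _ u])
    fix v :: "real poly" assume "degree v \<le> 0"
    then obtain a where "v = [:a:]" by (metis degree_eq_zeroE le_zero_eq)
    then have "T (rp A * v) = smult a (T (rp A))" by (simp add: T_smult)
    then show "[:- \<theta>, 1:] ^ (2 + c) dvd T (rp (replicate_mset c \<theta> + add_mset \<theta> A1) * v)"
      unfolding A[symmetric] using dvd by (simp add: dvd_smult del: power_Suc)
  qed
  show ?thesis
  proof (cases "A1 = {#}")
    case True
    have "poly (T (rp (add_mset \<theta> {#}) * u)) \<theta> = 0" if "degree u \<le> c" for u
    proof -
      have "[:- \<theta>, 1:] ^ 2 dvd T (rp (add_mset \<theta> {#}) * u)" using fam[of u] that True by simp
      then have "[:- \<theta>, 1:] dvd T (rp (add_mset \<theta> {#}) * u)"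
        by (metis dvd_mult_left power2_eq_square)
      then show ?thesis by (simp add: poly_eq_0_iff_dvd del: rp_add_mset)
    qed
    moreover have "size A = c + size ({#} :: real multiset) + 1" by (subst A) (simp add: True)
    ultimately show ?thesis
      using k by (intro symbol_simple_family[where t = c and A = "{#}"]) auto
  next
    case False
    then obtain a A2 where A2: "A1 = add_mset a A2" by (meson multiset_cases)
    have "poly (T (rp (add_mset \<theta> A2) * u)) \<theta> = 0" if u: "degree u \<le> Suc c" for u
    proof -
      have "[:- \<theta>, 1:] ^ 1 dvd T (rp (add_mset \<theta> A2) * u)"
      proof (rule T_drop_family[where c = a and m = c, OF hyperbolic_rp _ u])
        fix v :: "real poly" assume "degree v \<le> c"
        then have "[:- \<theta>, 1:] ^ 2 dvd T (rp (add_mset \<theta> A1) * v)" by (intro fam) simp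
        also have "rp (add_mset \<theta> A1) = [:- a, 1:] * rp (add_mset \<theta> A2)"
          unfolding A2 rp_add_mset by (simp only: mult_ac)
        finally show "[:- \<theta>, 1:] ^ Suc 1 dvd T ([:- a, 1:] * rp (add_mset \<theta> A2) * v)"
          by (simp only: numeral_2_eq_2 One_nat_def)
      qed
      then show ?thesis by (simp add: poly_eq_0_iff_dvd del: rp_add_mset)
    qed
    moreover have "size A = Suc c + size A2 + 1" by (subst A) (simp add: A2)
    moreover have "\<theta> \<notin># A2" using A2 by (metis (mono_tags, lifting) A1_def add_mset_remove_trivial filter_mset_eq_conv in_diffD)
    ultimately show ?thesis using k by (intro symbol_simple_family) auto
  qed
qed

text \<open>Distinct zeros of the list for f sit at distinct positions of the list for T(f), so
  multiplicities do not decrease. A position outside B with the same value is a zero of the cofactor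
  and makes the inequality strict.\<close>

lemma eigen_order:
  assumes n: "n \<ge> M" and B: "B \<subseteq> {1..n + r}" "card B = n"
    and \<xi>: "\<And>i. i < n \<Longrightarrow> \<xi> i = zeros (T (pf n \<xi>)) ! idx B i"
  shows "order a (pf n \<xi>) \<le> order a (T (pf n \<xi>))"
    and "l < n + r \<Longrightarrow> zeros (T (pf n \<xi>)) ! l = a \<Longrightarrow> (\<And>i. i < n \<Longrightarrow> idx B i \<noteq> l) \<Longrightarrow>
      order a (pf n \<xi>) < order a (T (pf n \<xi>))"
proof -
  define S where "S = idx B ` {i. i < n \<and> \<xi> i = a}"
  define J where "J = {j. j < n + r \<and> zeros (T (pf n \<xi>)) ! j = a}"
  have "inj_on (idx B) {i. i < n \<and> \<xi> i = a}"
  proof (rule inj_onI)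
    fix i j assume ij: "i \<in> {i. i < n \<and> \<xi> i = a}" "j \<in> {i. i < n \<and> \<xi> i = a}" "idx B i = idx B j"
    then show "i = j"
      using idx_strict_mono[OF B(1), of i j] idx_strict_mono[OF B(1), of j i] B(2)
      by (cases i j rule: linorder_cases) auto
  qed
  then have card: "card S = order a (pf n \<xi>)" unfolding S_def order_pf by (rule card_image)
  have sub: "S \<subseteq> J"
  proof
    fix l assume "l \<in> S"
    then obtain i where i: "i < n" "\<xi> i = a" "l = idx B i" by (auto simp: S_def)
    have "idx B i < n + r" using idx_less(1)[OF B(1), of i] B(2) i by simp
    then show "l \<in> J" using \<xi>[OF i(1)] i by (simp add: J_def)
  qed
  have fin: "finite J" by (simp add: J_def)
  have cJ: "card J = order a (T (pf n \<xi>))" by (simp add: J_def order_T_pf[OF n])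
  show "order a (pf n \<xi>) \<le> order a (T (pf n \<xi>))"
    using card_mono[OF fin sub] card cJ by simp
  show "order a (pf n \<xi>) < order a (T (pf n \<xi>))"
    if "l < n + r" "zeros (T (pf n \<xi>)) ! l = a" "\<And>i. i < n \<Longrightarrow> idx B i \<noteq> l"
  proof -
    have "l \<in> J" "l \<notin> S" using that by (auto simp: J_def S_def)
    then have "S \<subset> J" using sub by blast
    then show ?thesis using psubset_card_mono[OF fin \<open>S \<subset> J\<close>] card cJ by simp
  qed
qed

lemma symbol_mixed:
  assumes mix: "\<And>z. (\<And>i. i < n \<Longrightarrow> z i \<in> {x i, y i}) \<Longrightarrow> [:- \<theta>, 1:] ^ j dvd T (pf n z)"
    and j: "card {i. i < n \<and> x i = y i \<and> x i = \<theta>} \<le> j" "1 \<le> j"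
    and i: "i < n" "x i \<noteq> y i" and k: "k \<in> {1..n}"
  shows "poly (Q k) \<theta> = 0"
proof -
  define F where "F = {i. i < n \<and> x i = y i}"
  define G where "G = {i. i < n \<and> x i \<noteq> y i}"
  have fin: "finite F" "finite G" by (simp_all add: F_def G_def)
  have "card (F \<union> G) = card F + card G"
    by (rule card_Un_disjoint) (auto simp: F_def G_def)
  moreover have "F \<union> G = {..<n}" by (auto simp: F_def G_def)
  ultimately have FG: "card F + card G = n" by simp
  have G1: "card G \<ge> 1" using i fin by (auto simp: G_def Suc_le_eq card_gt_0_iff)
  have "{i \<in> F. x i = \<theta>} = {i. i < n \<and> x i = y i \<and> x i = \<theta>}" by (auto simp: F_def)
  then have "count (image_mset x (mset_set F)) \<theta> \<le> j"
    using j(1) fin by (simp add: count_image_mset_set)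
  then show ?thesis
  proof (rule symbol_family[where m = "card G", rotated])
    show "[:- \<theta>, 1:] ^ j dvd T (rp (image_mset x (mset_set F)) * u)" if "degree u \<le> card G" for u
      unfolding F_def
    proof (rule T_mixed_span)
      show "[:- \<theta>, 1:] ^ j dvd T (pf n z)" if "\<And>i. i < n \<Longrightarrow> z i \<in> {x i, y i}" for z
        by (rule mix[OF that])
    qed (use that in \<open>simp add: G_def\<close>)
  qed (use k FG G1 j in auto)
qed

text \<open>Case analysis for a common zero \<open>\<theta>\<close>. If the two eigenpolynomials agree, \<open>B \<noteq> C\<close> forces
  \<open>\<theta>\<close> to be a common zero of \<open>v\<close> and \<open>f\<close>. Otherwise the zeros of \<open>T f\<close> and \<open>T g\<close> at \<open>\<theta>\<close> have the same
  positions up to a shift by one, so they persist for every mixture of the zeros of \<open>f\<close> and \<open>g\<close>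
  (aligned according to the shift), and hence for a whole linear family.\<close>

lemma common_zero_symbol:
  assumes n: "n \<ge> M" and B: "B \<subseteq> {1..n + r}" "card B = n" and C: "C \<subseteq> {1..n + r}" "card C = n"
    and arr: "arrow B C" and BC: "B \<noteq> C"
    and \<xi>: "\<And>i. i < n \<Longrightarrow> \<xi> i = zeros (T (pf n \<xi>)) ! idx B i"
    and \<eta>: "\<And>i. i < n \<Longrightarrow> \<eta> i = zeros (T (pf n \<eta>)) ! idx C i"
    and xy: "\<And>i. i < n \<Longrightarrow> \<xi> i \<le> \<eta> i" and yx: "\<And>i. Suc i < n \<Longrightarrow> \<eta> i \<le> \<xi> (Suc i)"
    and pq: "p < n" "p' < n" "\<xi> p = \<eta> p'"
  shows "\<exists>\<theta>. \<forall>k\<in>{1..n}. poly (Q k) \<theta> = 0"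
proof (cases "\<forall>i<n. \<xi> i = \<eta> i")
  case True
  note ar = arrow_idx[OF arr B(1) C(1) B(2) C(2)]
  have fg: "pf n \<xi> = pf n \<eta>" using True by (intro pf_cong) auto
  have "\<exists>i<n. idx B i \<noteq> idx C i"
  proof (rule ccontr)
    assume "\<not> ?thesis"
    then have same: "idx B i = idx C i" if "i < n" for i using that by blast
    have "sorted_list_of_set B = sorted_list_of_set C"
    proof (rule nth_equalityI)
      show "length (sorted_list_of_set B) = length (sorted_list_of_set C)" using B C by simp
      fix i assume "i < length (sorted_list_of_set B)"
      then have i: "i < n" using B by simp
      have "sorted_list_of_set B ! i = Suc (idx B i)" using idx_less(2)[OF B(1), of i] B(2) i by simp
      also have "\<dots> = Suc (idx C i)" using same[OF i] by simp
      also have "\<dots> = sorted_list_of_set C ! i" using idx_less(2)[OF C(1), of i] C(2) i by simp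
      finally show "sorted_list_of_set B ! i = sorted_list_of_set C ! i" .
    qed
    moreover have "finite B" "finite C" using B C finite_subset by blast+
    ultimately show False using BC by (metis set_sorted_list_of_set)
  qed
  then obtain i where i: "i < n" "idx B i < idx C i" using ar(1) by (meson le_neq_implies_less)
  define \<theta> where "\<theta> = \<xi> i"
  \<comment> \<open>The arrow relation puts position i of C strictly between positions i and i + 1
    of B, hence outside B; so \<theta> is a zero of T(f) not taken up by f.\<close>
  have out: "idx B j \<noteq> idx C i" if j: "j < n" for j
  proof (cases "j \<le> i")
    case True
    then have "idx B j \<le> idx B i"
      using idx_strict_mono[OF B(1), of j i] B(2) i by (cases "j = i") auto
    then show ?thesis using i by simp
  next
    case False
    then have "Suc i < n" "Suc i \<le> j" using j by auto
    then have "idx B (Suc i) \<le> idx B j"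
      using idx_strict_mono[OF B(1), of "Suc i" j] B(2) j by (cases "Suc i = j") auto
    then show ?thesis using ar(2)[OF \<open>Suc i < n\<close>] by simp
  qed
  have "zeros (T (pf n \<xi>)) ! idx C i = \<theta>"
    using \<eta>[OF i(1)] True i unfolding fg \<theta>_def by simp
  moreover have "idx C i < n + r" using idx_less(1)[OF C(1), of i] C(2) i by simp
  ultimately have lt: "order \<theta> (pf n \<xi>) < order \<theta> (T (pf n \<xi>))"
    using out by (intro eigen_order(2)[OF n B \<xi>])
  have "{j. j < n \<and> \<xi> j = \<theta>} \<noteq> {}" using i by (auto simp: \<theta>_def)
  then have "order \<theta> (pf n \<xi>) > 0" by (simp add: order_pf card_gt_0_iff)
  then obtain c where c: "order \<theta> (pf n \<xi>) = Suc c" using gr0_implies_Suc by blast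
  have "[:- \<theta>, 1:] ^ Suc (Suc c) dvd T (pf n \<xi>)" using lt c by (intro iffD2[OF order_divides]) simp
  moreover have "count (image_mset \<xi> (mset_set {..<n})) \<theta> = Suc c"
    using c by (simp add: count_image_mset_set order_pf)
  ultimately have "poly (Q k) \<theta> = 0" if "k \<in> {1..n}" for k
    using that unfolding pf_rp by (intro symbol_multiple[of \<theta> c "image_mset \<xi> (mset_set {..<n})"]) auto
  then show ?thesis by blast
next
  case False
  define \<theta> where "\<theta> = \<xi> p"
  \<comment> \<open>The minimum is at most both multiplicities in the images and still at least the
    multiplicity of \<theta> among the entries common to the two vectors, as
    \<open>symbol_mixed\<close> requires.\<close>
  define j where "j = min (order \<theta> (pf n \<xi>)) (order \<theta> (pf n \<eta>))"
  have "{i. i < n \<and> \<xi> i = \<theta>} \<noteq> {}" "{i. i < n \<and> \<eta> i = \<theta>} \<noteq> {}" using pq by (auto simp: \<theta>_def)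
  then have j1: "1 \<le> j" by (simp add: j_def order_pf Suc_le_eq card_gt_0_iff)
  have "j \<le> order \<theta> (T (pf n \<xi>))" "j \<le> order \<theta> (T (pf n \<eta>))"
    using eigen_order(1)[OF n B \<xi>, of \<theta>] eigen_order(1)[OF n C \<eta>, of \<theta>] by (simp_all add: j_def)
  then have dvd: "[:- \<theta>, 1:] ^ j dvd T (pf n \<xi>)" "[:- \<theta>, 1:] ^ j dvd T (pf n \<eta>)"
    using order_divides by blast+
  have "nz (T (pf n \<eta>)) \<theta> \<le> nz (T (pf n \<xi>)) \<theta>" by (rule T_mono_pf) (rule xy)
  moreover have "nz (T (pf n \<xi>)) \<theta> \<le> Suc (nz (T (pf n \<eta>)) \<theta>)" by (rule T_shift) (rule yx)
  ultimately consider (same) "nz (T (pf n \<xi>)) \<theta> = nz (T (pf n \<eta>)) \<theta>"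
    | (shift) "nz (T (pf n \<xi>)) \<theta> = Suc (nz (T (pf n \<eta>)) \<theta>)" by linarith
  then show ?thesis
  proof cases
    case same
    have mix: "[:- \<theta>, 1:] ^ j dvd T (pf n z)" if "\<And>i. i < n \<Longrightarrow> z i \<in> {\<xi> i, \<eta> i}" for z
      by (rule T_mixed_order[OF n xy same dvd(1) that])
    have "card {i. i < n \<and> \<xi> i = \<eta> i \<and> \<xi> i = \<theta>} \<le> card {i. i < n \<and> \<xi> i = \<theta>}"
      "card {i. i < n \<and> \<xi> i = \<eta> i \<and> \<xi> i = \<theta>} \<le> card {i. i < n \<and> \<eta> i = \<theta>}"
      by (rule card_mono; auto)+
    then have le: "card {i. i < n \<and> \<xi> i = \<eta> i \<and> \<xi> i = \<theta>} \<le> j"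
      by (simp add: j_def order_pf)
    obtain i where i: "i < n" "\<xi> i \<noteq> \<eta> i" using False by blast
    have "poly (Q k) \<theta> = 0" if "k \<in> {1..n}" for k
      by (rule symbol_mixed[where x = \<xi> and y = \<eta> and n = n, OF mix le j1 i that])
    then show ?thesis by blast
  next
    case shift
    \<comment> \<open>The zeros of g are aligned with the next zeros of f. The last one has no
      partner and may move right freely; any larger value serves, and it makes the vectors differ in
      at least one position.\<close>
    define y where "y i = (if Suc i < n then \<xi> (Suc i) else \<eta> i + 1)" for i
    have mix: "[:- \<theta>, 1:] ^ j dvd T (pf n z)" if z: "\<And>i. i < n \<Longrightarrow> z i \<in> {\<eta> i, y i}" for z
    proof (rule T_mixed_order_shift[OF n yx shift dvd(2)])
      show "z i \<in> {\<eta> i, \<xi> (Suc i)}" if "Suc i < n" for i using z[of i] that by (simp add: y_def)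
      show "\<eta> i \<le> z i" if "n = Suc i" for i using z[of i] that by (auto simp: y_def)
    qed
    let ?S = "{i. i < n \<and> \<eta> i = y i \<and> \<eta> i = \<theta>}"
    have "card ?S \<le> card {i. i < n \<and> \<eta> i = \<theta>}"
      by (rule card_mono) auto
    \<comment> \<open>Coincidences of the aligned vectors at i are zeros of f at i + 1, so the
      shifted set bounds their number by the multiplicity of \<theta> in f.\<close>
    moreover have "card ?S = card (Suc ` ?S)"
      by (rule card_image[symmetric]) simp
    moreover have "card (Suc ` ?S) \<le> card {i. i < n \<and> \<xi> i = \<theta>}"
      by (rule card_mono) (auto simp: y_def split: if_splits)
    ultimately have le: "card ?S \<le> j" by (simp add: j_def order_pf)
    have last: "n - 1 < n" "\<eta> (n - 1) \<noteq> y (n - 1)" using pq(1) by (auto simp: y_def)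
    have "poly (Q k) \<theta> = 0" if "k \<in> {1..n}" for k
      by (rule symbol_mixed[where x = \<eta> and y = y and n = n, OF mix le j1 last that])
    then show ?thesis by blast
  qed
qed

lemma eigenpolys_interlace:
  assumes n: "n \<ge> M" and B: "B \<subseteq> {1..n + r}" "card B = n" and C: "C \<subseteq> {1..n + r}" "card C = n"
    and arr: "arrow B C"
  shows "proper_position (eigenpoly Q M N r n B) (eigenpoly Q M N r n C) \<and>
    (B \<noteq> C \<and> \<not> (\<exists>\<theta>. \<forall>k\<in>{1..n}. poly (Q k) \<theta> = 0) \<longrightarrow>
       coprime (eigenpoly Q M N r n B) (eigenpoly Q M N r n C) \<and>
       strictly_interlace (eigenpoly Q M N r n B) (eigenpoly Q M N r n C))"
proof -
  obtain \<xi> where \<xi>: "\<And>i. i < n \<Longrightarrow> (\<lambda>k. iter n B k i) \<longlonglongrightarrow> \<xi> i"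
    "eigenpoly Q M N r n B = pf n \<xi>" "\<And>i. i < n \<Longrightarrow> \<xi> i = zeros (T (pf n \<xi>)) ! idx B i"
    using eigenpoly_limit[OF n B] by blast
  obtain \<eta> where \<eta>: "\<And>i. i < n \<Longrightarrow> (\<lambda>k. iter n C k i) \<longlonglongrightarrow> \<eta> i"
    "eigenpoly Q M N r n C = pf n \<eta>" "\<And>i. i < n \<Longrightarrow> \<eta> i = zeros (T (pf n \<eta>)) ! idx C i"
    using eigenpoly_limit[OF n C] by blast
  note it = iter_interlace[OF n B C arr]
  have xy: "\<xi> i \<le> \<eta> i" if i: "i < n" for i
    by (rule LIMSEQ_le[OF \<xi>(1)[OF i] \<eta>(1)[OF i]]) (use it i in blast)
  have yx: "\<eta> i \<le> \<xi> (Suc i)" if i: "Suc i < n" for i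
    by (rule LIMSEQ_le[OF \<eta>(1)[OF Suc_lessD[OF i]] \<xi>(1)[OF i]]) (use it i in blast)
  show ?thesis unfolding \<xi>(2) \<eta>(2)
  proof (intro conjI[OF proper_position_pf[of n \<xi> \<eta>, OF xy yx]] impI)
    assume *: "B \<noteq> C \<and> \<not> (\<exists>\<theta>. \<forall>k\<in>{1..n}. poly (Q k) \<theta> = 0)"
    have ne: "\<xi> i \<noteq> \<eta> j" if "i < n" "j < n" for i j
      using * common_zero_symbol[OF n B C arr _ \<xi>(3) \<eta>(3) xy yx that] by blast
    show "coprime (pf n \<xi>) (pf n \<eta>) \<and> strictly_interlace (pf n \<xi>) (pf n \<eta>)"
      using strictly_interlace_pf[of n \<xi> \<eta>, OF xy yx ne] by blast
  qed
qed

end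

theorem theorem4p3:
  fixes Q :: "nat \<Rightarrow> real poly" and M N n r :: nat and B C :: "nat set"
  assumes "\<And>k. k < M \<or> k > N \<Longrightarrow> Q k = 0"
    and "M \<le> N" and "Q M * Q N \<noteq> 0"
    and "hyperbolicity_preserver (diff_op Q M N)"
    and "fuchs_index Q M N = int r"
    and "non_degenerate Q M N"
    and "n \<ge> M"
    and "B \<subseteq> {1..n + r}" and "card B = n"
    and "C \<subseteq> {1..n + r}" and "card C = n"
    and "arrow B C"
  shows "proper_position (eigenpoly Q M N r n B) (eigenpoly Q M N r n C) \<and>
    (B \<noteq> C \<and> \<not> (\<exists>\<theta>. \<forall>k\<in>{1..n}. poly (Q k) \<theta> = 0) \<longrightarrow>
       coprime (eigenpoly Q M N r n B) (eigenpoly Q M N r n C) \<and>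
       strictly_interlace (eigenpoly Q M N r n B) (eigenpoly Q M N r n C))"
proof -
  interpret fuchsian_preserver Q M N r
    by unfold_locales fact+
  show ?thesis by (rule eigenpolys_interlace) fact+
qed

end
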